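(* Let $l,m\ge0$ and $P_{l,m}=\left[(\mathrm{Im}\,\mathbb{O}^* )^{\otimes l}\otimes(\mathbb{O}^* )^{\otimes m}\right]^{\mathrm{Spin}(7)}$, viewed as the space of $\mathrm{Spin}(7)$-invariant multilinear functions of $u_1,\dots,u_l\in\mathrm{Im}\,\mathbb{O}$ and $x_1,\dots,x_m\in\mathbb{O}$. Then $P_{l,m}$ is spanned by products of the following functions: $$\begin{aligned}&\langle u_{j_1},u_{j_2}\rangle,&&1\le j_1<j_2\le l;\\&\det(u_{j_1},\dots,u_{j_7}),&&1\le j_1<\cdots<j_7\le l;\\&\langle x_{k_1},L_{u_{j_1}}\cdots L_{u_{j_r}}(x_{k_2})\rangle,&&0\le r\le7,\ 1\le j_1<\cdots<j_r\le l,\ 1\le k_1<k_2\le m;\\&\Phi(x_{k_1},x_{k_2},x_{k_3},x_{k_4}),&&1\le k_1<\cdots<k_4\le m;\\&\Phi(u_jx_{k_1},x_{k_2},x_{k_3},x_{k_4}),&&1\le k_1<\cdots<k_4\le m,\ 1\le j\le l;\end{aligned}$$ such that each of the variables $u_1,\dots,u_l,x_1,\dots,x_m$ occurs exactly once.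
   Context: $\mathbb{O}$ denotes the octonions: $\mathbb{R}^8$ with standard orthonormal basis $e_0=1,e_1,\dots,e_7$ and the bilinear product with unit $e_0$, $e_i^2=-e_0$ and $e_ie_j=-e_je_i$ for distinct $i,j\in\{1,\dots,7\}$, and $e_ie_j=e_k,\ e_je_k=e_i,\ e_ke_i=e_j$ for $(i,j,k)\in\{(1,2,4),(2,3,5),(3,4,6),(4,5,7),(5,6,1),(6,7,2),(7,1,3)\}$. $\mathrm{Im}\,\mathbb{O}=\mathrm{span}(e_1,\dots,e_7)$, $\overline x=\mathrm{Re}(x)-\mathrm{Im}(x)$, $\langle\cdot,\cdot\rangle$ is the Euclidean inner product, $L_w(x)=wx$. $\det$ on $\mathrm{Im}\,\mathbb{O}$ is normalized by $\det(e_1,\dots,e_7)=1$. The Cayley calibration is $\Phi(w,x,y,z)=\langle w,x\times y\times z\rangle$ with $x\times y\times z=\frac12\big[(x\overline y)z-(z\overline y)x\big]$. $\mathrm{Spin}(7)\subset\mathrm{SO}(8)$ is the subgroup of $\mathrm{GL}(\mathbb{O})$ generated by $L_u$, $u\in\mathrm{Im}\,\mathbb{O}$, $|u|=1$; it acts on $\mathbb{O}$ by $g$ (spin representation) and on $\mathrm{Im}\,\mathbb{O}$ by $\chi_g(u)=g(u\cdot g^{-1}(1))$ (vector representation). *)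

theory Defs
  imports
    "HOL-Analysis.Analysis"
    "HOL-Algebra.Generated_Groups"
    "HOL-Library.Function_Algebras"
begin

text \<open>
  The index type \<open>8\<close> is the type of integers modulo 8, whose elements are
  \<open>0, \<dots>, 7\<close>. The algebra product is written \<open>\<odot>\<close>: the library's \<open>*\<close> on vectors is
  componentwise.
\<close>

type_synonym octonion = "real ^ 8"

definition oct_e :: "8 \<Rightarrow> octonion" where
  "oct_e i = axis i 1"

definition oct_triples :: "(8 \<times> 8 \<times> 8) set" where
  "oct_triples =
     (\<Union>(i, j, k) \<in> {(1,2,4), (2,3,5), (3,4,6), (4,5,7), (5,6,1), (6,7,2), (7,1,3)}.
        {(i, j, k), (j, k, i), (k, i, j)})"

text \<open>\<open>oct_coeff i j k\<close> is the \<open>k\<close>-th coordinate of the product of \<open>oct_e i\<close> and \<open>oct_e j\<close>.\<close>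

definition oct_coeff :: "8 \<Rightarrow> 8 \<Rightarrow> 8 \<Rightarrow> real" where
  "oct_coeff i j k =
     (if i = 0 then of_bool (k = j)
      else if j = 0 then of_bool (k = i)
      else if i = j then - of_bool (k = 0)
      else of_bool ((i, j, k) \<in> oct_triples) - of_bool ((j, i, k) \<in> oct_triples))"

definition oct_mult :: "octonion \<Rightarrow> octonion \<Rightarrow> octonion" (infixl \<open>\<odot>\<close> 70) where
  "x \<odot> y = (\<chi> k. \<Sum>i\<in>UNIV. \<Sum>j\<in>UNIV. oct_coeff i j k * x $ i * y $ j)"

definition Im_oct :: "octonion set" where
  "Im_oct = span (oct_e ` {1, 2, 3, 4, 5, 6, 7})"

definition oct_cnj :: "octonion \<Rightarrow> octonion" where
  "oct_cnj x = x $ 0 *\<^sub>R oct_e 0 - (x - x $ 0 *\<^sub>R oct_e 0)"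

definition triple_cross :: "octonion \<Rightarrow> octonion \<Rightarrow> octonion \<Rightarrow> octonion" where
  "triple_cross x y z = (1 / 2) *\<^sub>R ((x \<odot> oct_cnj y) \<odot> z - (z \<odot> oct_cnj y) \<odot> x)"

definition Cayley_form :: "octonion \<Rightarrow> octonion \<Rightarrow> octonion \<Rightarrow> octonion \<Rightarrow> real" where
  "Cayley_form w x y z = w \<bullet> triple_cross x y z"

text \<open>
  The determinant of seven imaginary octonions is that of their coordinates in the
  basis \<open>oct_e 1, \<dots>, oct_e 7\<close>. It is only meant for lists of length 7.
\<close>

definition det_Im :: "octonion list \<Rightarrow> real" where
  "det_Im us =
     det (vector (map (\<lambda>u. vector [u $ 1, u $ 2, u $ 3, u $ 4, u $ 5, u $ 6, u $ 7]) us)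
            :: real ^ 7 ^ 7)"

definition GL_oct :: "(octonion \<Rightarrow> octonion) monoid" where
  "GL_oct = \<lparr>carrier = {g. linear g \<and> bij g}, monoid.mult = (\<circ>), one = id\<rparr>"

definition Spin7 :: "(octonion \<Rightarrow> octonion) set" where
  "Spin7 = generate GL_oct {(\<odot>) u | u. u \<in> Im_oct \<and> norm u = 1}"

definition vector_rep :: "(octonion \<Rightarrow> octonion) \<Rightarrow> octonion \<Rightarrow> octonion" where
  "vector_rep g u = g (u \<odot> inv_into UNIV g (oct_e 0))"

text \<open>
  A function of \<open>u\<^sub>1, \<dots>, u\<^sub>l\<close> in \<open>Im_oct\<close> and \<open>x\<^sub>1, \<dots>, x\<^sub>m\<close> is represented by a function
  that vanishes outside the tuples below, so that equality of functions is equality on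
  these tuples.
\<close>

definition u_tuples :: "nat \<Rightarrow> (nat \<Rightarrow> octonion) set" where
  "u_tuples l = {1..l} \<rightarrow>\<^sub>E Im_oct"

definition x_tuples :: "nat \<Rightarrow> (nat \<Rightarrow> octonion) set" where
  "x_tuples m = {1..m} \<rightarrow>\<^sub>E UNIV"

type_synonym tuple_fun = "(nat \<Rightarrow> octonion) \<Rightarrow> (nat \<Rightarrow> octonion) \<Rightarrow> real"

definition restrict_tuples :: "nat \<Rightarrow> nat \<Rightarrow> tuple_fun \<Rightarrow> tuple_fun" where
  "restrict_tuples l m f = (\<lambda>u x. if u \<in> u_tuples l \<and> x \<in> x_tuples m then f u x else 0)"

definition multilinear_fun :: "nat \<Rightarrow> nat \<Rightarrow> tuple_fun \<Rightarrow> bool" where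
  "multilinear_fun l m f \<longleftrightarrow>
     (\<forall>u\<in>u_tuples l. \<forall>x\<in>x_tuples m.
        (\<forall>j\<in>{1..l}.
           (\<forall>v\<in>Im_oct. \<forall>w\<in>Im_oct. f (u(j := v + w)) x = f (u(j := v)) x + f (u(j := w)) x) \<and>
           (\<forall>c. \<forall>v\<in>Im_oct. f (u(j := c *\<^sub>R v)) x = c * f (u(j := v)) x)) \<and>
        (\<forall>k\<in>{1..m}. linear (\<lambda>y. f u (x(k := y)))))"

definition Spin7_invariant :: "nat \<Rightarrow> nat \<Rightarrow> tuple_fun \<Rightarrow> bool" where
  "Spin7_invariant l m f \<longleftrightarrow>
     (\<forall>g\<in>Spin7. \<forall>u\<in>u_tuples l. \<forall>x\<in>x_tuples m.
        f (\<lambda>j\<in>{1..l}. vector_rep g (u j)) (\<lambda>k\<in>{1..m}. g (x k)) = f u x)"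

definition invariant_space :: "nat \<Rightarrow> nat \<Rightarrow> tuple_fun set" where
  "invariant_space l m =
     {f. restrict_tuples l m f = f \<and> multilinear_fun l m f \<and> Spin7_invariant l m f}"

text \<open>
  \<open>generator J K f\<close> means that \<open>f\<close> is one of the basic functions and that the variables
  occurring in it (exactly once each) are \<open>u\<^sub>j\<close> for \<open>j \<in> J\<close> and \<open>x\<^sub>k\<close> for \<open>k \<in> K\<close>.
\<close>

inductive generator :: "nat set \<Rightarrow> nat set \<Rightarrow> tuple_fun \<Rightarrow> bool" where
  inner_u: "j1 < j2 \<Longrightarrow> generator {j1, j2} {} (\<lambda>u x. u j1 \<bullet> u j2)"
| det_u: "sorted_wrt (<) js \<Longrightarrow> length js = 7 \<Longrightarrow>
    generator (set js) {} (\<lambda>u x. det_Im (map u js))"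
| inner_x: "sorted_wrt (<) js \<Longrightarrow> length js \<le> 7 \<Longrightarrow> k1 < k2 \<Longrightarrow>
    generator (set js) {k1, k2} (\<lambda>u x. x k1 \<bullet> foldr (\<lambda>j y. u j \<odot> y) js (x k2))"
| Cayley: "k1 < k2 \<Longrightarrow> k2 < k3 \<Longrightarrow> k3 < k4 \<Longrightarrow>
    generator {} {k1, k2, k3, k4} (\<lambda>u x. Cayley_form (x k1) (x k2) (x k3) (x k4))"
| Cayley_u: "k1 < k2 \<Longrightarrow> k2 < k3 \<Longrightarrow> k3 < k4 \<Longrightarrow>
    generator {j} {k1, k2, k3, k4} (\<lambda>u x. Cayley_form (u j \<odot> x k1) (x k2) (x k3) (x k4))"

text \<open>
  \<open>gen_product J K p\<close>: \<open>p\<close> is a (possibly empty) product of basic functions in which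
  each \<open>u\<^sub>j\<close>, \<open>j \<in> J\<close>, and each \<open>x\<^sub>k\<close>, \<open>k \<in> K\<close>, occurs exactly once, and no other variable
  occurs. For \<open>J = {1..l}\<close> and \<open>K = {1..m}\<close> this bounds all indices by \<open>l\<close> and \<open>m\<close>.
\<close>

inductive gen_product :: "nat set \<Rightarrow> nat set \<Rightarrow> tuple_fun \<Rightarrow> bool" where
  empty: "gen_product {} {} (\<lambda>u x. 1)"
| times: "generator J K f \<Longrightarrow> gen_product J' K' p \<Longrightarrow> J \<inter> J' = {} \<Longrightarrow> K \<inter> K' = {} \<Longrightarrow>
    gen_product (J \<union> J') (K \<union> K') (\<lambda>u x. f u x * p u x)"

definition span_fun :: "tuple_fun set \<Rightarrow> tuple_fun set" where
  "span_fun = module.span (\<lambda>c f u x. c * f u x)"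

end

theory Submission
  imports Defs "HOL-Combinatorics.Permutations"
begin

text \<open>
  Why the theorem holds.  For a unit vector \<open>w\<close> the generator \<open>L\<^sub>w\<close> of the group acts on vectors as
  the half turn \<open>u \<mapsto> 2\<langle>u, w\<rangle>w - u\<close> and satisfies \<open>L\<^bsub>\<chi>u\<^esub> L\<^sub>w = L\<^sub>w L\<^sub>u\<close>.  Hence all basic functions are
  invariant, which is the easy inclusion.  For the converse, an invariant function of \<open>l\<close> vectors
  and \<open>m\<close> spinors is reduced to invariants of vectors alone, at the cost of contractions, and the
  products of basic functions are shown to be stable under contraction.

  \<^item> Vectors only (\<open>FFT_vectors\<close>).  Half turns generate the rotations, so differentiating
    gives invariance under infinitesimal rotations.  The Casimir operator of one variable then yields
    \<open>6 f + \<Sum>\<^sub>i f \<circ> (k i) = \<Sum>\<^sub>i \<langle>u\<^sub>k, u\<^sub>i\<rangle> C\<^bsub>ki\<^esub> f\<close>, where \<open>C\<^bsub>ki\<^esub>\<close> contracts two variables.  Modulo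
    products, which are covered by induction, the transpositions thus act on \<open>f\<close> in a prescribed way,
    and this forces \<open>f\<close> to be a combination of functions that alternate in one more variable.  An
    alternating function of eight vectors vanishes and one of exactly seven is a multiple of the determinant.

  \<^item> Removing two spinors (\<open>invar_spanned\<close>).  The Fierz identity writes
    \<open>x \<otimes> y\<close> as a combination of the functions \<open>\<langle>y, L\<^sub>a\<^sub>1 \<dots> L\<^sub>a\<^sub>s x\<rangle>\<close> with \<open>s \<le> 3\<close>, summed over basis vectors.
    So \<open>f\<close> is a contraction of such brackets with invariants in two spinors fewer.  One
    remaining spinor is impossible since \<open>-1\<close> lies in the group.

  \<^item> Contraction (\<open>contr_spanned\<close>).  Everything rests on one identity,
    \<open>\<Sum>\<^sub>a \<langle>x, e\<^sub>a z\<rangle>\<langle>y, e\<^sub>a w\<rangle> = \<langle>z, w\<rangle>\<langle>x, y\<rangle> - \<langle>x, w\<rangle>\<langle>y, z\<rangle> - \<Phi>(x, y, z, w)\<close>, and on the Clifford relations.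
    They imply that a vector inside \<open>\<Phi>\<close> may be moved from one argument to another modulo products
    (\<open>phi_move\<close>), that \<open>\<Phi>\<close> with two vectors inside is a combination of products, and that a
    bracket contracted with \<open>\<Phi>\<close> is one too (\<open>bracket_phi_formula\<close>).  A determinant is
    absorbed by a bracket since the alternation of \<open>L\<^sub>u\<^sub>1 \<dots> L\<^sub>u\<^sub>7\<close> is \<open>-7! det(u\<^sub>1, \<dots>, u\<^sub>7)\<close> (\<open>alternated_word\<close>);
    this also bounds the length of brackets by seven.
\<close>

section \<open>The octonions and their Clifford relations\<close>

lemma UNIV_8: "(UNIV :: 8 set) = {0, 1, 2, 3, 4, 5, 6, 7}"
proof -
  have "card {0, 1, 2, 3, 4, 5, 6, 7 :: 8} = CARD(8)" by simp
  from card_subset_eq[OF _ _ this] show ?thesis by simp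
qed

lemma neq_8_0: "(0::8) \<noteq> 1" "(0::8) \<noteq> 2" "(0::8) \<noteq> 3" "(0::8) \<noteq> 4" "(0::8) \<noteq> 5" "(0::8) \<noteq> 6" "(0::8) \<noteq> 7" by simp_all
lemma neq_8_1: "(1::8) \<noteq> 0" "(1::8) \<noteq> 2" "(1::8) \<noteq> 3" "(1::8) \<noteq> 4" "(1::8) \<noteq> 5" "(1::8) \<noteq> 6" "(1::8) \<noteq> 7" by simp_all
lemma neq_8_2: "(2::8) \<noteq> 0" "(2::8) \<noteq> 1" "(2::8) \<noteq> 3" "(2::8) \<noteq> 4" "(2::8) \<noteq> 5" "(2::8) \<noteq> 6" "(2::8) \<noteq> 7" by simp_all
lemma neq_8_3: "(3::8) \<noteq> 0" "(3::8) \<noteq> 1" "(3::8) \<noteq> 2" "(3::8) \<noteq> 4" "(3::8) \<noteq> 5" "(3::8) \<noteq> 6" "(3::8) \<noteq> 7" by simp_all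
lemma neq_8_4: "(4::8) \<noteq> 0" "(4::8) \<noteq> 1" "(4::8) \<noteq> 2" "(4::8) \<noteq> 3" "(4::8) \<noteq> 5" "(4::8) \<noteq> 6" "(4::8) \<noteq> 7" by simp_all
lemma neq_8_5: "(5::8) \<noteq> 0" "(5::8) \<noteq> 1" "(5::8) \<noteq> 2" "(5::8) \<noteq> 3" "(5::8) \<noteq> 4" "(5::8) \<noteq> 6" "(5::8) \<noteq> 7" by simp_all
lemma neq_8_6: "(6::8) \<noteq> 0" "(6::8) \<noteq> 1" "(6::8) \<noteq> 2" "(6::8) \<noteq> 3" "(6::8) \<noteq> 4" "(6::8) \<noteq> 5" "(6::8) \<noteq> 7" by simp_all
lemma neq_8_7: "(7::8) \<noteq> 0" "(7::8) \<noteq> 1" "(7::8) \<noteq> 2" "(7::8) \<noteq> 3" "(7::8) \<noteq> 4" "(7::8) \<noteq> 5" "(7::8) \<noteq> 6" by simp_all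
lemmas neq_8 = neq_8_0 neq_8_1 neq_8_2 neq_8_3 neq_8_4 neq_8_5 neq_8_6 neq_8_7

lemma sum_8: "(\<Sum>i\<in>(UNIV :: 8 set). f i) = f 0 + f 1 + f 2 + f 3 + f 4 + f 5 + f 6 + f 7"
  by (simp only: UNIV_8 sum.insert finite.intros insert_iff empty_iff neq_8 simp_thms sum.empty
      add_0_right add.assoc)

lemma forall_8: "(\<forall>i::8. P i) \<longleftrightarrow> P 0 \<and> P 1 \<and> P 2 \<and> P 3 \<and> P 4 \<and> P 5 \<and> P 6 \<and> P 7"
proof -
  have "(\<forall>i::8. P i) \<longleftrightarrow> (\<forall>i\<in>(UNIV :: 8 set). P i)" by (simp only: ball_UNIV)
  also have "\<dots> \<longleftrightarrow> P 0 \<and> P 1 \<and> P 2 \<and> P 3 \<and> P 4 \<and> P 5 \<and> P 6 \<and> P 7"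
    unfolding UNIV_8 by (simp only: ball_simps simp_thms)
  finally show ?thesis .
qed

definition I7 :: "8 set" where "I7 = {1, 2, 3, 4, 5, 6, 7}"

lemma finite_I7 [simp]: "finite I7" by (simp add: I7_def)

lemma sum_I7: "(\<Sum>i\<in>I7. f i) = f 1 + f 2 + f 3 + f 4 + f 5 + f 6 + f 7"
  by (simp only: I7_def sum.insert finite.intros insert_iff empty_iff neq_8 simp_thms sum.empty
      add_0_right add.assoc)

lemma mem_triples: "(i, j, k) \<in> oct_triples \<longleftrightarrow>
  i = 1 \<and> j = 2 \<and> k = 4 \<or>
  i = 2 \<and> j = 4 \<and> k = 1 \<or>
  i = 4 \<and> j = 1 \<and> k = 2 \<or>
  i = 2 \<and> j = 3 \<and> k = 5 \<or>
  i = 3 \<and> j = 5 \<and> k = 2 \<or>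
  i = 5 \<and> j = 2 \<and> k = 3 \<or>
  i = 3 \<and> j = 4 \<and> k = 6 \<or>
  i = 4 \<and> j = 6 \<and> k = 3 \<or>
  i = 6 \<and> j = 3 \<and> k = 4 \<or>
  i = 4 \<and> j = 5 \<and> k = 7 \<or>
  i = 5 \<and> j = 7 \<and> k = 4 \<or>
  i = 7 \<and> j = 4 \<and> k = 5 \<or>
  i = 5 \<and> j = 6 \<and> k = 1 \<or>
  i = 6 \<and> j = 1 \<and> k = 5 \<or>
  i = 1 \<and> j = 5 \<and> k = 6 \<or>
  i = 6 \<and> j = 7 \<and> k = 2 \<or>
  i = 7 \<and> j = 2 \<and> k = 6 \<or>
  i = 2 \<and> j = 6 \<and> k = 7 \<or>
  i = 7 \<and> j = 1 \<and> k = 3 \<or>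
  i = 1 \<and> j = 3 \<and> k = 7 \<or>
  i = 3 \<and> j = 7 \<and> k = 1"
  by (simp only: oct_triples_def UN_insert UN_empty Un_empty_right prod.case Un_iff insert_iff empty_iff prod.inject simp_thms disj_assoc)

lemma oct_mult_coords:
  "(x \<odot> y) $ 0 = x$0*y$0 - x$1*y$1 - x$2*y$2 - x$3*y$3 - x$4*y$4 - x$5*y$5 - x$6*y$6 - x$7*y$7"
  "(x \<odot> y) $ 1 = x$0*y$1 + x$1*y$0 + x$2*y$4 - x$4*y$2 + x$3*y$7 - x$7*y$3 + x$5*y$6 - x$6*y$5"
  "(x \<odot> y) $ 2 = x$0*y$2 + x$2*y$0 + x$4*y$1 - x$1*y$4 + x$3*y$5 - x$5*y$3 + x$6*y$7 - x$7*y$6"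
  "(x \<odot> y) $ 3 = x$0*y$3 + x$3*y$0 + x$5*y$2 - x$2*y$5 + x$4*y$6 - x$6*y$4 + x$7*y$1 - x$1*y$7"
  "(x \<odot> y) $ 4 = x$0*y$4 + x$4*y$0 + x$1*y$2 - x$2*y$1 + x$6*y$3 - x$3*y$6 + x$5*y$7 - x$7*y$5"
  "(x \<odot> y) $ 5 = x$0*y$5 + x$5*y$0 + x$2*y$3 - x$3*y$2 + x$7*y$4 - x$4*y$7 + x$6*y$1 - x$1*y$6"
  "(x \<odot> y) $ 6 = x$0*y$6 + x$6*y$0 + x$3*y$4 - x$4*y$3 + x$1*y$5 - x$5*y$1 + x$7*y$2 - x$2*y$7"
  "(x \<odot> y) $ 7 = x$0*y$7 + x$7*y$0 + x$1*y$3 - x$3*y$1 + x$4*y$5 - x$5*y$4 + x$2*y$6 - x$6*y$2"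
  by (simp_all only: oct_mult_def vec_lambda_beta sum_8 oct_coeff_def neq_8
        simp_thms if_True if_False of_bool_eq mem_triples
        mult_zero_left add_0 add_0_right diff_0 diff_zero diff_self mult_1 minus_zero mult_minus1)

lemma oct_e_coords: "oct_e i $ j = (if j = i then 1 else 0)"
  by (simp add: oct_e_def axis_def)

lemma Im_oct_iff: "x \<in> Im_oct \<longleftrightarrow> x $ 0 = 0"
proof
  assume "x \<in> Im_oct"
  then show "x $ 0 = 0" unfolding Im_oct_def
    by (induction rule: span_induct_alt) (auto simp: oct_e_coords)
next
  assume 0: "x $ 0 = 0"
  have "x = (\<Sum>i\<in>I7. x $ i *\<^sub>R oct_e i)"
    using 0 by (simp add: vec_eq_iff forall_8 sum_I7 oct_e_coords)
  also have "\<dots> \<in> Im_oct" unfolding Im_oct_def I7_def[symmetric]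
    by (intro span_sum span_scale span_base imageI)
  finally show "x \<in> Im_oct" .
qed

lemma oct_inner: "(x :: octonion) \<bullet> y = x$0*y$0 + x$1*y$1 + x$2*y$2 + x$3*y$3 + x$4*y$4 + x$5*y$5 + x$6*y$6 + x$7*y$7"
  by (simp add: inner_vec_def sum_8)

lemma bilinear_oct_mult: "bilinear (\<odot>)"
  unfolding bilinear_def
  by (intro conjI allI linearI)
     (simp_all add: oct_mult_def vec_eq_iff sum.distrib sum_distrib_left algebra_simps)

lemmas oct_mult_add_left = bilinear_ladd[OF bilinear_oct_mult]
lemmas oct_mult_add_right = bilinear_radd[OF bilinear_oct_mult]
lemmas oct_mult_scale_left = bilinear_lmul[OF bilinear_oct_mult]
lemmas oct_mult_scale_right = bilinear_rmul[OF bilinear_oct_mult]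
lemmas oct_mult_neg_left = bilinear_lneg[OF bilinear_oct_mult]
lemmas oct_mult_neg_right = bilinear_rneg[OF bilinear_oct_mult]
lemmas oct_mult_diff_left = bilinear_lsub[OF bilinear_oct_mult]

lemma oct_mult_sum_left: "sum f S \<odot> y = (\<Sum>i\<in>S. f i \<odot> y)"
  by (induction S rule: infinite_finite_induct)
     (simp_all add: oct_mult_add_left bilinear_lzero[OF bilinear_oct_mult])

lemma oct_mult_one [simp]: "x \<odot> oct_e 0 = x" "oct_e 0 \<odot> x = x"
  by (simp_all add: vec_eq_iff forall_8 oct_mult_coords oct_e_coords)

lemma Clifford_square:
  assumes "u \<in> Im_oct" shows "u \<odot> (u \<odot> x) = - (u \<bullet> u) *\<^sub>R x"
  using assms unfolding Im_oct_iff
  unfolding vec_eq_iff forall_8 vector_scaleR_component oct_inner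
  by (simp only: oct_mult_coords) (simp add: algebra_simps)

text \<open>
  Polarization of the relation \<open>L\<^sub>u\<^sup>2 = -|u|\<^sup>2\<close>.
\<close>

lemma Clifford:
  assumes "u \<in> Im_oct" "v \<in> Im_oct"
  shows "u \<odot> (v \<odot> x) = - (v \<odot> (u \<odot> x)) - (2 * (u \<bullet> v)) *\<^sub>R x"
proof -
  have "u + v \<in> Im_oct" using assms by (simp add: Im_oct_iff)
  note sq = Clifford_square[OF this] Clifford_square[OF assms(1)] Clifford_square[OF assms(2)]
  have "u \<odot> (v \<odot> x) + v \<odot> (u \<odot> x)
      = (u + v) \<odot> ((u + v) \<odot> x) - u \<odot> (u \<odot> x) - v \<odot> (v \<odot> x)"
    by (simp only: oct_mult_add_left oct_mult_add_right) simp
  also have "\<dots> = (- ((u + v) \<bullet> (u + v)) + u \<bullet> u + v \<bullet> v) *\<^sub>R x"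
    unfolding sq scaleR_add_left by simp
  also have "- ((u + v) \<bullet> (u + v)) + u \<bullet> u + v \<bullet> v = - (2 * (u \<bullet> v))"
    by (simp add: inner_add_left inner_add_right inner_commute)
  finally have "u \<odot> (v \<odot> x) = (- (2 * (u \<bullet> v))) *\<^sub>R x - v \<odot> (u \<odot> x)"
    by (simp only: eq_diff_eq)
  then show ?thesis by (simp only: scaleR_minus_left diff_conv_add_uminus add.commute)
qed

lemma inner_oct_mult_skew:
  assumes "u \<in> Im_oct" shows "x \<bullet> (u \<odot> y) = - ((u \<odot> x) \<bullet> y)"
  using assms unfolding Im_oct_iff
  by (simp add: oct_mult_coords oct_inner algebra_simps)

lemma oct_e_Im [simp]: "a \<in> I7 \<Longrightarrow> oct_e a \<in> Im_oct"
  by (auto simp: I7_def Im_oct_iff oct_e_coords)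

lemma oct_e_mult_coords:
  "(oct_e 1 \<odot> y) $ 0 = - y$1" "(oct_e 1 \<odot> y) $ 1 = y$0" "(oct_e 1 \<odot> y) $ 2 = - y$4" "(oct_e 1 \<odot> y) $ 3 = - y$7" "(oct_e 1 \<odot> y) $ 4 = y$2" "(oct_e 1 \<odot> y) $ 5 = - y$6" "(oct_e 1 \<odot> y) $ 6 = y$5" "(oct_e 1 \<odot> y) $ 7 = y$3"
  "(oct_e 2 \<odot> y) $ 0 = - y$2" "(oct_e 2 \<odot> y) $ 1 = y$4" "(oct_e 2 \<odot> y) $ 2 = y$0" "(oct_e 2 \<odot> y) $ 3 = - y$5" "(oct_e 2 \<odot> y) $ 4 = - y$1" "(oct_e 2 \<odot> y) $ 5 = y$3" "(oct_e 2 \<odot> y) $ 6 = - y$7" "(oct_e 2 \<odot> y) $ 7 = y$6"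
  "(oct_e 3 \<odot> y) $ 0 = - y$3" "(oct_e 3 \<odot> y) $ 1 = y$7" "(oct_e 3 \<odot> y) $ 2 = y$5" "(oct_e 3 \<odot> y) $ 3 = y$0" "(oct_e 3 \<odot> y) $ 4 = - y$6" "(oct_e 3 \<odot> y) $ 5 = - y$2" "(oct_e 3 \<odot> y) $ 6 = y$4" "(oct_e 3 \<odot> y) $ 7 = - y$1"
  "(oct_e 4 \<odot> y) $ 0 = - y$4" "(oct_e 4 \<odot> y) $ 1 = - y$2" "(oct_e 4 \<odot> y) $ 2 = y$1" "(oct_e 4 \<odot> y) $ 3 = y$6" "(oct_e 4 \<odot> y) $ 4 = y$0" "(oct_e 4 \<odot> y) $ 5 = - y$7" "(oct_e 4 \<odot> y) $ 6 = - y$3" "(oct_e 4 \<odot> y) $ 7 = y$5"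
  "(oct_e 5 \<odot> y) $ 0 = - y$5" "(oct_e 5 \<odot> y) $ 1 = y$6" "(oct_e 5 \<odot> y) $ 2 = - y$3" "(oct_e 5 \<odot> y) $ 3 = y$2" "(oct_e 5 \<odot> y) $ 4 = y$7" "(oct_e 5 \<odot> y) $ 5 = y$0" "(oct_e 5 \<odot> y) $ 6 = - y$1" "(oct_e 5 \<odot> y) $ 7 = - y$4"
  "(oct_e 6 \<odot> y) $ 0 = - y$6" "(oct_e 6 \<odot> y) $ 1 = - y$5" "(oct_e 6 \<odot> y) $ 2 = y$7" "(oct_e 6 \<odot> y) $ 3 = - y$4" "(oct_e 6 \<odot> y) $ 4 = y$3" "(oct_e 6 \<odot> y) $ 5 = y$1" "(oct_e 6 \<odot> y) $ 6 = y$0" "(oct_e 6 \<odot> y) $ 7 = - y$2"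
  "(oct_e 7 \<odot> y) $ 0 = - y$7" "(oct_e 7 \<odot> y) $ 1 = - y$3" "(oct_e 7 \<odot> y) $ 2 = - y$6" "(oct_e 7 \<odot> y) $ 3 = y$1" "(oct_e 7 \<odot> y) $ 4 = - y$5" "(oct_e 7 \<odot> y) $ 5 = y$4" "(oct_e 7 \<odot> y) $ 6 = y$2" "(oct_e 7 \<odot> y) $ 7 = y$0"
  by (simp_all add: oct_mult_coords oct_e_coords)

text \<open>
  This does not follow from the Clifford relations, which leave the sign open; it is what links
  words of length seven to determinants.
\<close>

lemma oct_e_word: "oct_e 1 \<odot> (oct_e 2 \<odot> (oct_e 3 \<odot> (oct_e 4 \<odot> (oct_e 5 \<odot> (oct_e 6 \<odot> (oct_e 7 \<odot> y)))))) = - y"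
  unfolding vec_eq_iff forall_8 by (simp only: oct_e_mult_coords vector_uminus_component minus_minus simp_thms)

lemma inner_oct_e [simp]: "x \<bullet> oct_e i = x $ i" "oct_e i \<bullet> x = x $ i"
  by (simp_all add: oct_e_def inner_axis inner_axis')

lemma oct_expand: "x = (\<Sum>i\<in>UNIV. x $ i *\<^sub>R oct_e i)"
  by (simp add: sum_8 vec_eq_iff forall_8 oct_e_coords)

lemma Im_oct_expand: "v \<in> Im_oct \<Longrightarrow> v = (\<Sum>a\<in>I7. v $ a *\<^sub>R oct_e a)"
  by (simp add: vec_eq_iff forall_8 sum_I7 oct_e_coords Im_oct_iff)

lemma Im_inner: "u \<in> Im_oct \<Longrightarrow> u \<bullet> v = (\<Sum>a\<in>I7. u $ a * v $ a)"
  by (simp add: oct_inner sum_I7 Im_oct_iff)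

section \<open>The Cayley form as a contraction of brackets\<close>

text \<open>
  This is minus the Cayley form (\<open>Cayley_form_phi\<close>).  Defining it by the contraction of two brackets
  makes the contraction identity hold by definition; what has to be proved is that
  the expression is alternating.
\<close>

definition phi :: "octonion \<Rightarrow> octonion \<Rightarrow> octonion \<Rightarrow> octonion \<Rightarrow> real" where
  "phi x y z w = (\<Sum>a\<in>I7. (x \<bullet> (oct_e a \<odot> z)) * (y \<bullet> (oct_e a \<odot> w)))
      - (z \<bullet> w) * (x \<bullet> y) + (x \<bullet> w) * (y \<bullet> z)"

lemma oct_mult_norm: "(p \<odot> q) \<bullet> (p \<odot> q) = (p \<bullet> p) * (q \<bullet> q)"
proof -
  define u where "u = p - p $ 0 *\<^sub>R oct_e 0"
  have u: "u \<in> Im_oct" by (simp add: u_def Im_oct_iff oct_e_coords)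
  have "q \<bullet> (u \<odot> q) = 0" using inner_oct_mult_skew[OF u, of q q] by (simp add: inner_commute)
  moreover have "(u \<odot> q) \<bullet> (u \<odot> q) = (u \<bullet> u) * (q \<bullet> q)"
    by (subst inner_oct_mult_skew[OF u]) (simp add: Clifford_square[OF u])
  moreover have "p \<odot> q = p $ 0 *\<^sub>R q + u \<odot> q"
    by (simp add: u_def oct_mult_diff_left oct_mult_scale_left)
  moreover have "p \<bullet> p = (p $ 0)\<^sup>2 + u \<bullet> u"
    by (simp add: u_def inner_diff_left inner_diff_right power2_eq_square oct_e_coords)
  ultimately show ?thesis
    by (simp add: inner_add_left inner_add_right inner_commute[of "u \<odot> q" q] power2_eq_square distrib_right)
qed

lemma oct_cnj_coords:
  "oct_cnj z $ 0 = z $ 0" "oct_cnj z $ 1 = - z $ 1" "oct_cnj z $ 2 = - z $ 2" "oct_cnj z $ 3 = - z $ 3"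
  "oct_cnj z $ 4 = - z $ 4" "oct_cnj z $ 5 = - z $ 5" "oct_cnj z $ 6 = - z $ 6" "oct_cnj z $ 7 = - z $ 7"
  by (simp_all add: oct_cnj_def oct_e_coords)

lemma oct_mult_cnj_coord: "(x \<odot> oct_cnj z) $ a = x \<bullet> (oct_e a \<odot> z)"
proof -
  have "\<forall>a. (x \<odot> oct_cnj z) $ a = x \<bullet> (oct_e a \<odot> z)"
    unfolding forall_8 oct_inner oct_mult_one oct_e_mult_coords unfolding oct_mult_coords oct_cnj_coords
    by (simp only: mult_minus_right diff_minus_eq_add minus_mult_minus) (intro conjI; linarith)
  then show ?thesis by simp
qed

text \<open>
  The numbers \<open>\<langle>x, e\<^sub>a z\<rangle>\<close> are the coordinates of \<open>x \<odot> oct_cnj z\<close>, so this is the multiplicativity of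
  the norm.
\<close>

lemma eight_squares: "(\<Sum>a\<in>UNIV. (x \<bullet> (oct_e a \<odot> z))\<^sup>2) = (x \<bullet> x) * (z \<bullet> z)"
proof -
  have "(\<Sum>a\<in>UNIV. (x \<bullet> (oct_e a \<odot> z))\<^sup>2) = (x \<odot> oct_cnj z) \<bullet> (x \<odot> oct_cnj z)"
    by (simp add: inner_vec_def oct_mult_cnj_coord power2_eq_square)
  moreover have "oct_cnj z \<bullet> oct_cnj z = z \<bullet> z"
    by (simp only: oct_inner oct_cnj_coords minus_mult_minus)
  ultimately show ?thesis by (simp only: oct_mult_norm)
qed

lemma sum_UNIV_8_split: "(\<Sum>a\<in>(UNIV::8 set). f a) = f 0 + (\<Sum>a\<in>I7. f a)"
  by (simp only: sum_8 sum_I7 add.assoc)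

lemma sum_brackets_same: "(\<Sum>a\<in>I7. (x \<bullet> (oct_e a \<odot> z)) * (x \<bullet> (oct_e a \<odot> w)))
    = (z \<bullet> w) * (x \<bullet> x) - (x \<bullet> w) * (x \<bullet> z)"
proof -
  have q: "(\<Sum>a\<in>I7. (x \<bullet> (oct_e a \<odot> z))\<^sup>2) = (z \<bullet> z) * (x \<bullet> x) - (x \<bullet> z)\<^sup>2" for z
    using eight_squares[of x z] by (simp only: sum_UNIV_8_split) (simp add: algebra_simps)
  have "(\<Sum>a\<in>I7. 2 * ((x \<bullet> (oct_e a \<odot> z)) * (x \<bullet> (oct_e a \<odot> w))))
    = (\<Sum>a\<in>I7. (x \<bullet> (oct_e a \<odot> (z + w)))\<^sup>2 - (x \<bullet> (oct_e a \<odot> z))\<^sup>2 - (x \<bullet> (oct_e a \<odot> w))\<^sup>2)"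
    by (rule sum.cong) (simp_all add: oct_mult_add_right inner_add_right power2_eq_square algebra_simps)
  also have "\<dots> = 2 * ((z \<bullet> w) * (x \<bullet> x) - (x \<bullet> w) * (x \<bullet> z))"
    unfolding sum_subtractf q
    by (simp add: inner_add_right inner_add_left power2_eq_square inner_commute[of w z] algebra_simps)
  finally show ?thesis by (simp flip: sum_distrib_left)
qed

lemma phi_swap13: "phi z y x w = - phi x y z w"
proof -
  have "(z \<bullet> (oct_e a \<odot> x)) = - (x \<bullet> (oct_e a \<odot> z))" if "a \<in> I7" for a
    using inner_oct_mult_skew[OF oct_e_Im[OF that], of z x] by (simp add: inner_commute)
  then have "(\<Sum>a\<in>I7. (z \<bullet> (oct_e a \<odot> x)) * (y \<bullet> (oct_e a \<odot> w)))
     = (\<Sum>a\<in>I7. - ((x \<bullet> (oct_e a \<odot> z)) * (y \<bullet> (oct_e a \<odot> w))))"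
    by (intro sum.cong) auto
  then show ?thesis unfolding phi_def sum_negf by (simp only:) (simp add: inner_commute algebra_simps)
qed

lemma phi_swap1234: "phi y x w z = phi x y z w"
  unfolding phi_def by (simp add: inner_commute algebra_simps)

lemma phi_linear:
  "linear (\<lambda>x. phi x y z w)" "linear (\<lambda>y. phi x y z w)" "linear (\<lambda>z. phi x y z w)" "linear (\<lambda>w. phi x y z w)"
  unfolding phi_def
  by (rule linearI; simp add: oct_mult_add_right oct_mult_scale_right inner_add_left inner_add_right
      algebra_simps sum.distrib sum_distrib_left)+

text \<open>
  The essential antisymmetry of \<open>phi\<close>; the skewness in the first and third argument is that of the
  operators \<open>L\<^sub>a\<close>, and together with the evident symmetry under exchange of both pairs they generate all
  others.
\<close>

lemma phi_diag12: "phi x x z w = 0"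
  unfolding phi_def sum_brackets_same by (simp add: inner_commute)

lemma phi_swap12: "phi y x z w = - phi x y z w"
proof -
  have "phi (x + y) (x + y) z w = phi x x z w + phi x y z w + (phi y x z w + phi y y z w)"
    by (simp add: linear_add[OF phi_linear(1)] linear_add[OF phi_linear(2)])
  then show ?thesis by (simp add: phi_diag12)
qed

lemma phi_swap23: "phi x z y w = - phi x y z w"
  by (metis phi_swap12 phi_swap13)

lemma phi_swap34: "phi x y w z = - phi x y z w"
  by (metis phi_swap12 phi_swap1234)

text \<open>
  Both terms of the triple cross product are brackets contracted over all eight units, which
  turns the Cayley form into a difference of two values of \<open>phi\<close>.
\<close>

lemma Cayley_form_phi: "Cayley_form x y z w = - phi x y z w"
proof -
  have *: "x \<bullet> ((y \<odot> oct_cnj z) \<odot> w)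
      = (\<Sum>a\<in>I7. (x \<bullet> (oct_e a \<odot> w)) * (y \<bullet> (oct_e a \<odot> z))) + (x \<bullet> w) * (y \<bullet> z)" for y w
  proof -
    have "(y \<odot> oct_cnj z) = (\<Sum>a\<in>UNIV. (y \<bullet> (oct_e a \<odot> z)) *\<^sub>R oct_e a)"
      by (subst oct_expand) (simp add: oct_mult_cnj_coord)
    then have "x \<bullet> ((y \<odot> oct_cnj z) \<odot> w) = (\<Sum>a\<in>UNIV. (x \<bullet> (oct_e a \<odot> w)) * (y \<bullet> (oct_e a \<odot> z)))"
      by (simp add: oct_mult_sum_left oct_mult_scale_left inner_sum_right mult.commute)
    then show ?thesis by (simp only: sum_UNIV_8_split) simp
  qed
  have "2 * Cayley_form x y z w = x \<bullet> ((y \<odot> oct_cnj z) \<odot> w) - x \<bullet> ((w \<odot> oct_cnj z) \<odot> y)"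
    by (simp add: Cayley_form_def triple_cross_def inner_diff_right)
  also have "\<dots> = phi x y w z - phi x w y z"
    unfolding * phi_def by (simp add: inner_commute algebra_simps)
  also have "\<dots> = - 2 * phi x y z w"
    using phi_swap34[of x y z w] phi_swap23[of x w y z] by simp
  finally show ?thesis by simp
qed

lemma sum_brackets: "(\<Sum>a\<in>I7. (x \<bullet> (oct_e a \<odot> z)) * (y \<bullet> (oct_e a \<odot> w)))
    = (z \<bullet> w) * (x \<bullet> y) - (x \<bullet> w) * (y \<bullet> z) + phi x y z w"
  by (simp only: phi_def)

lemma inner_oct_e_mult:
  assumes "a \<in> I7" shows "(oct_e a \<odot> x) \<bullet> y = - (x \<bullet> (oct_e a \<odot> y))"
  using inner_oct_mult_skew[OF oct_e_Im[OF assms], of x y] by simp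

lemma inner_oct_e_both:
  assumes "a \<in> I7" shows "(oct_e a \<odot> x) \<bullet> (oct_e a \<odot> y) = x \<bullet> y"
proof -
  have "oct_e a \<bullet> oct_e a = 1" by (simp add: oct_e_coords)
  then show ?thesis
    unfolding inner_oct_e_mult[OF assms] Clifford_square[OF oct_e_Im[OF assms]] by simp
qed

lemma sum_I7_inner:
  assumes "u \<in> Im_oct" shows "(\<Sum>a\<in>I7. u $ a * (y \<bullet> (oct_e a \<odot> w))) = y \<bullet> (u \<odot> w)"
proof -
  have "u \<odot> w = (\<Sum>a\<in>I7. u $ a *\<^sub>R oct_e a) \<odot> w" using Im_oct_expand[OF assms] by metis
  also have "\<dots> = (\<Sum>a\<in>I7. u $ a *\<^sub>R (oct_e a \<odot> w))"
    by (simp only: oct_mult_sum_left oct_mult_scale_left)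
  finally show ?thesis by (simp only: inner_sum_right inner_scaleR_right)
qed

text \<open>
  Moving a vector from one argument of \<open>phi\<close> to another costs only products of brackets: in the
  contraction that defines \<open>phi\<close>, the operator \<open>L\<^sub>u\<close> anticommutes with \<open>L\<^sub>a\<close> up to a scalar.
\<close>

lemma phi_move:
  assumes u: "u \<in> Im_oct"
  shows "phi (u \<odot> x) y z w = phi x y (u \<odot> z) w + 2 * (x \<bullet> z) * (y \<bullet> (u \<odot> w))
     + (z \<bullet> w) * (x \<bullet> (u \<odot> y)) + (x \<bullet> y) * ((u \<odot> z) \<bullet> w)
     - (x \<bullet> (u \<odot> w)) * (y \<bullet> z) - (x \<bullet> w) * (y \<bullet> (u \<odot> z))"
proof -
  have "(u \<odot> x) \<bullet> (oct_e a \<odot> z) = x \<bullet> (oct_e a \<odot> (u \<odot> z)) + 2 * (u $ a * (x \<bullet> z))" if a: "a \<in> I7" for a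
  proof -
    have "(u \<odot> x) \<bullet> (oct_e a \<odot> z) = - (x \<bullet> (u \<odot> (oct_e a \<odot> z)))"
      using inner_oct_mult_skew[OF u] by simp
    then show ?thesis unfolding Clifford[OF u oct_e_Im[OF a]] by (simp add: inner_diff_right)
  qed
  then have "(\<Sum>a\<in>I7. ((u \<odot> x) \<bullet> (oct_e a \<odot> z)) * (y \<bullet> (oct_e a \<odot> w)))
     = (\<Sum>a\<in>I7. (x \<bullet> (oct_e a \<odot> (u \<odot> z))) * (y \<bullet> (oct_e a \<odot> w)) + 2 * (x \<bullet> z) * (u $ a * (y \<bullet> (oct_e a \<odot> w))))"
    by (intro sum.cong) (simp_all only: distrib_right distrib_left mult.assoc mult.left_commute[of "u $ _"] mult.commute[of "u $ _"])
  also have "\<dots> = (\<Sum>a\<in>I7. (x \<bullet> (oct_e a \<odot> (u \<odot> z))) * (y \<bullet> (oct_e a \<odot> w))) + 2 * (x \<bullet> z) * (y \<bullet> (u \<odot> w))"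
    by (simp only: sum.distrib sum_distrib_left[symmetric] sum_I7_inner[OF u])
  finally have s: "(\<Sum>a\<in>I7. ((u \<odot> x) \<bullet> (oct_e a \<odot> z)) * (y \<bullet> (oct_e a \<odot> w))) = \<dots>" .
  have "(u \<odot> x) \<bullet> y = - (x \<bullet> (u \<odot> y))" "(u \<odot> x) \<bullet> w = - (x \<bullet> (u \<odot> w))"
    using inner_oct_mult_skew[OF u, of x] by simp_all
  then show ?thesis unfolding phi_def s by (simp add: algebra_simps)
qed

text \<open>
  In \<open>phi_move\<close> take \<open>e\<^sub>a\<close> for \<open>u\<close> and \<open>e\<^sub>a x\<close> for \<open>x\<close>: as \<open>L\<^sub>a\<^sup>2 = -1\<close>, the left-hand side does not depend on \<open>a\<close>, and the
  sum over \<open>a\<close> of the correction terms consists of contracted brackets.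
\<close>

lemma sum_phi_slots13:
  "(\<Sum>a\<in>I7. phi (oct_e a \<odot> x) y (oct_e a \<odot> z) w) = - 7 * phi x y z w
     - 2 * ((x \<bullet> w) * (z \<bullet> y) - (z \<bullet> w) * (y \<bullet> x) + phi z y x w)
     - 7 * ((z \<bullet> w) * (x \<bullet> y)) - ((x \<bullet> z) * (y \<bullet> w) - (y \<bullet> z) * (w \<bullet> x) + phi y w x z)
     + 7 * ((x \<bullet> w) * (y \<bullet> z)) + ((x \<bullet> z) * (w \<bullet> y) - (w \<bullet> z) * (y \<bullet> x) + phi w y x z)"
proof -
  have "phi (oct_e a \<odot> x) y (oct_e a \<odot> z) w = - phi x y z w
     - 2 * ((z \<bullet> (oct_e a \<odot> x)) * (y \<bullet> (oct_e a \<odot> w)))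
     - (z \<bullet> w) * (x \<bullet> y) - (y \<bullet> (oct_e a \<odot> x)) * (w \<bullet> (oct_e a \<odot> z))
     + (x \<bullet> w) * (y \<bullet> z) + (w \<bullet> (oct_e a \<odot> x)) * (y \<bullet> (oct_e a \<odot> z))" if a: "a \<in> I7" for a
  proof -
    have "oct_e a \<odot> (oct_e a \<odot> x) = - x"
      using Clifford_square[OF oct_e_Im[OF a]] by (simp add: oct_e_coords)
    moreover have "phi (- x) y z w = - phi x y z w"
      by (rule linear_neg[OF phi_linear(1)])
    ultimately show ?thesis
      using phi_move[OF oct_e_Im[OF a], of "oct_e a \<odot> x" y z w]
      unfolding inner_oct_e_both[OF a] inner_commute[of "oct_e a \<odot> x" y] inner_commute[of "oct_e a \<odot> x" z]
         inner_commute[of "oct_e a \<odot> x" w] inner_commute[of "oct_e a \<odot> z" w]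
      by simp
  qed
  then have "(\<Sum>a\<in>I7. phi (oct_e a \<odot> x) y (oct_e a \<odot> z) w) = (\<Sum>a\<in>I7. - phi x y z w
     - 2 * ((z \<bullet> (oct_e a \<odot> x)) * (y \<bullet> (oct_e a \<odot> w)))
     - (z \<bullet> w) * (x \<bullet> y) - (y \<bullet> (oct_e a \<odot> x)) * (w \<bullet> (oct_e a \<odot> z))
     + (x \<bullet> w) * (y \<bullet> z) + (w \<bullet> (oct_e a \<odot> x)) * (y \<bullet> (oct_e a \<odot> z)))"
    by (rule sum.cong[OF refl])
  also have "\<dots> = - 7 * phi x y z w
     - 2 * (\<Sum>a\<in>I7. (z \<bullet> (oct_e a \<odot> x)) * (y \<bullet> (oct_e a \<odot> w)))
     - 7 * ((z \<bullet> w) * (x \<bullet> y)) - (\<Sum>a\<in>I7. (y \<bullet> (oct_e a \<odot> x)) * (w \<bullet> (oct_e a \<odot> z)))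
     + 7 * ((x \<bullet> w) * (y \<bullet> z)) + (\<Sum>a\<in>I7. (w \<bullet> (oct_e a \<odot> x)) * (y \<bullet> (oct_e a \<odot> z)))"
  proof -
    have c: "(\<Sum>a\<in>I7. (r::real)) = 7 * r" for r by (simp only: sum_I7)
    show ?thesis unfolding sum.distrib sum_subtractf sum_distrib_left[symmetric] c by simp
  qed
  finally show ?thesis unfolding sum_brackets .
qed

lemma sum_phi_slots34:
  "(\<Sum>a\<in>I7. phi z w (oct_e a \<odot> x) (oct_e a \<odot> y))
     = 6 * ((z \<bullet> x) * (w \<bullet> y) - (z \<bullet> y) * (w \<bullet> x)) - 3 * phi z w x y"
proof -
  have "phi z w (oct_e a \<odot> x) (oct_e a \<odot> y) = - phi (oct_e a \<odot> x) z (oct_e a \<odot> y) w" for a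
    by (metis phi_swap12 phi_swap23 phi_swap34)
  then have "(\<Sum>a\<in>I7. phi z w (oct_e a \<odot> x) (oct_e a \<odot> y)) = - (\<Sum>a\<in>I7. phi (oct_e a \<odot> x) z (oct_e a \<odot> y) w)"
    by (simp only: sum_negf)
  moreover have "phi x z y w = - phi z w x y" by (metis phi_swap12 phi_swap23 phi_swap34)
  moreover have "phi y z x w = phi z w x y" by (metis phi_swap12 phi_swap23 phi_swap34 minus_minus)
  moreover have "phi w z x y = - phi z w x y" by (metis phi_swap12)
  ultimately show ?thesis unfolding sum_phi_slots13 by (simp add: inner_commute algebra_simps)
qed

text \<open>
  Iterates of the operator \<open>\<Sum>\<^sub>a L\<^sub>a \<otimes> L\<^sub>a\<close> on the tensor square of the spinors.
\<close>

definition brackets1 :: "octonion \<Rightarrow> octonion \<Rightarrow> octonion \<Rightarrow> octonion \<Rightarrow> real" where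
  "brackets1 x y z w = (\<Sum>a\<in>I7. (z \<bullet> (oct_e a \<odot> x)) * (w \<bullet> (oct_e a \<odot> y)))"
definition brackets2 :: "octonion \<Rightarrow> octonion \<Rightarrow> octonion \<Rightarrow> octonion \<Rightarrow> real" where
  "brackets2 x y z w = (\<Sum>b\<in>I7. brackets1 (oct_e b \<odot> x) (oct_e b \<odot> y) z w)"
definition brackets3 :: "octonion \<Rightarrow> octonion \<Rightarrow> octonion \<Rightarrow> octonion \<Rightarrow> real" where
  "brackets3 x y z w = (\<Sum>b\<in>I7. brackets2 (oct_e b \<odot> x) (oct_e b \<odot> y) z w)"

text \<open>
  The operator \<open>C = \<Sum>\<^sub>a L\<^sub>a \<otimes> L\<^sub>a\<close> has the eigenvalues \<open>7, -5, 3, -1\<close> on the four irreducible parts of the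
  tensor square of the spinors, and \<open>(C + 5)(C - 3)(C + 1) = C\<^sup>3 + 3C\<^sup>2 - 13C - 15\<close> projects, up to the factor
  384, onto the invariant line.  The projection is one eighth of the left-hand side tensor.
\<close>

lemma Fierz: "48 * ((x \<bullet> y) * (z \<bullet> w))
    = brackets3 x y z w + 3 * brackets2 x y z w - 13 * brackets1 x y z w - 15 * ((z \<bullet> x) * (w \<bullet> y))"
proof -
  have c: "(\<Sum>a\<in>I7. (r::real)) = 7 * r" for r by (simp only: sum_I7)
  have brackets1: "brackets1 x y z w = (x \<bullet> y) * (z \<bullet> w) - (z \<bullet> y) * (w \<bullet> x) + phi z w x y" for x y
    unfolding brackets1_def sum_brackets ..
  have brackets2: "brackets2 x y z w = 7 * ((x \<bullet> y) * (z \<bullet> w)) - brackets1 y x z w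
      + 6 * ((z \<bullet> x) * (w \<bullet> y) - (z \<bullet> y) * (w \<bullet> x)) - 3 * phi z w x y" for x y
  proof -
    have "(\<Sum>a\<in>I7. ((oct_e a \<odot> x) \<bullet> (oct_e a \<odot> y)) * (z \<bullet> w)) = (\<Sum>a\<in>I7. (x \<bullet> y) * (z \<bullet> w))"
      by (rule sum.cong) (simp_all only: inner_oct_e_both)
    moreover have "(\<Sum>a\<in>I7. (z \<bullet> (oct_e a \<odot> y)) * (w \<bullet> (oct_e a \<odot> x))) = brackets1 y x z w"
      by (simp only: brackets1_def)
    ultimately show ?thesis
      unfolding brackets2_def brackets1 sum.distrib sum_subtractf sum_phi_slots34 c by (simp only: brackets1)
  qed
  have brackets2': "brackets2 x y z w = 6 * ((x \<bullet> y) * (z \<bullet> w)) + 7 * ((z \<bullet> x) * (w \<bullet> y)) - 6 * ((z \<bullet> y) * (w \<bullet> x)) - 2 * phi z w x y" for x y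
    unfolding brackets2 brackets1 phi_swap34[of z w x y] by (simp add: inner_commute algebra_simps)
  have brackets3: "brackets3 x y z w = 42 * ((x \<bullet> y) * (z \<bullet> w)) + 7 * brackets1 x y z w - 6 * brackets1 y x z w
      - 2 * (6 * ((z \<bullet> x) * (w \<bullet> y) - (z \<bullet> y) * (w \<bullet> x)) - 3 * phi z w x y)"
  proof -
    have "(\<Sum>a\<in>I7. ((oct_e a \<odot> x) \<bullet> (oct_e a \<odot> y)) * (z \<bullet> w)) = (\<Sum>a\<in>I7. (x \<bullet> y) * (z \<bullet> w))"
      by (rule sum.cong) (simp_all only: inner_oct_e_both)
    moreover have "(\<Sum>a\<in>I7. (z \<bullet> (oct_e a \<odot> y)) * (w \<bullet> (oct_e a \<odot> x))) = brackets1 y x z w"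
      "(\<Sum>a\<in>I7. (z \<bullet> (oct_e a \<odot> x)) * (w \<bullet> (oct_e a \<odot> y))) = brackets1 x y z w"
      by (simp_all only: brackets1_def)
    ultimately show ?thesis
      unfolding brackets3_def brackets2' sum.distrib sum_subtractf sum_distrib_left[symmetric] sum_phi_slots34 c by simp
  qed
  show ?thesis
    unfolding brackets3 brackets2' brackets1 phi_swap34[of z w x y] by (simp add: inner_commute[of y x] inner_commute[of w z] algebra_simps)
qed

text \<open>
  The contraction of a bracket with \<open>phi\<close>, the one case that \<open>sum_brackets\<close> does not cover.
\<close>

definition bracket_phi where
  "bracket_phi x y p q r s = (\<Sum>a\<in>I7. (x \<bullet> (oct_e a \<odot> y)) * phi (oct_e a \<odot> p) q r s)"

lemma bracket_phi_skew: "bracket_phi x y p r q s = - bracket_phi x y p q r s" "bracket_phi x y p q s r = - bracket_phi x y p q r s"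
    "bracket_phi x y p s r q = - bracket_phi x y p q r s"
proof -
  have 1: "bracket_phi x y p r q s = - bracket_phi x y p q r s" for q r s
    unfolding bracket_phi_def phi_swap23[of _ r q s] by (simp only: mult_minus_right sum_negf)
  have 2: "bracket_phi x y p q s r = - bracket_phi x y p q r s" for q r s
    unfolding bracket_phi_def phi_swap34[of _ _ s r] by (simp only: mult_minus_right sum_negf)
  show "bracket_phi x y p r q s = - bracket_phi x y p q r s" "bracket_phi x y p q s r = - bracket_phi x y p q r s" by (rule 1 2)+
  show "bracket_phi x y p s r q = - bracket_phi x y p q r s" using 1[of s r q] 2[of r s q] 1[of r q s] by simp
qed

lemma bracket_phi_swap13:
  "bracket_phi x y p q r s + bracket_phi x y r q p s =
     2 * (p \<bullet> r) * brackets1 y s x q + (r \<bullet> s) * brackets1 y q x p + (p \<bullet> q) * brackets1 y r x s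
     - (q \<bullet> r) * brackets1 y s x p - (p \<bullet> s) * brackets1 y r x q"
proof -
  have "(x \<bullet> (oct_e a \<odot> y)) * phi (oct_e a \<odot> p) q r s + (x \<bullet> (oct_e a \<odot> y)) * phi (oct_e a \<odot> r) q p s
      = 2 * (p \<bullet> r) * ((x \<bullet> (oct_e a \<odot> y)) * (q \<bullet> (oct_e a \<odot> s)))
       + (r \<bullet> s) * ((x \<bullet> (oct_e a \<odot> y)) * (p \<bullet> (oct_e a \<odot> q)))
       + (p \<bullet> q) * ((x \<bullet> (oct_e a \<odot> y)) * (s \<bullet> (oct_e a \<odot> r)))
       - (q \<bullet> r) * ((x \<bullet> (oct_e a \<odot> y)) * (p \<bullet> (oct_e a \<odot> s)))
       - (p \<bullet> s) * ((x \<bullet> (oct_e a \<odot> y)) * (q \<bullet> (oct_e a \<odot> r)))" if a: "a \<in> I7" for a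
    unfolding phi_move[OF oct_e_Im[OF a], of p q r s] phi_swap13[of p q "oct_e a \<odot> r" s]
      inner_commute[of "oct_e a \<odot> r" s]
    by (simp add: algebra_simps)
  then have "bracket_phi x y p q r s + bracket_phi x y r q p s = (\<Sum>a\<in>I7. 2 * (p \<bullet> r) * ((x \<bullet> (oct_e a \<odot> y)) * (q \<bullet> (oct_e a \<odot> s)))
       + (r \<bullet> s) * ((x \<bullet> (oct_e a \<odot> y)) * (p \<bullet> (oct_e a \<odot> q)))
       + (p \<bullet> q) * ((x \<bullet> (oct_e a \<odot> y)) * (s \<bullet> (oct_e a \<odot> r)))
       - (q \<bullet> r) * ((x \<bullet> (oct_e a \<odot> y)) * (p \<bullet> (oct_e a \<odot> s)))
       - (p \<bullet> s) * ((x \<bullet> (oct_e a \<odot> y)) * (q \<bullet> (oct_e a \<odot> r))))"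
    unfolding bracket_phi_def sum.distrib[symmetric] by (rule sum.cong[OF refl])
  then show ?thesis unfolding sum.distrib sum_subtractf sum_distrib_left[symmetric] brackets1_def .
qed

text \<open>
  Expanding \<open>phi\<close> as a contraction over \<open>b\<close> and performing the contraction over \<open>a\<close> first exchanges the
  roles of the two pairs of arguments.
\<close>

lemma bracket_phi_exchange:
  "bracket_phi x y p q r s = - bracket_phi q s r x y p + (y \<bullet> p) * brackets1 r s x q - (x \<bullet> p) * brackets1 r s y q
     - (r \<bullet> s) * brackets1 y p x q + (q \<bullet> r) * brackets1 y p x s"
proof -
  have "bracket_phi x y p q r s = (\<Sum>a\<in>I7. (\<Sum>b\<in>I7. (x \<bullet> (oct_e a \<odot> y)) * (((oct_e a \<odot> p) \<bullet> (oct_e b \<odot> r)) * (q \<bullet> (oct_e b \<odot> s))))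
      - (r \<bullet> s) * ((x \<bullet> (oct_e a \<odot> y)) * (q \<bullet> (oct_e a \<odot> p)))
      + (q \<bullet> r) * ((x \<bullet> (oct_e a \<odot> y)) * (s \<bullet> (oct_e a \<odot> p))))"
    unfolding bracket_phi_def phi_def[of _ q r s] inner_commute[of "oct_e _ \<odot> p" q] inner_commute[of "oct_e _ \<odot> p" s]
    unfolding sum_distrib_left[symmetric]
    by (rule sum.cong[OF refl]) (simp add: algebra_simps)
  also have "\<dots> = (\<Sum>a\<in>I7. \<Sum>b\<in>I7. (x \<bullet> (oct_e a \<odot> y)) * (((oct_e a \<odot> p) \<bullet> (oct_e b \<odot> r)) * (q \<bullet> (oct_e b \<odot> s))))
     - (r \<bullet> s) * brackets1 y p x q + (q \<bullet> r) * brackets1 y p x s"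
    unfolding sum.distrib sum_subtractf sum_distrib_left[symmetric] brackets1_def ..
  also have "(\<Sum>a\<in>I7. \<Sum>b\<in>I7. (x \<bullet> (oct_e a \<odot> y)) * (((oct_e a \<odot> p) \<bullet> (oct_e b \<odot> r)) * (q \<bullet> (oct_e b \<odot> s))))
     = (\<Sum>b\<in>I7. (\<Sum>a\<in>I7. (x \<bullet> (oct_e a \<odot> y)) * ((oct_e b \<odot> r) \<bullet> (oct_e a \<odot> p))) * (q \<bullet> (oct_e b \<odot> s)))"
    unfolding sum_distrib_right by (subst sum.swap) (simp only: inner_commute[of "oct_e _ \<odot> p"] mult.assoc)
  also have "\<dots> = (\<Sum>b\<in>I7. (y \<bullet> p) * ((x \<bullet> (oct_e b \<odot> r)) * (q \<bullet> (oct_e b \<odot> s)))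
        - (x \<bullet> p) * ((y \<bullet> (oct_e b \<odot> r)) * (q \<bullet> (oct_e b \<odot> s)))
        - (q \<bullet> (oct_e b \<odot> s)) * phi (oct_e b \<odot> r) x y p)"
    unfolding sum_brackets phi_swap12[of "oct_e _ \<odot> r" x] inner_commute[of "oct_e _ \<odot> r" y]
    by (rule sum.cong[OF refl]) (simp add: algebra_simps)
  also have "\<dots> = (y \<bullet> p) * brackets1 r s x q - (x \<bullet> p) * brackets1 r s y q - bracket_phi q s r x y p"
    unfolding sum_subtractf sum_distrib_left[symmetric] brackets1_def bracket_phi_def ..
  finally show ?thesis by simp
qed

text \<open>
  Write \<open>E\<^sub>1, E\<^sub>2, E\<^sub>3\<close> for the values of \<open>bracket_phi\<close> with the pairs \<open>01\<close>, \<open>35\<close>, \<open>24\<close> in the bracket.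
  Modulo products they are skew in the other four arguments, and the exchange relation gives
  \<open>E\<^sub>1 = -E\<^sub>2\<close>, \<open>E\<^sub>2 = -E\<^sub>3\<close> and \<open>E\<^sub>1 = -E\<^sub>3\<close>; hence \<open>2E\<^sub>1\<close> vanishes modulo products.  The indexed form of
  the arguments serves to bring inner products and values of \<open>phi\<close> into a normal form by
  sorting their indices.
\<close>

lemma bracket_phi_formula_indexed:
  fixes T :: "nat \<Rightarrow> octonion"
  shows "bracket_phi (T 0) (T 1) (T 2) (T 3) (T 4) (T 5) =
     - (T 0 \<bullet> T 2) * phi (T 1) (T 3) (T 4) (T 5) + (T 0 \<bullet> T 3) * phi (T 1) (T 2) (T 4) (T 5)
     - (T 0 \<bullet> T 4) * phi (T 1) (T 2) (T 3) (T 5) + (T 0 \<bullet> T 5) * phi (T 1) (T 2) (T 3) (T 4)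
     + (T 1 \<bullet> T 2) * phi (T 0) (T 3) (T 4) (T 5) - (T 1 \<bullet> T 3) * phi (T 0) (T 2) (T 4) (T 5)
     + (T 1 \<bullet> T 4) * phi (T 0) (T 2) (T 3) (T 5) - (T 1 \<bullet> T 5) * phi (T 0) (T 2) (T 3) (T 4)
     + (T 2 \<bullet> T 3) * phi (T 0) (T 1) (T 4) (T 5) - (T 2 \<bullet> T 4) * phi (T 0) (T 1) (T 3) (T 5)
     + (T 2 \<bullet> T 5) * phi (T 0) (T 1) (T 3) (T 4)
     - (T 0 \<bullet> T 3) * ((T 1 \<bullet> T 4) * (T 2 \<bullet> T 5)) + (T 0 \<bullet> T 3) * ((T 1 \<bullet> T 5) * (T 2 \<bullet> T 4))
     + (T 0 \<bullet> T 4) * ((T 1 \<bullet> T 3) * (T 2 \<bullet> T 5)) - (T 0 \<bullet> T 4) * ((T 1 \<bullet> T 5) * (T 2 \<bullet> T 3))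
     - (T 0 \<bullet> T 5) * ((T 1 \<bullet> T 3) * (T 2 \<bullet> T 4)) + (T 0 \<bullet> T 5) * ((T 1 \<bullet> T 4) * (T 2 \<bullet> T 3))"
proof -
  have so: "j < i \<Longrightarrow> phi (T i) (T j) x y = - phi (T j) (T i) x y"
    "j < i \<Longrightarrow> phi x (T i) (T j) y = - phi x (T j) (T i) y"
    "j < i \<Longrightarrow> phi x y (T i) (T j) = - phi x y (T j) (T i)"
    "j < i \<Longrightarrow> T i \<bullet> T j = T j \<bullet> T i" for i j x y
    by (rule phi_swap12 phi_swap23 phi_swap34 inner_commute)+
  have brackets1: "brackets1 x y z w = (x \<bullet> y) * (z \<bullet> w) - (z \<bullet> y) * (w \<bullet> x) + phi z w x y" for x y z w
    unfolding brackets1_def sum_brackets ..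
  note r1 = bracket_phi_exchange[of "T 0" "T 1" "T 2" "T 3" "T 4" "T 5", unfolded brackets1]
  note r2 = bracket_phi_exchange[of "T 0" "T 1" "T 3" "T 2" "T 5" "T 4", unfolded brackets1]
  note r3 = bracket_phi_exchange[of "T 3" "T 5" "T 0" "T 2" "T 1" "T 4", unfolded brackets1]
  note a1 = bracket_phi_swap13[of "T 0" "T 1" "T 2" "T 4" "T 3" "T 5", unfolded brackets1]
  note a2 = bracket_phi_skew(1)[of "T 0" "T 1" "T 2" "T 4" "T 3" "T 5"] bracket_phi_skew(1)[of "T 0" "T 1" "T 3" "T 4" "T 2" "T 5"]
    bracket_phi_skew(2)[of "T 0" "T 1" "T 3" "T 2" "T 5" "T 4"]
  note b1 = bracket_phi_swap13[of "T 3" "T 5" "T 4" "T 1" "T 0" "T 2", unfolded brackets1]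
  note b2 = bracket_phi_skew(1)[of "T 3" "T 5" "T 4" "T 0" "T 1" "T 2"] bracket_phi_skew(1)[of "T 3" "T 5" "T 0" "T 4" "T 1" "T 2"]
    bracket_phi_skew(3)[of "T 3" "T 5" "T 0" "T 4" "T 1" "T 2"]
  note c1 = bracket_phi_swap13[of "T 2" "T 4" "T 5" "T 0" "T 1" "T 3", unfolded brackets1]
  note c2 = bracket_phi_skew(3)[of "T 2" "T 4" "T 1" "T 0" "T 5" "T 3"]
  show ?thesis
    using r1 r2 r3 a1 a2 b1 b2 c1 c2
    by (simp add: so algebra_simps)
qed

lemma bracket_phi_formula:
  "bracket_phi x y p q r s =
     - (x \<bullet> p) * phi y q r s + (x \<bullet> q) * phi y p r s - (x \<bullet> r) * phi y p q s + (x \<bullet> s) * phi y p q r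
     + (y \<bullet> p) * phi x q r s - (y \<bullet> q) * phi x p r s + (y \<bullet> r) * phi x p q s - (y \<bullet> s) * phi x p q r
     + (p \<bullet> q) * phi x y r s - (p \<bullet> r) * phi x y q s + (p \<bullet> s) * phi x y q r
     - (x \<bullet> q) * ((y \<bullet> r) * (p \<bullet> s)) + (x \<bullet> q) * ((y \<bullet> s) * (p \<bullet> r))
     + (x \<bullet> r) * ((y \<bullet> q) * (p \<bullet> s)) - (x \<bullet> r) * ((y \<bullet> s) * (p \<bullet> q))
     - (x \<bullet> s) * ((y \<bullet> q) * (p \<bullet> r)) + (x \<bullet> s) * ((y \<bullet> r) * (p \<bullet> q))"
  using bracket_phi_formula_indexed[of "\<lambda>n. [x, y, p, q, r, s] ! n"] by (simp add: numeral_eq_Suc)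

section \<open>Words, alternating functions and determinants\<close>

definition imag :: "(nat \<Rightarrow> octonion) \<Rightarrow> bool" where
  "imag u \<longleftrightarrow> (\<forall>j. u j \<in> Im_oct)"

lemma imag_upd [simp]: "imag u \<Longrightarrow> v \<in> Im_oct \<Longrightarrow> imag (u(j := v))"
  by (simp add: imag_def)

lemma imagD [simp]: "imag u \<Longrightarrow> u j \<in> Im_oct"
  by (simp add: imag_def)

lemma imag_comp [simp]: "imag u \<Longrightarrow> imag (u \<circ> p)"
  by (simp add: imag_def)

text \<open>
  Linearity in one imaginary variable, stated as the expansion in the basis: this is the only form
  in which it is used, and it makes sense for functions that are linear on imaginary octonions.
\<close>

definition lin_at :: "nat \<Rightarrow> ((nat \<Rightarrow> octonion) \<Rightarrow> real) \<Rightarrow> bool" where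
  "lin_at j f \<longleftrightarrow> (\<forall>u. imag u \<longrightarrow> (\<forall>v\<in>Im_oct. f (u(j := v)) = (\<Sum>a\<in>I7. v $ a * f (u(j := oct_e a)))))"

lemma lin_atI:
  assumes "\<And>u. imag u \<Longrightarrow> linear (\<lambda>v. f (u(j := v)))"
  shows "lin_at j f"
  unfolding lin_at_def
proof (intro allI impI ballI)
  fix u v assume "imag u" and v: "v \<in> Im_oct"
  then interpret l: linear "\<lambda>v. f (u(j := v))" using assms by blast
  have "f (u(j := v)) = f (u(j := \<Sum>a\<in>I7. v $ a *\<^sub>R oct_e a))"
    using Im_oct_expand[OF v] by metis
  also have "\<dots> = (\<Sum>a\<in>I7. v $ a * f (u(j := oct_e a)))"
    unfolding l.sum by (simp only: l.scale real_scaleR_def)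
  finally show "f (u(j := v)) = (\<Sum>a\<in>I7. v $ a * f (u(j := oct_e a)))" .
qed

lemma lin_atD:
  "lin_at j f \<Longrightarrow> imag u \<Longrightarrow> v \<in> Im_oct \<Longrightarrow> f (u(j := v)) = (\<Sum>a\<in>I7. v $ a * f (u(j := oct_e a)))"
  unfolding lin_at_def by blast

lemma lin_at_add:
  assumes "lin_at j f" "lin_at j g" shows "lin_at j (\<lambda>u. f u + g u)"
  unfolding lin_at_def
proof (intro allI impI ballI)
  fix u v assume "imag u" "v \<in> Im_oct"
  from lin_atD[OF assms(1) this] lin_atD[OF assms(2) this]
  show "f (u(j := v)) + g (u(j := v)) = (\<Sum>a\<in>I7. v $ a * (f (u(j := oct_e a)) + g (u(j := oct_e a))))"
    by (simp only: distrib_left sum.distrib)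
qed

lemma lin_at_mult:
  assumes "lin_at j f" "\<And>u v. g (u(j := v)) = g u"
  shows "lin_at j (\<lambda>u. f u * g u)"
  unfolding lin_at_def
proof (intro allI impI ballI)
  fix u v assume "imag u" "v \<in> Im_oct"
  from lin_atD[OF assms(1) this]
  show "f (u(j := v)) * g (u(j := v)) = (\<Sum>a\<in>I7. v $ a * (f (u(j := oct_e a)) * g (u(j := oct_e a))))"
    by (simp only: assms(2) sum_distrib_right mult.assoc)
qed

lemma lin_at_mult':
  assumes "lin_at j f" "\<And>u v. g (u(j := v)) = g u"
  shows "lin_at j (\<lambda>u. g u * f u)"
  using lin_at_mult[of j f g, OF assms] by (simp only: mult.commute)

lemma lin_at_scale: "lin_at j f \<Longrightarrow> lin_at j (\<lambda>u. c * f u)"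
  by (rule lin_at_mult') auto

lemma lin_at_zero: "lin_at j (\<lambda>u. 0)"
  unfolding lin_at_def by simp

lemma lin_at_sum: "(\<And>i. i \<in> A \<Longrightarrow> lin_at j (f i)) \<Longrightarrow> lin_at j (\<lambda>u. \<Sum>i\<in>A. f i u)"
  by (induction A rule: infinite_finite_induct) (simp_all add: lin_at_zero lin_at_add)

lemma lin_at_diff: "lin_at j f \<Longrightarrow> lin_at j g \<Longrightarrow> lin_at j (\<lambda>u. f u - g u)"
  using lin_at_add[of j f "\<lambda>u. (-1) * g u"] lin_at_scale[of j g "-1"] by simp

text \<open>
  The operator \<open>L\<^bsub>u j\<^esub>\<close> composed along a list of indices; the first index acts last.
\<close>

definition wd :: "(nat \<Rightarrow> octonion) \<Rightarrow> nat list \<Rightarrow> octonion \<Rightarrow> octonion" where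
  "wd u js y = foldr (\<lambda>j y. u j \<odot> y) js y"

lemma wd_simps [simp]: "wd u [] y = y" "wd u (j # js) y = u j \<odot> wd u js y"
  by (simp_all add: wd_def)

lemma wd_append [simp]: "wd u (as @ bs) y = wd u as (wd u bs y)"
  by (simp add: wd_def)

lemma wd_linear: "linear (wd u js)"
proof (induction js)
  case Nil
  have "wd u [] = (\<lambda>y. y)" by (rule ext) simp
  then show ?case by (simp add: linear_ident)
next
  case (Cons j js)
  then have "linear (\<lambda>y. u j \<odot> wd u js y)"
    by (intro linearI) (simp_all add: linear_add linear_scale oct_mult_add_right oct_mult_scale_right)
  moreover have "wd u (j # js) = (\<lambda>y. u j \<odot> wd u js y)" by (rule ext) simp
  ultimately show ?case by simp
qed

lemma wd_cong: "(\<And>j. j \<in> set js \<Longrightarrow> u j = u' j) \<Longrightarrow> wd u js y = wd u' js y"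
  by (induction js) auto

lemma wd_upd_other [simp]: "j \<notin> set js \<Longrightarrow> wd (u(j := v)) js y = wd u js y"
  by (rule wd_cong) auto

lemma wd_comp: "wd (u \<circ> p) js y = wd u (map p js) y"
  by (induction js) auto

lemma wd_linear_at:
  assumes "j \<in> set js" "distinct js"
  shows "linear (\<lambda>v. wd (u(j := v)) js y)"
proof -
  obtain A B where js: "js = A @ j # B" using assms(1) by (meson split_list)
  then have "j \<notin> set A" "j \<notin> set B" using assms(2) by auto
  then have "(\<lambda>v. wd (u(j := v)) js y) = (\<lambda>v. wd u A (v \<odot> wd u B y))"
    by (simp add: js)
  moreover have "linear \<dots>"
    by (rule linearI) (simp_all add: oct_mult_add_left oct_mult_scale_left
      linear_add[OF wd_linear] linear_scale[OF wd_linear])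
  ultimately show ?thesis by simp
qed

text \<open>
  Adjacent letters of a word anticommute modulo shorter words.
\<close>

lemma wd_swap:
  assumes "imag u"
  shows "wd u (A @ a # b # C) y = - wd u (A @ b # a # C) y - (2 * (u a \<bullet> u b)) *\<^sub>R wd u (A @ C) y"
proof -
  have "u a \<odot> (u b \<odot> wd u C y) = - (u b \<odot> (u a \<odot> wd u C y)) - (2 * (u a \<bullet> u b)) *\<^sub>R wd u C y"
    by (rule Clifford) (use assms in auto)
  then show ?thesis
    by (simp add: linear_diff[OF wd_linear] linear_neg[OF wd_linear] linear_scale[OF wd_linear])
qed

lemma wd_inner:
  assumes "imag u"
  shows "wd u js x \<bullet> y = (-1) ^ length js * (x \<bullet> wd u (rev js) y)"
proof (induction js arbitrary: y)
  case (Cons j js)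
  have "wd u (j # js) x \<bullet> y = - (wd u js x \<bullet> (u j \<odot> y))"
    using inner_oct_mult_skew[of "u j" "wd u js x" y] assms by simp
  then show ?case unfolding Cons by simp
qed simp

lemma multilinear_zero:
  assumes "finite S" "\<And>j. j \<in> S \<Longrightarrow> lin_at j g"
    and "\<And>u. imag u \<Longrightarrow> (\<And>j. j \<in> S \<Longrightarrow> u j \<in> oct_e ` I7) \<Longrightarrow> g u = 0"
    and "imag u"
  shows "g u = 0"
  using assms
proof (induction S arbitrary: u rule: finite_induct)
  case empty
  then show ?case by simp
next
  case (insert j S)
  have "g u = 0" if u: "imag u" "\<And>i. i \<in> S \<Longrightarrow> u i \<in> oct_e ` I7" for u
  proof -
    have "g (u(j := oct_e a)) = 0" if "a \<in> I7" for a
      by (rule insert.prems(2)) (use u that insert.hyps in \<open>auto simp: imag_def\<close>)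
    moreover have "g (u(j := u j)) = (\<Sum>a\<in>I7. u j $ a * g (u(j := oct_e a)))"
      by (rule lin_atD) (use insert.prems(1) u in auto)
    ultimately show ?thesis by simp
  qed
  then show ?case using insert by blast
qed

definition alternating :: "nat set \<Rightarrow> ((nat \<Rightarrow> octonion) \<Rightarrow> real) \<Rightarrow> bool" where
  "alternating S g \<longleftrightarrow> (\<forall>u. imag u \<longrightarrow> (\<forall>i\<in>S. \<forall>j\<in>S. i \<noteq> j \<longrightarrow> g (u \<circ> Transposition.transpose i j) = - g u))"

lemma alternatingD:
  "alternating S g \<Longrightarrow> imag u \<Longrightarrow> i \<in> S \<Longrightarrow> j \<in> S \<Longrightarrow> i \<noteq> j \<Longrightarrow> g (u \<circ> Transposition.transpose i j) = - g u"
  unfolding alternating_def by blast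

lemma alternating_eq_zero:
  assumes "alternating S g" "imag u" "i \<in> S" "j \<in> S" "i \<noteq> j" "u i = u j"
  shows "g u = 0"
proof -
  have "u \<circ> Transposition.transpose i j = u" using assms(6) by (auto simp: fun_eq_iff Transposition.transpose_def)
  then show ?thesis using alternatingD[OF assms(1-5)] by simp
qed

text \<open>
  Transpositions generate the permutations.
\<close>

lemma alternating_permutes:
  assumes "alternating S g" "finite S" "imag u" "p permutes S"
  shows "g (u \<circ> p) = of_int (sign p) * g u"
  using assms(4,2,3)
proof (induction p arbitrary: u rule: permutes_induct)
  case id
  then show ?case by simp
next
  case (swap a b p)
  have "permutation p" using swap.hyps(4) assms(2) by (metis permutation_permutes)
  then have s: "sign (Transposition.transpose a b \<circ> p) = - sign p"
    using swap.hyps by (simp add: sign_compose permutation_swap_id sign_swap_id)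
  have "g (u \<circ> (Transposition.transpose a b \<circ> p)) = g ((u \<circ> Transposition.transpose a b) \<circ> p)" by (simp add: o_assoc)
  also have "\<dots> = of_int (sign p) * g (u \<circ> Transposition.transpose a b)"
    by (rule swap.IH[OF imag_comp[OF swap.prems]])
  also have "\<dots> = - of_int (sign p) * g u"
    using alternatingD[OF assms(1) swap.prems swap.hyps(1-3)] by simp
  finally show ?case unfolding s by (simp only: of_int_minus)
qed

lemma card_I7: "card I7 = 7"
  by (simp add: I7_def)

text \<open>
  On basis vectors two of more than seven arguments coincide.
\<close>

lemma alternating_too_many:
  assumes "alternating S g" "finite S" "card S > 7" "\<And>j. j \<in> S \<Longrightarrow> lin_at j g" "imag u"
  shows "g u = 0"
proof (rule multilinear_zero[OF assms(2,4) _ assms(5)])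
  fix u assume u: "imag u" "\<And>j. j \<in> S \<Longrightarrow> u j \<in> oct_e ` I7"
  have "card (oct_e ` I7) \<le> 7"
    by (rule order.trans[OF card_image_le]) (simp_all add: card_I7)
  moreover have "u ` S \<subseteq> oct_e ` I7" using u(2) by blast
  ultimately have "\<not> inj_on u S"
    using assms(3) card_inj_on_le[of u S "oct_e ` I7"] by auto
  then obtain i j where "i \<in> S" "j \<in> S" "i \<noteq> j" "u i = u j" unfolding inj_on_def by blast
  then show "g u = 0" using alternating_eq_zero[OF assms(1) u(1)] by blast
qed

lemma UNIV_7: "(UNIV :: 7 set) = {0, 1, 2, 3, 4, 5, 6}"
proof -
  have "card {0, 1, 2, 3, 4, 5, 6 :: 7} = CARD(7)" by simp
  from card_subset_eq[OF _ _ this] show ?thesis by simp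
qed

lemma exhaust_7: fixes i :: 7 obtains "i = 1" | "i = 2" | "i = 3" | "i = 4" | "i = 5" | "i = 6" | "i = 7"
proof -
  have "i \<in> {0, 1, 2, 3, 4, 5, 6}" using UNIV_7 by blast
  moreover have "(0::7) = 7" by simp
  ultimately show ?thesis using that by (elim insertE) simp_all
qed

lemma neq_7: "(1::7) \<noteq> 2" "(1::7) \<noteq> 3" "(1::7) \<noteq> 4" "(1::7) \<noteq> 5" "(1::7) \<noteq> 6" "(1::7) \<noteq> 7"
  "(2::7) \<noteq> 3" "(2::7) \<noteq> 4" "(2::7) \<noteq> 5" "(2::7) \<noteq> 6" "(2::7) \<noteq> 7"
  "(3::7) \<noteq> 4" "(3::7) \<noteq> 5" "(3::7) \<noteq> 6" "(3::7) \<noteq> 7"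
  "(4::7) \<noteq> 5" "(4::7) \<noteq> 6" "(4::7) \<noteq> 7"
  "(5::7) \<noteq> 6" "(5::7) \<noteq> 7" "(6::7) \<noteq> 7"
  by simp_all

text \<open>
  The position in a list of the row that the determinant of type \<open>real ^ 7 ^ 7\<close> indexes by \<open>i\<close>.  The index
  \<open>7\<close> equals \<open>0\<close>, but it belongs to the last row.
\<close>

definition idx7 :: "7 \<Rightarrow> nat" where
  "idx7 i = (if i = 1 then 0 else if i = 2 then 1 else if i = 3 then 2 else if i = 4 then 3
     else if i = 5 then 4 else if i = 6 then 5 else 6)"

lemma idx7_simps: "idx7 1 = 0" "idx7 2 = 1" "idx7 3 = 2" "idx7 4 = 3" "idx7 5 = 4" "idx7 6 = 5" "idx7 7 = 6"
  by (simp_all only: idx7_def neq_7 neq_7[symmetric] if_True if_False simp_thms)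

lemma idx7_less: "idx7 i < 7"
  by (simp add: idx7_def)

lemma idx7_inj: "idx7 i = idx7 j \<Longrightarrow> i = j"
  by (cases i rule: exhaust_7; cases j rule: exhaust_7; simp only: idx7_simps; simp)

lemma idx7_surj: assumes "n < 7" obtains i where "idx7 i = n"
proof -
  have "n \<in> {0, 1, 2, 3, 4, 5, 6}" using assms by auto
  then show ?thesis using that idx7_simps by (elim insertE) blast+
qed

lemma list7:
  assumes "length xs = 7" shows "xs = [xs!0, xs!1, xs!2, xs!3, xs!4, xs!5, xs!6]"
  using assms by (auto simp: numeral_eq_Suc length_Suc_conv)

lemma vector7:
  "(vector [x1, x2, x3, x4, x5, x6, x7] :: 'a::zero ^ 7) $ i = [x1, x2, x3, x4, x5, x6, x7] ! idx7 i"
  by (cases i rule: exhaust_7; simp only: idx7_simps; simp add: vector_def)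

definition row7 :: "octonion \<Rightarrow> real ^ 7" where
  "row7 u = vector [u $ 1, u $ 2, u $ 3, u $ 4, u $ 5, u $ 6, u $ 7]"

lemma row7_nth: "row7 u $ i = [u $ 1, u $ 2, u $ 3, u $ 4, u $ 5, u $ 6, u $ 7] ! idx7 i"
  unfolding row7_def vector7 ..

lemma row7_linear: "row7 (u + v) = row7 u + row7 v" "row7 (c *\<^sub>R u) = c *s row7 u"
proof -
  have "row7 (u + v) $ i = row7 u $ i + row7 v $ i \<and> row7 (c *\<^sub>R u) $ i = c * row7 u $ i" for i
    unfolding row7_nth by (cases i rule: exhaust_7; simp only: idx7_simps; simp)
  then show "row7 (u + v) = row7 u + row7 v" "row7 (c *\<^sub>R u) = c *s row7 u"
    by (simp_all add: vec_eq_iff)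
qed

lemma det_Im_rows:
  assumes "length us = 7"
  shows "det_Im us = det (\<chi> i. row7 (us ! idx7 i))"
proof -
  have "vector (map row7 us) $ i = row7 (us ! idx7 i)" for i :: 7
  proof -
    have "map row7 us = [row7 (us!0), row7 (us!1), row7 (us!2), row7 (us!3), row7 (us!4), row7 (us!5), row7 (us!6)]"
      by (subst list7[OF assms]) simp
    then have "vector (map row7 us) $ i = map row7 us ! idx7 i" by (simp only: vector7)
    then show ?thesis using idx7_less[of i] assms by simp
  qed
  then have "vector (map row7 us) = (\<chi> i. row7 (us ! idx7 i))" by (simp add: vec_eq_iff)
  then show ?thesis unfolding det_Im_def row7_def[abs_def, symmetric] by simp
qed

lemma det_Im_linear:
  assumes "length us = 7" "n < 7"
  shows "linear (\<lambda>v. det_Im (us[n := v]))"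
proof -
  obtain k where k: "idx7 k = n" using idx7_surj assms(2) by blast
  have "row7 (us[n := v] ! idx7 i) = (if i = k then row7 v else row7 (us ! idx7 i))" for v i
  proof (cases "i = k")
    case True
    then show ?thesis using k assms by simp
  next
    case False
    then have "n \<noteq> idx7 i" using k idx7_inj[of i k] by metis
    then show ?thesis using False by simp
  qed
  then have "det_Im (us[n := v]) = det (\<chi> i. if i = k then row7 v else row7 (us ! idx7 i))" for v
    using det_Im_rows[of "us[n := v]"] assms(1) by simp
  then show ?thesis
    by (intro linearI) (simp_all only: row7_linear det_row_add det_row_mul real_scaleR_def)
qed

lemma det_Im_repeat:
  assumes "length us = 7" "m < 7" "n < 7" "m \<noteq> n" "us ! m = us ! n"
  shows "det_Im us = 0"
proof -
  obtain k l where kl: "idx7 k = m" "idx7 l = n" using idx7_surj assms(2,3) by metis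
  show ?thesis unfolding det_Im_rows[OF assms(1)]
    by (rule det_identical_rows[of k l]) (use kl assms in \<open>auto simp: row_def\<close>)
qed

definition std_basis :: "octonion list" where
  "std_basis = [oct_e 1, oct_e 2, oct_e 3, oct_e 4, oct_e 5, oct_e 6, oct_e 7]"

lemma det_Im_std_basis: "det_Im std_basis = 1"
proof -
  have "row7 (std_basis ! idx7 i) $ j = (mat 1 :: real ^ 7 ^ 7) $ i $ j" for i j
    unfolding row7_nth std_basis_def mat_def vec_lambda_beta
    by (cases i rule: exhaust_7; cases j rule: exhaust_7; simp only: idx7_simps neq_7 neq_7[symmetric];
        simp add: oct_e_coords)
  then have "(\<chi> i. row7 (std_basis ! idx7 i)) = (mat 1 :: real ^ 7 ^ 7)"
    by (simp add: vec_eq_iff)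
  moreover have "length std_basis = 7" by (simp add: std_basis_def)
  ultimately show ?thesis by (simp add: det_Im_rows)
qed

lemma map_upd_nth:
  assumes "distinct js" "n < length js"
  shows "map (u(js ! n := v)) js = (map u js)[n := v]"
  by (rule nth_equalityI) (use assms in \<open>auto simp: nth_list_update nth_eq_iff_index_eq\<close>)

lemma det_Im_map_linear:
  assumes "distinct js" "length js = 7" "j \<in> set js"
  shows "linear (\<lambda>v. det_Im (map (u(j := v)) js))"
proof -
  obtain n where "n < 7" "j = js ! n" using assms(2,3) by (metis in_set_conv_nth)
  then show ?thesis using map_upd_nth[OF assms(1), of n u] det_Im_linear[of "map u js" n] assms(2) by simp
qed

lemma skew_of_diag:
  fixes B :: "octonion \<Rightarrow> octonion \<Rightarrow> real"
  assumes "\<And>y. linear (\<lambda>x. B x y)" "\<And>x. linear (\<lambda>y. B x y)" "\<And>x. B x x = 0"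
  shows "B y x = - B x y"
proof -
  have "B (x + y) (x + y) = B x x + B x y + (B y x + B y y)"
    by (simp add: linear_add[OF assms(1)] linear_add[OF assms(2)])
  then show ?thesis by (simp add: assms(3))
qed

lemma det_Im_alternating:
  assumes "distinct js" "length js = 7"
  shows "alternating (set js) (\<lambda>u. det_Im (map u js))"
  unfolding alternating_def
proof (intro allI impI ballI)
  fix u i j assume ij: "i \<in> set js" "j \<in> set js" "i \<noteq> j"
  define B where "B x y = det_Im (map (u(i := x, j := y)) js)" for x y
  have "B (u j) (u i) = - B (u i) (u j)"
  proof (rule skew_of_diag)
    fix y show "linear (\<lambda>x. B x y)"
      unfolding B_def fun_upd_twist[OF ij(3), of u] by (rule det_Im_map_linear[OF assms ij(1)])
    show "linear (\<lambda>x. B y x)"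
      unfolding B_def by (rule det_Im_map_linear[OF assms ij(2)])
    obtain m n where "m < 7" "i = js ! m" "n < 7" "j = js ! n" using assms(2) ij by (metis in_set_conv_nth)
    then show "B y y = 0" unfolding B_def
      by (intro det_Im_repeat[of _ m n]) (use assms ij in auto)
  qed
  moreover have "u \<circ> Transposition.transpose i j = u(i := u j, j := u i)"
    using ij(3) by (auto simp: fun_eq_iff Transposition.transpose_def)
  ultimately show "det_Im (map (u \<circ> Transposition.transpose i j) js) = - det_Im (map u js)"
    by (simp add: B_def)
qed

text \<open>
  The assignment that sends the seven listed variables to the standard basis, in order.  Off
  the list the value is \<open>0\<close>, which is imaginary.
\<close>

definition std_assign :: "nat list \<Rightarrow> nat \<Rightarrow> octonion" where
  "std_assign js j = (case map_of (zip js std_basis) j of Some v \<Rightarrow> v | None \<Rightarrow> 0)"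

lemma map_std_assign:
  assumes "distinct js" "length js = 7" shows "map (std_assign js) js = std_basis"
proof (rule nth_equalityI)
  fix n assume "n < length (map (std_assign js) js)"
  then have n: "n < length js" by simp
  have l: "length js = length std_basis" using assms by (simp add: std_basis_def)
  have "map_of (zip js std_basis) (js ! n) = Some (std_basis ! n)"
    by (rule map_of_zip_nth) (use assms n l in auto)
  then show "map (std_assign js) js ! n = std_basis ! n" using n by (simp add: std_assign_def)
qed (use assms in \<open>simp add: std_basis_def\<close>)

definition std_override :: "nat list \<Rightarrow> (nat \<Rightarrow> octonion) \<Rightarrow> nat \<Rightarrow> octonion" where
  "std_override js u j = (if j \<in> set js then std_assign js j else u j)"

lemma set_std_basis: "set std_basis = oct_e ` I7"
  by (simp add: std_basis_def I7_def)

lemma distinct_std_basis: "distinct std_basis"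
proof -
  have "oct_e i = oct_e j \<longleftrightarrow> i = j" for i j
    by (metis oct_e_coords zero_neq_one)
  then show ?thesis by (simp add: std_basis_def)
qed

lemma std_assign_bij:
  assumes "distinct js" "length js = 7"
  shows "bij_betw (std_assign js) (set js) (oct_e ` I7)"
proof -
  have "distinct (map (std_assign js) js)" using map_std_assign[OF assms] distinct_std_basis by simp
  then have "inj_on (std_assign js) (set js)" by (simp add: distinct_map)
  moreover have "std_assign js ` set js = oct_e ` I7"
    using map_std_assign[OF assms] set_std_basis by (metis set_map)
  ultimately show ?thesis by (simp add: bij_betw_def)
qed

lemma imag_std_override:
  assumes "distinct js" "length js = 7" "imag u"
  shows "imag (std_override js u)"
proof -
  have "std_assign js j \<in> Im_oct" if "j \<in> set js" for j
  proof -
    have "std_assign js j \<in> oct_e ` I7" using std_assign_bij[OF assms(1,2)] that by (rule bij_betwE[THEN bspec])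
    then show ?thesis by (rule imageE) (simp only: oct_e_Im)
  qed
  then show ?thesis using assms(3) by (simp add: imag_def std_override_def)
qed

lemma map_std_override:
  assumes "distinct js" "length js = 7" shows "map (std_override js u) js = std_basis"
proof -
  have "map (std_override js u) js = map (std_assign js) js" by (rule map_cong) (simp_all add: std_override_def)
  then show ?thesis using map_std_assign[OF assms] by simp
qed

text \<open>
  The difference of both sides is alternating and multilinear, so it suffices to test it on basis
  vectors.  If two of them coincide it vanishes; otherwise they are a permutation of the
  standard assignment, where the determinant is 1.
\<close>

lemma alternating_det:
  assumes js: "distinct js" "length js = 7" and alt: "alternating (set js) f"
    and lin: "\<And>j. j \<in> set js \<Longrightarrow> lin_at j f" and "imag u"
  shows "f u = det_Im (map u js) * f (std_override js u)"
proof -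
  define g where "g u = f u - det_Im (map u js) * f (std_override js u)" for u
  have override_upd: "std_override js (u(j := v)) = std_override js u" if "j \<in> set js" for u j v
    using that by (auto simp: std_override_def fun_eq_iff)
  have override_transpose: "std_override js (u \<circ> Transposition.transpose i j) = std_override js u" if "i \<in> set js" "j \<in> set js" for u i j
    using that by (auto simp: std_override_def fun_eq_iff Transposition.transpose_def)
  have glin: "lin_at j g" if j: "j \<in> set js" for j
    unfolding g_def
    by (intro lin_at_diff lin[OF j] lin_at_mult lin_atI det_Im_map_linear js j)
       (simp add: override_upd j)
  have galt: "alternating (set js) g"
    using alt det_Im_alternating[OF js] unfolding alternating_def g_def
    by (simp add: override_transpose)
  have "g u = 0"
  proof (rule multilinear_zero[OF _ glin _ \<open>imag u\<close>])
    fix u assume u: "imag u" "\<And>j. j \<in> set js \<Longrightarrow> u j \<in> oct_e ` I7"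
    show "g u = 0"
    proof (cases "inj_on u (set js)")
      case False
      then obtain i j where "i \<in> set js" "j \<in> set js" "i \<noteq> j" "u i = u j" unfolding inj_on_def by blast
      then show ?thesis using alternating_eq_zero[OF galt u(1)] by blast
    next
      case True
      note sb = std_assign_bij[OF js]
      define w where "w = std_override js u"
      define p where "p j = (if j \<in> set js then inv_into (set js) (std_assign js) (u j) else j)" for j
      have "bij_betw (inv_into (set js) (std_assign js)) (oct_e ` I7) (set js)"
        by (rule bij_betw_inv_into[OF sb])
      moreover have "u ` set js \<subseteq> oct_e ` I7" using u(2) by blast
      ultimately have inv_inj: "inj_on (inv_into (set js) (std_assign js)) (u ` set js)"
        by (meson bij_betw_def inj_on_subset)
      have pin: "p j \<in> set js" if "j \<in> set js" for j
        using that u(2)[OF that] sb by (auto simp: p_def bij_betw_def intro: inv_into_into)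
      have "inj_on p (set js)"
      proof (rule inj_onI)
        fix i j assume ij: "i \<in> set js" "j \<in> set js" "p i = p j"
        then have "u i = u j" using inv_inj by (simp add: p_def inj_on_def)
        then show "i = j" using True ij by (simp add: inj_on_def)
      qed
      then have "p ` set js = set js"
        using pin by (intro endo_inj_surj) auto
      with \<open>inj_on p (set js)\<close> have "bij_betw p (set js) (set js)" by (simp add: bij_betw_def)
      then have perm: "p permutes set js" by (rule bij_imp_permutes) (simp add: p_def)
      have "std_assign js (p j) = u j" if "j \<in> set js" for j
        using that u(2)[OF that] sb by (simp add: p_def bij_betw_def f_inv_into_f)
      then have "u = w \<circ> p"
        using pin by (auto simp: fun_eq_iff w_def std_override_def p_def)
      moreover have "imag w" unfolding w_def by (rule imag_std_override[OF js u(1)])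
      moreover have "g w = 0"
      proof -
        have "std_override js w = w" by (auto simp: w_def std_override_def)
        moreover have "det_Im (map w js) = 1" unfolding w_def map_std_override[OF js] by (rule det_Im_std_basis)
        ultimately show ?thesis by (simp add: g_def)
      qed
      ultimately show ?thesis using alternating_permutes[OF galt _ _ perm] by simp
    qed
  qed simp
  then show ?thesis by (simp add: g_def)
qed

text \<open>
  A function of words that changes sign modulo \<open>N\<close> under swaps of adjacent letters changes by the
  sign modulo \<open>N\<close> under every permutation.  It is used with \<open>N\<close> the functions that vanish at a
  point, and with \<open>N\<close> the span of products of basic functions.
\<close>

lemma permuted_word_sign:
  fixes G :: "nat list \<Rightarrow> 's \<Rightarrow> real" and N :: "('s \<Rightarrow> real) \<Rightarrow> bool"
  assumes N0: "N (\<lambda>s. 0)" and Nadd: "\<And>f g. N f \<Longrightarrow> N g \<Longrightarrow> N (\<lambda>s. f s + g s)"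
    and Nscale: "\<And>c f. N f \<Longrightarrow> N (\<lambda>s. c * f s)"
    and swap: "\<And>A a b C. mset (A @ a # b # C) = mset xs \<Longrightarrow> N (\<lambda>s. G (A @ a # b # C) s + G (A @ b # a # C) s)"
    and xs: "distinct xs" and p: "p permutes set xs"
  shows "N (\<lambda>s. G (map p xs) s - of_int (sign p) * G xs s)"
proof -
  \<comment> \<open>swapping two distant letters takes an odd number of adjacent swaps\<close>
  have far: "N (\<lambda>s. G (A @ a # B @ b # C) s + G (A @ b # B @ a # C) s)"
    if "mset (A @ a # B @ b # C) = mset xs" for A a B b C
    using that
  proof (induction B arbitrary: A)
    case Nil
    then show ?case using swap[of A a b C] by simp
  next
    case (Cons c B)
    have 1: "N (\<lambda>s. G (A @ a # c # B @ b # C) s + G (A @ c # a # B @ b # C) s)"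
      by (rule swap) (use Cons.prems in \<open>simp add: add_mset_commute\<close>)
    have 2: "N (\<lambda>s. G ((A @ [c]) @ a # B @ b # C) s + G ((A @ [c]) @ b # B @ a # C) s)"
      by (rule Cons.IH) (use Cons.prems in \<open>simp add: add_mset_commute\<close>)
    have 3: "N (\<lambda>s. G (A @ c # b # B @ a # C) s + G (A @ b # c # B @ a # C) s)"
      by (rule swap) (use Cons.prems in \<open>simp add: add_mset_commute\<close>)
    have "N (\<lambda>s. ((G (A @ a # c # B @ b # C) s + G (A @ c # a # B @ b # C) s)
        + (-1) * (G ((A @ [c]) @ a # B @ b # C) s + G ((A @ [c]) @ b # B @ a # C) s))
        + (G (A @ c # b # B @ a # C) s + G (A @ b # c # B @ a # C) s))"
      by (intro Nadd Nscale 1 2 3)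
    then show ?case by simp
  qed
  show ?thesis
    using p finite_set[of xs]
  proof (induction rule: permutes_induct)
    case id
    then show ?case using N0 by simp
  next
    case (swap a b p)
    define ys where "ys = map p xs"
    have perm: "permutation p" using swap.hyps(4) by (metis permutation_permutes finite_set)
    then have s: "sign (Transposition.transpose a b \<circ> p) = - sign p"
      using swap.hyps by (simp add: sign_compose permutation_swap_id sign_swap_id)
    have ys: "distinct ys" "set ys = set xs"
      using xs swap.hyps(4) by (auto simp: ys_def distinct_map permutes_image intro: permutes_inj_on)
    then have "mset ys = mset xs" using xs by (simp add: set_eq_iff_mset_eq_distinct)
    have key: "N (\<lambda>s. G (map (Transposition.transpose c d) ys) s + G ys s)"
      if "ys = A @ c # B @ d # C" for A B C c d
    proof -
      have "map (Transposition.transpose c d) A = A" "map (Transposition.transpose c d) B = B" "map (Transposition.transpose c d) C = C"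
        using ys(1) that by (auto intro!: map_idI simp: Transposition.transpose_def)
      then have "map (Transposition.transpose c d) ys = A @ d # B @ c # C" using that by simp
      then show ?thesis using far[of A c B d C] that \<open>mset ys = mset xs\<close> by (simp add: add.commute)
    qed
    have "N (\<lambda>s. G (map (Transposition.transpose a b) ys) s + G ys s)"
    proof -
      obtain A D where AD: "ys = A @ a # D" using swap.hyps(1) ys by (metis split_list)
      show ?thesis
      proof (cases "b \<in> set D")
        case True
        then obtain B C where "D = B @ b # C" by (meson split_list)
        then show ?thesis using key AD by simp
      next
        case False
        then have "b \<in> set A" using swap.hyps(2,3) ys AD by auto
        then obtain B C where "A = B @ b # C" by (meson split_list)
        then have "ys = B @ b # C @ a # D" using AD by simp
        from key[OF this] show ?thesis by (simp add: transpose_commute)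
      qed
    qed
    from Nadd[OF this Nscale[OF swap.IH, of "-1"]]
    have "N (\<lambda>s. (G (map (Transposition.transpose a b) ys) s + G ys s) + (-1) * (G (map p xs) s - of_int (sign p) * G xs s))" .
    then show ?case unfolding s by (simp add: ys_def comp_def)
  qed
qed

lemma std_assign_orthogonal:
  assumes "distinct js" "length js = 7" "i \<in> set js" "j \<in> set js" "i \<noteq> j"
  shows "std_override js u i \<bullet> std_override js u j = 0"
proof -
  obtain a where a: "a \<in> I7" "std_assign js i = oct_e a" using std_assign_bij[OF assms(1,2)] assms(3) bij_betwE by blast
  obtain b where b: "b \<in> I7" "std_assign js j = oct_e b" using std_assign_bij[OF assms(1,2)] assms(4) bij_betwE by blast
  have "std_assign js i \<noteq> std_assign js j"
    using std_assign_bij[OF assms(1,2)] assms(3-5) by (meson bij_betw_def inj_onD)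
  then have "b \<noteq> a" using a b by auto
  then show ?thesis using a b assms by (simp add: std_override_def oct_e_coords)
qed

text \<open>
  The alternation of \<open>L\<^sub>u\<^sub>1 \<dots> L\<^sub>u\<^sub>7\<close> is a multiple of the determinant, and orthonormal vectors anticommute,
  so that on the standard basis all \<open>7!\<close> summands equal \<open>L\<^sub>1 \<dots> L\<^sub>7 = -1\<close>.
\<close>

lemma alternated_word:
  assumes js: "distinct js" "length js = 7" and "imag u"
  shows "(\<Sum>p | p permutes set js. of_int (sign p) * (y \<bullet> wd u (map p js) z))
     = - fact 7 * det_Im (map u js) * (y \<bullet> z)"
proof -
  define f where "f u = (\<Sum>p | p permutes set js. of_int (sign p) * (y \<bullet> wd u (map p js) z))" for u
  have lin: "lin_at j f" if j: "j \<in> set js" for j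
    unfolding f_def
  proof (intro lin_at_sum lin_at_scale lin_atI)
    fix p u assume "p \<in> {p. p permutes set js}"
    then have "j \<in> set (map p js)" "distinct (map p js)"
      using j js(1) by (auto simp: distinct_map permutes_image intro: permutes_inj_on)
    note l = wd_linear_at[OF this, of u z]
    show "linear (\<lambda>v. y \<bullet> wd (u(j := v)) (map p js) z)"
      by (intro linearI) (simp_all only: linear_add[OF l] linear_scale[OF l] inner_add_right inner_scaleR_right real_scaleR_def)
  qed
  have alt: "alternating (set js) f"
    unfolding alternating_def
  proof (intro allI impI ballI)
    fix u i j assume ij: "i \<in> set js" "j \<in> set js" "i \<noteq> j"
    let ?t = "Transposition.transpose i j"
    have t: "?t permutes set js" using ij by (simp add: permutes_swap_id)
    have "f (u \<circ> ?t) = (\<Sum>p | p permutes set js. of_int (sign p) * (y \<bullet> wd u (map (?t \<circ> p) js) z))"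
      unfolding f_def wd_comp by simp
    also have "\<dots> = (\<Sum>p | p permutes set js. - (of_int (sign p) * (y \<bullet> wd u (map p js) z)))"
    proof (rule sum.reindex_bij_witness[of _ "\<lambda>p. ?t \<circ> p" "\<lambda>p. ?t \<circ> p"])
      fix p assume p: "p \<in> {p. p permutes set js}"
      then have "permutation p" by (metis mem_Collect_eq permutation_permutes finite_set)
      then have "sign (?t \<circ> p) = - sign p"
        using ij by (simp add: sign_compose permutation_swap_id sign_swap_id)
      then show "- (of_int (sign (?t \<circ> p)) * (y \<bullet> wd u (map (?t \<circ> p) js) z)) = of_int (sign p) * (y \<bullet> wd u (map (?t \<circ> p) js) z)"
        by simp
      show "?t \<circ> p \<in> {p. p permutes set js}" using p t by (simp add: permutes_compose)
      show "?t \<circ> (?t \<circ> p) = p" by (simp add: o_assoc)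
      then show "?t \<circ> (?t \<circ> p) = p" .
      show "?t \<circ> p \<in> {p. p permutes set js}" using p t by (simp add: permutes_compose)
    qed
    finally show "f (u \<circ> ?t) = - f u" by (simp add: f_def sum_negf)
  qed
  have "f (std_override js u) = - fact 7 * (y \<bullet> z)"
  proof -
    let ?w = "std_override js u"
    have w: "imag ?w" by (rule imag_std_override[OF js \<open>imag u\<close>])
    have val: "wd ?w js z = - z"
    proof -
      have "wd ?w js z = foldr (\<odot>) (map ?w js) z" by (simp add: wd_def foldr_map comp_def)
      then show ?thesis unfolding map_std_override[OF js] std_basis_def by (simp add: oct_e_word)
    qed
    have "y \<bullet> wd ?w (map p js) z = of_int (sign p) * (y \<bullet> wd ?w js z)" if "p permutes set js" for p
    proof -
      have "(\<lambda>s::unit. y \<bullet> wd ?w (map p js) z - of_int (sign p) * (y \<bullet> wd ?w js z)) () = 0"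
      proof (rule permuted_word_sign[where N = "\<lambda>f. f () = 0" and G = "\<lambda>ks s. y \<bullet> wd ?w ks z"])
        fix A a b C assume m: "mset (A @ a # b # C) = mset js"
        then have "distinct (A @ a # b # C)" using js(1) by (metis mset_eq_imp_distinct_iff)
        moreover have "set (A @ a # b # C) = set js" using m by (metis mset_eq_setD)
        ultimately have "?w a \<bullet> ?w b = 0" by (intro std_assign_orthogonal[OF js]) auto
        then show "y \<bullet> wd ?w (A @ a # b # C) z + y \<bullet> wd ?w (A @ b # a # C) z = 0"
          unfolding wd_swap[OF w, of A a b C] by simp
      qed (use js that in auto)
      then show ?thesis by simp
    qed
    then have "f ?w = (\<Sum>p | p permutes set js. of_int (sign p * sign p) * (y \<bullet> wd ?w js z))"
      unfolding f_def by (intro sum.cong) (auto simp: mult.assoc simp del: sign_idempotent)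
    also have "\<dots> = fact 7 * (y \<bullet> wd ?w js z)"
      using card_permutations[of "set js" 7] js by (simp add: distinct_card)
    finally show ?thesis by (simp add: val)
  qed
  then show ?thesis
    using alternating_det[OF js alt lin \<open>imag u\<close>] unfolding f_def by simp
qed

section \<open>The span of products of basic functions\<close>

text \<open>
  Membership in the span of the products of basic functions in exactly the variables indexed by \<open>J\<close>
  and \<open>K\<close>, where functions count as equal if they agree whenever all vector variables are imaginary.  The
  inductive form makes it possible to treat linear operations by rule induction.
\<close>

inductive spanned :: "nat set \<Rightarrow> nat set \<Rightarrow> tuple_fun \<Rightarrow> bool" for J K where
  zero: "spanned J K (\<lambda>u x. 0)"
| step: "spanned J K f \<Longrightarrow> gen_product J K p \<Longrightarrow> spanned J K (\<lambda>u x. c * p u x + f u x)"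
| cong: "spanned J K f \<Longrightarrow> (\<And>u x. imag u \<Longrightarrow> f u x = g u x) \<Longrightarrow> spanned J K g"

text \<open>
  To prove that a linear operation preserves the span it suffices to apply it to products.
\<close>

lemma spanned_lift_step:
  assumes "spanned J K f"
    and gen: "\<And>p. gen_product J K p \<Longrightarrow> spanned J' K' (T p)"
    and zero: "\<And>u x. imag u \<Longrightarrow> T (\<lambda>u x. 0) u x = 0"
    and lin: "\<And>c p f u x. imag u \<Longrightarrow> T (\<lambda>u x. c * p u x + f u x) u x = c * T p u x + T f u x"
    and cong: "\<And>f g u x. (\<And>u x. imag u \<Longrightarrow> f u x = g u x) \<Longrightarrow> imag u \<Longrightarrow> T f u x = T g u x"
    and step: "\<And>c p f. spanned J' K' p \<Longrightarrow> spanned J' K' f \<Longrightarrow> spanned J' K' (\<lambda>u x. c * p u x + f u x)"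
  shows "spanned J' K' (T f)"
  using assms(1)
proof induction
  case zero
  show ?case by (rule spanned.cong[OF spanned.zero]) (simp add: assms(3))
next
  case (step f p c)
  show ?case
    by (rule spanned.cong[OF assms(6)[OF gen[OF step.hyps(2)] step.IH, of c]]) (simp add: lin)
next
  case (cong f g)
  show ?case by (rule spanned.cong[OF cong.IH]) (rule assms(5), auto simp: cong.hyps)
qed

lemma spanned_add: assumes "spanned J K f" "spanned J K g" shows "spanned J K (\<lambda>u x. f u x + g u x)"
  using assms(1)
proof induction
  case zero
  then show ?case using assms(2) by simp
next
  case (step f p c)
  from spanned.step[OF step.IH step.hyps(2), of c] show ?case by (simp only: add.assoc)
next
  case (cong f f')
  show ?case by (rule spanned.cong[OF cong.IH]) (simp add: cong.hyps)
qed

lemma spanned_gen: "gen_product J K p \<Longrightarrow> spanned J K p"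
  using spanned.step[OF spanned.zero, of J K p 1] by simp

lemma spanned_scale: assumes "spanned J K f" shows "spanned J K (\<lambda>u x. c * f u x)"
  using assms
proof induction
  case zero
  then show ?case using spanned.zero by simp
next
  case (step f p d)
  from spanned.step[OF step.IH step.hyps(2), of "c * d"] show ?case by (simp only: distrib_left mult.assoc)
next
  case (cong f f')
  show ?case by (rule spanned.cong[OF cong.IH]) (simp add: cong.hyps)
qed

lemmas spanned_lift = spanned_lift_step[OF _ _ _ _ _ spanned_add[OF spanned_scale]]

lemma spanned_neg: "spanned J K f \<Longrightarrow> spanned J K (\<lambda>u x. - f u x)"
  using spanned_scale[of J K f "-1"] by simp

lemma spanned_diff: "spanned J K f \<Longrightarrow> spanned J K g \<Longrightarrow> spanned J K (\<lambda>u x. f u x - g u x)"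
  using spanned_add[OF _ spanned_neg, of J K f g] by simp

lemma spanned_sum: "(\<And>i. i \<in> A \<Longrightarrow> spanned J K (f i)) \<Longrightarrow> spanned J K (\<lambda>u x. \<Sum>i\<in>A. f i u x)"
  by (induction A rule: infinite_finite_induct) (simp_all add: spanned.zero spanned_add)

lemma spanned_sets: "spanned J K f \<Longrightarrow> J = J' \<Longrightarrow> K = K' \<Longrightarrow> spanned J' K' f"
  by simp

lemma gen_product_mult:
  assumes "gen_product J K p" "gen_product J' K' q" "J \<inter> J' = {}" "K \<inter> K' = {}"
  shows "gen_product (J \<union> J') (K \<union> K') (\<lambda>u x. p u x * q u x)"
  using assms
proof (induction rule: gen_product.induct)
  case empty
  then show ?case by simp
next
  case (times J1 K1 f J2 K2 p)
  have "gen_product (J1 \<union> (J2 \<union> J')) (K1 \<union> (K2 \<union> K')) (\<lambda>u x. f u x * (p u x * q u x))"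
    by (rule gen_product.times[OF times.hyps(1) times.IH]) (use times.hyps times.prems in auto)
  then show ?case by (simp only: Un_assoc mult.assoc)
qed

lemma spanned_mult:
  assumes "spanned J K f" "spanned J' K' g" "J \<inter> J' = {}" "K \<inter> K' = {}"
  shows "spanned (J \<union> J') (K \<union> K') (\<lambda>u x. f u x * g u x)"
proof (rule spanned_lift[where T = "\<lambda>f u x. f u x * g u x", OF assms(1)])
  fix p assume p: "gen_product J K p"
  show "spanned (J \<union> J') (K \<union> K') (\<lambda>u x. p u x * g u x)"
  proof (rule spanned_lift[where T = "\<lambda>g u x. p u x * g u x", OF assms(2)])
    fix q assume "gen_product J' K' q"
    from spanned_gen[OF gen_product_mult[OF p this assms(3,4)]]
    show "spanned (J \<union> J') (K \<union> K') (\<lambda>u x. p u x * q u x)" .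
  qed (auto simp: algebra_simps)
qed (auto simp: algebra_simps)

lemma spanned_const: "spanned {} {} (\<lambda>u x. c)"
  using spanned_scale[OF spanned_gen[OF gen_product.empty], of c] by simp

lemma spanned_generator: "generator J K f \<Longrightarrow> spanned J K f"
  using spanned_gen[OF gen_product.times[OF _ gen_product.empty, of J K f]] by simp

lemma spanned_inner_u: "i \<noteq> j \<Longrightarrow> spanned {i, j} {} (\<lambda>u x. u i \<bullet> u j)"
proof (induction i j rule: linorder_wlog)
  case (le a b)
  then show ?case by (intro spanned_generator generator.inner_u) simp
next
  case (sym a b)
  then show ?case by (simp add: insert_commute inner_commute)
qed

text \<open>
  Sorting the arguments of a determinant changes it by a constant factor.
\<close>

lemma spanned_det:
  assumes "distinct js" "length js = 7"
  shows "spanned (set js) {} (\<lambda>u x. det_Im (map u js))"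
proof -
  define ss where "ss = sorted_list_of_set (set js)"
  have set_ss: "set ss = set js" by (simp add: ss_def)
  have ss: "distinct ss" "length ss = 7"
    using assms by (simp_all add: ss_def distinct_card)
  have "generator (set ss) {} (\<lambda>u x. det_Im (map u ss))"
    by (rule generator.det_u) (simp_all add: ss_def strict_sorted_list_of_set, use assms in \<open>simp add: distinct_card\<close>)
  from spanned_scale[OF spanned_generator[OF this], of "det_Im (map (std_assign ss) js)"]
  have "spanned (set js) {} (\<lambda>u x. det_Im (map (std_assign ss) js) * det_Im (map u ss))" by (simp add: set_ss)
  then show ?thesis
  proof (rule spanned.cong)
    fix u :: "nat \<Rightarrow> octonion" and x :: "nat \<Rightarrow> octonion" assume u: "imag u"
    have "det_Im (map u js) = det_Im (map u ss) * det_Im (map (std_override ss u) js)"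
      by (rule alternating_det[OF ss _ _ u]) (use det_Im_alternating[OF assms] assms in \<open>auto simp: set_ss intro!: lin_atI det_Im_map_linear\<close>)
    also have "map (std_override ss u) js = map (std_assign ss) js"
      by (rule map_cong) (simp_all add: std_override_def set_ss)
    finally show "det_Im (map (std_assign ss) js) * det_Im (map u ss) = det_Im (map u js)" by simp
  qed
qed

text \<open>
  Any two lists with the same entries are connected by swaps of adjacent entries.
\<close>

lemma adjacent_swaps:
  assumes swap: "\<And>A a b C. P (A @ a # b # C) \<Longrightarrow> P (A @ b # a # C)"
    and "mset xs = mset ys" "P (A @ xs)"
  shows "P (A @ ys)"
  using assms(2,3)
proof (induction xs arbitrary: A ys)
  case Nil
  then show ?case by simp
next
  case (Cons x xs)
  have "x \<in> set ys" using Cons.prems(1) by (metis list.set_intros(1) mset_eq_setD)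
  then obtain B D where ys: "ys = B @ x # D" by (meson split_list)
  have "P ((A @ [x]) @ B @ D)" by (rule Cons.IH) (use Cons.prems ys in auto)
  then have "P (A @ x # B @ D)" by simp
  then have "P (A @ B @ x # D)"
  proof (induction B arbitrary: A)
    case (Cons b B)
    have "P (A @ b # x # B @ D)" using swap[of A x b "B @ D"] Cons.prems by simp
    then show ?case using Cons.IH[of "A @ [b]"] by simp
  qed simp
  then show ?case by (simp add: ys)
qed

text \<open>
  Induction on the length of the word.  A swap of adjacent letters changes the sign modulo an inner
  product times a shorter bracket, so a word of length at most seven can be sorted.  In a longer word
  the first seven letters can be alternated at the cost of shorter brackets, and their
  alternation is a determinant times a shorter bracket.
\<close>

lemma spanned_bracket:
  assumes "distinct js" "k \<noteq> l"
  shows "spanned (set js) {k, l} (\<lambda>u x. x k \<bullet> wd u js (x l))"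
  using assms
proof (induction "length js" arbitrary: js k l rule: less_induct)
  case less
  have swap: "spanned (set js) {k, l} (\<lambda>u x. x k \<bullet> wd u (A @ a # b # C) (x l) + x k \<bullet> wd u (A @ b # a # C) (x l))"
    if m: "mset (A @ a # b # C) = mset js" and "k \<noteq> l" for A a b C k l
  proof -
    have d: "distinct (A @ a # b # C)" using m less.prems(1) by (metis mset_eq_imp_distinct_iff)
    have s: "set js = {a, b} \<union> set (A @ C)" using mset_eq_setD[OF m] by auto
    have "length js = length (A @ a # b # C)" using m by (metis size_mset)
    then have "spanned (set (A @ C)) {k, l} (\<lambda>u x. x k \<bullet> wd u (A @ C) (x l))"
      by (intro less.hyps \<open>k \<noteq> l\<close>) (use d in auto)
    from spanned_scale[OF spanned_mult[OF spanned_inner_u this], of a b "-2"] d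
    have "spanned (set js) {k, l} (\<lambda>u x. -2 * ((u a \<bullet> u b) * (x k \<bullet> wd u (A @ C) (x l))))"
      unfolding s by simp
    then show ?thesis
    proof (rule spanned.cong)
      fix u x :: "nat \<Rightarrow> octonion" assume "imag u"
      from wd_swap[OF this, of A a b C "x l"]
      show "- 2 * (u a \<bullet> u b * (x k \<bullet> wd u (A @ C) (x l)))
        = x k \<bullet> wd u (A @ a # b # C) (x l) + x k \<bullet> wd u (A @ b # a # C) (x l)"
        by (simp del: wd_append wd_simps add: inner_diff_right)
    qed
  qed
  show ?case
  proof (cases "length js \<le> 7")
    case True
    define ss where "ss = sorted_list_of_set (set js)"
    have ss: "mset ss = mset js" "sorted_wrt (<) ss" "length ss = length js"
      using less.prems(1) by (simp_all add: ss_def set_eq_iff_mset_eq_distinct[symmetric] strict_sorted_list_of_set distinct_card)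
    have lt: "spanned (set js) {k, l} (\<lambda>u x. x k \<bullet> wd u ks (x l))" if "k < l" "mset ks = mset js" for k l ks
    proof -
      define P where "P ks \<longleftrightarrow> mset ks = mset js \<and> spanned (set js) {k, l} (\<lambda>u x. x k \<bullet> wd u ks (x l))" for ks
      have "spanned (set ss) {k, l} (\<lambda>u x. x k \<bullet> wd u ss (x l))"
        unfolding wd_def by (intro spanned_generator generator.inner_x) (use ss True that in auto)
      then have "P ([] @ ss)" using ss(1) by (simp add: P_def ss_def)
      have "P ([] @ ks)"
      proof (rule adjacent_swaps[of P ss ks "[]", OF _ _ \<open>P ([] @ ss)\<close>])
        fix A a b C assume "P (A @ a # b # C)"
        then have P: "mset (A @ a # b # C) = mset js" "spanned (set js) {k, l} (\<lambda>u x. x k \<bullet> wd u (A @ a # b # C) (x l))"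
          by (simp_all add: P_def)
        from spanned_diff[OF swap[OF P(1)] P(2)] \<open>k < l\<close> P(1)
        show "P (A @ b # a # C)" by (simp add: P_def add_mset_commute)
      qed (use ss that in simp)
      then show ?thesis by (simp add: P_def)
    qed
    show ?thesis
    proof (cases "k < l")
      case True
      then show ?thesis by (rule lt) simp
    next
      case False
      then have "spanned (set js) {l, k} (\<lambda>u x. x l \<bullet> wd u (rev js) (x k))"
        using less.prems(2) by (intro lt) auto
      from spanned_scale[OF this, of "(-1) ^ length js"]
      have "spanned (set js) {k, l} (\<lambda>u x. (-1) ^ length js * (x l \<bullet> wd u (rev js) (x k)))"
        by (simp add: insert_commute)
      then show ?thesis
        by (rule spanned.cong) (simp only: wd_inner[symmetric] inner_commute)
    qed
  next
    case False
    define hs where "hs = take 7 js"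
    define ts where "ts = drop 7 js"
    have js: "js = hs @ ts" by (simp add: hs_def ts_def)
    have hs: "distinct hs" "length hs = 7" using less.prems(1) False by (simp_all add: hs_def)
    have ts: "distinct ts" "length ts < length js" "set hs \<inter> set ts = {}"
      using less.prems(1) hs(2) unfolding js by auto
    define G where "G ks s = (case s of (u, x) \<Rightarrow> x k \<bullet> wd u (ks @ ts) (x l))" for ks and s :: "(nat \<Rightarrow> octonion) \<times> (nat \<Rightarrow> octonion)"
    have "spanned (set js) {k, l} (\<lambda>u x. G (map p hs) (u, x) - of_int (sign p) * G hs (u, x))"
      if "p permutes set hs" for p
    proof (rule permuted_word_sign[where N = "\<lambda>f. spanned (set js) {k, l} (\<lambda>u x. f (u, x))" and G = G, OF _ _ _ _ hs(1) that])
      fix A a b C assume m: "mset (A @ a # b # C) = mset hs"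
      have "mset (A @ a # b # (C @ ts)) = mset js" unfolding js mset_append[of hs] m[symmetric] by simp
      from swap[OF this less.prems(2)]
      show "spanned (set js) {k, l} (\<lambda>u x. G (A @ a # b # C) (u, x) + G (A @ b # a # C) (u, x))"
        by (simp add: G_def)
    qed (auto intro: spanned.zero spanned_add spanned_scale)
    then have 1: "spanned (set js) {k, l} (\<lambda>u x. \<Sum>p | p permutes set hs.
        of_int (sign p) * (G (map p hs) (u, x) - of_int (sign p) * G hs (u, x)))"
      by (intro spanned_sum spanned_scale) simp
    have "spanned (set hs \<union> set ts) ({} \<union> {k, l}) (\<lambda>u x. det_Im (map u hs) * (x k \<bullet> wd u ts (x l)))"
      by (rule spanned_mult[OF spanned_det less.hyps]) (use hs ts less.prems in auto)
    then have 2: "spanned (set js) {k, l} (\<lambda>u x. det_Im (map u hs) * (x k \<bullet> wd u ts (x l)))"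
      by (simp add: js)
    from spanned_add[OF spanned_scale[OF 1, of "- 1 / fact 7"] spanned_neg[OF 2]]
    show ?thesis
    proof (rule spanned.cong)
      fix u x :: "nat \<Rightarrow> octonion" assume u: "imag u"
      have "(\<Sum>p | p permutes set hs. of_int (sign p) * (G (map p hs) (u, x) - of_int (sign p) * G hs (u, x)))
         = (\<Sum>p | p permutes set hs. of_int (sign p) * (x k \<bullet> wd u (map p hs) (wd u ts (x l))) - G hs (u, x))"
      proof (rule sum.cong[OF refl])
        fix p :: "nat \<Rightarrow> nat"
        have "of_int (sign p) * (of_int (sign p) * G hs (u, x)) = G hs (u, x)"
          by (simp only: mult.assoc[symmetric] of_int_mult[symmetric] sign_idempotent of_int_1 mult_1)
        then show "of_int (sign p) * (G (map p hs) (u, x) - of_int (sign p) * G hs (u, x))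
          = of_int (sign p) * (x k \<bullet> wd u (map p hs) (wd u ts (x l))) - G hs (u, x)"
          by (simp only: right_diff_distrib) (simp add: G_def)
      qed
      also have "\<dots> = - fact 7 * det_Im (map u hs) * (x k \<bullet> wd u ts (x l)) - fact 7 * G hs (u, x)"
        unfolding sum_subtractf alternated_word[OF hs u]
        using card_permutations[of "set hs" 7] hs by (simp add: distinct_card)
      finally show "- 1 / fact 7 * (\<Sum>p | p permutes set hs. of_int (sign p) * (G (map p hs) (u, x) - of_int (sign p) * G hs (u, x)))
          + - (det_Im (map u hs) * (x k \<bullet> wd u ts (x l))) = x k \<bullet> wd u js (x l)"
        by (simp add: G_def js field_simps)
    qed
  qed
qed

lemma spanned_bracket_words:
  assumes "distinct (A @ B)" "k \<noteq> l"
  shows "spanned (set A \<union> set B) {k, l} (\<lambda>u x. wd u A (x k) \<bullet> wd u B (x l))"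
proof -
  have "spanned (set (rev A @ B)) {k, l} (\<lambda>u x. (-1) ^ length A * (x k \<bullet> wd u (rev A @ B) (x l)))"
    by (intro spanned_scale spanned_bracket) (use assms in auto)
  then have "spanned (set A \<union> set B) {k, l} (\<lambda>u x. (-1) ^ length A * (x k \<bullet> wd u (rev A @ B) (x l)))" by simp
  then show ?thesis by (rule spanned.cong) (simp add: wd_inner)
qed

lemma spanned_bracket_mult:
  assumes "distinct (A @ B)" "k \<noteq> l" "spanned J K f" "(set A \<union> set B) \<inter> J = {}" "{k, l} \<inter> K = {}"
    and "J' = set A \<union> set B \<union> J" "K' = {k, l} \<union> K"
  shows "spanned J' K' (\<lambda>u x. (wd u A (x k) \<bullet> wd u B (x l)) * f u x)"
  unfolding assms(6,7) by (rule spanned_mult[OF spanned_bracket_words[OF assms(1,2)] assms(3-5)])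

lemma spanned_two_brackets:
  assumes "distinct (A @ B @ C @ D)" "distinct [k, l, m, n]"
    and "J = set A \<union> set B \<union> set C \<union> set D" "K = {k, l, m, n}"
  shows "spanned J K (\<lambda>u x. (wd u A (x k) \<bullet> wd u B (x l)) * (wd u C (x m) \<bullet> wd u D (x n)))"
  by (rule spanned_bracket_mult[OF _ _ spanned_bracket_words]) (use assms in auto)

definition phi_word where
  "phi_word k l m n A B C D u x = phi (wd u A (x k)) (wd u B (x l)) (wd u C (x m)) (wd u D (x n))"

lemma phi_word_move13:
  assumes "distinct (j # A @ B @ C @ D)" "distinct [k, l, m, n]"
    and J: "J = {j} \<union> set A \<union> set B \<union> set C \<union> set D" and K: "K = {k, l, m, n}"
  shows "spanned J K (\<lambda>u x. phi_word k l m n (j # A) B C D u x - phi_word k l m n A B (j # C) D u x)"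
proof -
  have 1: "spanned J K (\<lambda>u x. (wd u A (x k) \<bullet> wd u C (x m)) * (wd u B (x l) \<bullet> wd u (j # D) (x n)))"
    by (rule spanned_two_brackets) (use assms in auto)
  have 2: "spanned J K (\<lambda>u x. (wd u C (x m) \<bullet> wd u D (x n)) * (wd u A (x k) \<bullet> wd u (j # B) (x l)))"
    by (rule spanned_two_brackets) (use assms in auto)
  have 3: "spanned J K (\<lambda>u x. (wd u A (x k) \<bullet> wd u B (x l)) * (wd u (j # C) (x m) \<bullet> wd u D (x n)))"
    by (rule spanned_two_brackets) (use assms in auto)
  have 4: "spanned J K (\<lambda>u x. (wd u A (x k) \<bullet> wd u (j # D) (x n)) * (wd u B (x l) \<bullet> wd u C (x m)))"
    by (rule spanned_two_brackets) (use assms in auto)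
  have 5: "spanned J K (\<lambda>u x. (wd u A (x k) \<bullet> wd u D (x n)) * (wd u B (x l) \<bullet> wd u (j # C) (x m)))"
    by (rule spanned_two_brackets) (use assms in auto)
  show ?thesis
    by (rule spanned.cong[OF spanned_diff[OF spanned_diff[OF spanned_add[OF spanned_add[OF spanned_scale[OF 1, of 2] 2] 3] 4] 5]])
       (simp add: phi_word_def phi_move[of "_ j"])
qed

lemma phi_word_move12:
  assumes "distinct (j # A @ B @ C @ D)" "distinct [k, l, m, n]"
    and J: "J = {j} \<union> set A \<union> set B \<union> set C \<union> set D" and K: "K = {k, l, m, n}"
  shows "spanned J K (\<lambda>u x. phi_word k l m n (j # A) B C D u x - phi_word k l m n A (j # B) C D u x)"
proof -
  have "spanned J K (\<lambda>u x. phi_word k m l n (j # A) C B D u x - phi_word k m l n A C (j # B) D u x)"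
    by (rule phi_word_move13) (use assms in auto)
  from spanned_neg[OF this] show ?thesis
    by (rule spanned.cong) (simp add: phi_word_def phi_swap23[of _ "wd _ C _"])
qed

lemma phi_word_move14:
  assumes "distinct (j # A @ B @ C @ D)" "distinct [k, l, m, n]"
    and J: "J = {j} \<union> set A \<union> set B \<union> set C \<union> set D" and K: "K = {k, l, m, n}"
  shows "spanned J K (\<lambda>u x. phi_word k l m n (j # A) B C D u x - phi_word k l m n A B C (j # D) u x)"
proof -
  have "spanned J K (\<lambda>u x. phi_word k l n m (j # A) B D C u x - phi_word k l n m A B (j # D) C u x)"
    by (rule phi_word_move13) (use assms in auto)
  from spanned_neg[OF this] show ?thesis
    by (rule spanned.cong) (simp add: phi_word_def phi_swap34[of _ _ _ "wd _ C _"])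
qed

lemma spanned_of_diff: "spanned J K (\<lambda>u x. f u x - g u x) \<Longrightarrow> spanned J K f \<Longrightarrow> spanned J K g"
  using spanned_diff[of J K f "\<lambda>u x. f u x - g u x"] by simp

text \<open>
  With at most one letter in the first argument, the skewness of \<open>phi\<close> and moving the letter allow
  the spinors to be sorted, which leads to one of the two basic functions.
\<close>

lemma phi_word_base:
  assumes L: "L = [] \<or> L = [j]" and "distinct [k, l, m, n]"
  shows "spanned (set L) {k, l, m, n} (phi_word k l m n L [] [] [])"
proof -
  define P where "P ks \<longleftrightarrow> (length ks = 4 \<longrightarrow> distinct ks \<longrightarrow>
     spanned (set L) (set ks) (phi_word (ks!0) (ks!1) (ks!2) (ks!3) L [] [] []))" for ks
  have P4: "P [k, l, m, n] \<longleftrightarrow> (distinct [k, l, m, n] \<longrightarrow> spanned (set L) {k, l, m, n} (phi_word k l m n L [] [] []))" for k l m n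
    by (simp add: P_def numeral_eq_Suc)
  define X where "X = {k, l, m, n}"
  define ss where "ss = sorted_list_of_set X"
  have ss: "mset ss = mset [k, l, m, n]" "sorted_wrt (<) ss" "length ss = 4"
  proof -
    have "finite X" by (simp add: X_def)
    then have "distinct ss" "set ss = X" by (simp_all add: ss_def)
    then show m: "mset ss = mset [k, l, m, n]" using assms(2)
      by (subst set_eq_iff_mset_eq_distinct[symmetric]) (simp_all add: X_def)
    from arg_cong[OF m, of size] show "length ss = 4" by simp
    show "sorted_wrt (<) ss" by (simp add: ss_def strict_sorted_list_of_set)
  qed
  have "P ss"
  proof -
    obtain a b c d where abcd: "ss = [a, b, c, d]"
      using ss(3) by (auto simp: numeral_eq_Suc length_Suc_conv)
    have lt: "a < b" "b < c" "c < d" using ss(2) by (simp_all add: abcd)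
    show ?thesis unfolding abcd P4
    proof
      show "spanned (set L) {a, b, c, d} (phi_word a b c d L [] [] [])"
        using L
      proof
        assume "L = []"
        then show ?thesis
          using spanned_neg[OF spanned_generator[OF generator.Cayley[OF lt]]] by (simp add: phi_word_def[abs_def] Cayley_form_phi)
      next
        assume "L = [j]"
        then show ?thesis
          using spanned_neg[OF spanned_generator[OF generator.Cayley_u[OF lt, of j]]] by (simp add: phi_word_def[abs_def] Cayley_form_phi)
      qed
    qed
  qed
  have "P ([] @ [k, l, m, n])"
  proof (rule adjacent_swaps[of P ss])
    fix A and a b :: nat and C assume P: "P (A @ a # b # C)"
    show "P (A @ b # a # C)"
    proof (cases "length (A @ a # b # C) = 4")
      case False
      then show ?thesis by (simp add: P_def)
    next
      case True
      then consider c d where "A = []" "C = [c, d]" | c d where "A = [c]" "C = [d]" | c d where "A = [c, d]" "C = []"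
        by (cases A rule: list.exhaust; cases "tl A"; auto simp: numeral_eq_Suc length_Suc_conv)
      then show ?thesis
      proof cases
        case 1
        show ?thesis unfolding 1 append_Nil P4
        proof
          assume d: "distinct [b, a, c, d]"
          then have p: "spanned (set L) {b, a, c, d} (phi_word a b c d L [] [] [])" using P 1 by (simp add: P4 insert_commute)
          show "spanned (set L) {b, a, c, d} (phi_word b a c d L [] [] [])"
            using L
          proof
            assume "L = []"
            then show ?thesis using spanned_neg[OF p] by (simp add: phi_word_def[abs_def] phi_swap12[of "_ a" "_ b"])
          next
            assume Lj: "L = [j]"
            have "spanned (set [j]) {b, a, c, d} (\<lambda>u x. phi_word a b c d [j] [] [] [] u x - phi_word a b c d [] [j] [] [] u x)"
              by (rule phi_word_move12) (use d in auto)
            from spanned_neg[OF spanned_of_diff[OF this p[unfolded Lj]]]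
            show ?thesis unfolding Lj by (simp add: phi_word_def[abs_def] phi_swap12[of "_ \<odot> _ b"])
          qed
        qed
      next
        case 2
        show ?thesis using P unfolding 2 append_Cons append_Nil P4
          using spanned_neg[of "set L" "{c, a, b, d}" "phi_word c a b d L [] [] []"]
          by (auto simp: insert_commute phi_word_def[abs_def] phi_swap23[of _ "_ a" "_ b"])
      next
        case 3
        show ?thesis using P unfolding 3 append_Cons append_Nil P4
          using spanned_neg[of "set L" "{c, d, a, b}" "phi_word c d a b L [] [] []"]
          by (auto simp: insert_commute phi_word_def[abs_def] phi_swap34[of _ _ "_ a" "_ b"])
      qed
    qed
  qed (use ss \<open>P ss\<close> in simp_all)
  then show ?thesis using assms(2) by (simp add: P4)
qed

text \<open>
  With two letters \<open>i\<close>, \<open>j\<close> in the first argument, moving both into different arguments and back in the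
  other order shows that the words \<open>i j\<close> and \<open>j i\<close> give the same function modulo products.  By the Clifford
  relations they give opposite functions modulo shorter words, so both lie in the span.
\<close>

lemma phi_word_one_slot:
  assumes "distinct A" "distinct [k, l, m, n]"
  shows "spanned (set A) {k, l, m, n} (phi_word k l m n A [] [] [])"
  using assms
proof (induction "length A" arbitrary: A rule: less_induct)
  case less
  consider "A = []" | j where "A = [j]" | i j B where "A = i # j # B"
    by (cases A; cases "tl A"; auto)
  then show ?case
  proof cases
    case 1
    then show ?thesis using phi_word_base[of "[]" undefined] less.prems by simp
  next
    case (2 j)
    then show ?thesis using phi_word_base[of "[j]" j] less.prems by simp
  next
    case (3 i j B)
    let ?F = "phi_word k l m n"
    let ?K = "{k, l, m, n}"
    have a: "spanned (set A) ?K (\<lambda>u x. ?F (i # j # B) [] [] [] u x - ?F (j # B) [i] [] [] u x)"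
      by (rule phi_word_move12) (use 3 less.prems in auto)
    have b: "spanned (set A) ?K (\<lambda>u x. ?F (j # B) [i] [] [] u x - ?F B [i] [j] [] u x)"
      by (rule phi_word_move13) (use 3 less.prems in auto)
    have c: "spanned (set A) ?K (\<lambda>u x. ?F (i # B) [] [j] [] u x - ?F B [i] [j] [] u x)"
      by (rule phi_word_move12) (use 3 less.prems in auto)
    have d: "spanned (set A) ?K (\<lambda>u x. ?F (j # i # B) [] [] [] u x - ?F (i # B) [] [j] [] u x)"
      by (rule phi_word_move13) (use 3 less.prems in auto)
    have "spanned (set B) ?K (?F B [] [] [])" by (rule less.hyps) (use 3 less.prems in auto)
    from spanned_mult[OF spanned_inner_u this, of i j]
    have "spanned (set A) ?K (\<lambda>u x. (u i \<bullet> u j) * ?F B [] [] [] u x)"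
      using 3 less.prems by simp
    from spanned_scale[OF spanned_add[OF spanned_diff[OF spanned_add[OF a b] spanned_add[OF c d]] spanned_scale[OF this, of "-2"]], of "1/2"]
    show ?thesis
    proof (rule spanned.cong)
      fix u x :: "nat \<Rightarrow> octonion" assume u: "imag u"
      have "?F (i # j # B) [] [] [] u x = - ?F (j # i # B) [] [] [] u x - 2 * (u i \<bullet> u j) * ?F B [] [] [] u x"
        using wd_swap[OF u, of "[]" i j B]
        by (simp add: phi_word_def linear_diff[OF phi_linear(1)] linear_neg[OF phi_linear(1)] linear_scale[OF phi_linear(1)])
      then show "1 / 2 * (?F (i # j # B) [] [] [] u x - ?F (j # B) [i] [] [] u x
           + (?F (j # B) [i] [] [] u x - ?F B [i] [j] [] u x)
           - (?F (i # B) [] [j] [] u x - ?F B [i] [j] [] u x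
              + (?F (j # i # B) [] [] [] u x - ?F (i # B) [] [j] [] u x))
           + - 2 * ((u i \<bullet> u j) * ?F B [] [] [] u x)) = ?F A [] [] [] u x"
        unfolding 3 by simp
    qed
  qed
qed

lemma phi_word_spanned:
  assumes "distinct (A @ B @ C @ D)" "distinct [k, l, m, n]"
    and "J = set A \<union> set B \<union> set C \<union> set D" "K = {k, l, m, n}"
  shows "spanned J K (phi_word k l m n A B C D)"
proof -
  note k = assms(2)
  have 1: "spanned (set A \<union> set B) {k, l, m, n} (phi_word k l m n A B [] [])" if "distinct (A @ B)" for A B
    using that
  proof (induction B arbitrary: A)
    case Nil
    then show ?case using phi_word_one_slot[OF _ k] by simp
  next
    case (Cons j B)
    have "spanned (set A \<union> set (j # B)) {k, l, m, n} (phi_word k l m n (j # A) B [] [])"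
      using Cons.IH[of "j # A"] Cons.prems by simp
    moreover have "spanned (set A \<union> set (j # B)) {k, l, m, n} (\<lambda>u x. phi_word k l m n (j # A) B [] [] u x - phi_word k l m n A (j # B) [] [] u x)"
      by (rule phi_word_move12) (use k Cons.prems in auto)
    ultimately show ?case by (metis (no_types) spanned_of_diff)
  qed
  have 2: "spanned (set A \<union> set B \<union> set C) {k, l, m, n} (phi_word k l m n A B C [])" if "distinct (A @ B @ C)" for A B C
    using that
  proof (induction C arbitrary: A)
    case Nil
    then show ?case using 1 by simp
  next
    case (Cons j C)
    have "spanned (set A \<union> set B \<union> set (j # C)) {k, l, m, n} (phi_word k l m n (j # A) B C [])"
      using Cons.IH[of "j # A"] Cons.prems by simp
    moreover have "spanned (set A \<union> set B \<union> set (j # C)) {k, l, m, n} (\<lambda>u x. phi_word k l m n (j # A) B C [] u x - phi_word k l m n A B (j # C) [] u x)"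
      by (rule phi_word_move13) (use k Cons.prems in auto)
    ultimately show ?case by (metis (no_types) spanned_of_diff)
  qed
  have "spanned (set A \<union> set B \<union> set C \<union> set D) {k, l, m, n} (phi_word k l m n A B C D)"
    using assms(1)
  proof (induction D arbitrary: A)
    case Nil
    then show ?case using 2 by simp
  next
    case (Cons j D)
    have "spanned (set A \<union> set B \<union> set C \<union> set (j # D)) {k, l, m, n} (phi_word k l m n (j # A) B C D)"
      using Cons.IH[of "j # A"] Cons.prems by simp
    moreover have "spanned (set A \<union> set B \<union> set C \<union> set (j # D)) {k, l, m, n} (\<lambda>u x. phi_word k l m n (j # A) B C D u x - phi_word k l m n A B C (j # D) u x)"
      by (rule phi_word_move14) (use k Cons.prems in auto)
    ultimately show ?case by (metis (no_types) spanned_of_diff)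
  qed
  then show ?thesis using assms(3,4) by simp
qed

lemma spanned_phi_words:
  assumes "distinct (A @ B @ C @ D)" "distinct [k, l, m, n]"
    and "J = set A \<union> set B \<union> set C \<union> set D" "K = {k, l, m, n}"
  shows "spanned J K (\<lambda>u x. phi (wd u A (x k)) (wd u B (x l)) (wd u C (x m)) (wd u D (x n)))"
  using phi_word_spanned[OF assms] unfolding phi_word_def[abs_def] .

section \<open>Half turns and invariant functions\<close>

text \<open>
  The vector representation of \<open>L\<^sub>w\<close> (\<open>vector_rep_unit\<close>): the rotation by \<open>\<pi>\<close> about the axis \<open>w\<close>.
\<close>

definition half_turn :: "octonion \<Rightarrow> octonion \<Rightarrow> octonion" where
  "half_turn w u = (2 * (u \<bullet> w)) *\<^sub>R w - u"

definition unit_im :: "octonion \<Rightarrow> bool" where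
  "unit_im w \<longleftrightarrow> w \<in> Im_oct \<and> w \<bullet> w = 1"

lemma Im_comb: "p \<in> Im_oct \<Longrightarrow> q \<in> Im_oct \<Longrightarrow> c *\<^sub>R p + d *\<^sub>R q \<in> Im_oct"
  by (simp add: Im_oct_iff)

lemma half_turn_Im: "unit_im w \<Longrightarrow> u \<in> Im_oct \<Longrightarrow> half_turn w u \<in> Im_oct"
  by (simp add: half_turn_def unit_im_def Im_oct_iff)

text \<open>
  The intertwining relation \<open>L\<^bsub>\<chi>u\<^esub> L\<^sub>w = L\<^sub>w L\<^sub>u\<close>, from which the invariance of all basic functions
  that involve spinors follows.
\<close>

lemma half_turn_mult:
  assumes "unit_im w" "u \<in> Im_oct" shows "half_turn w u \<odot> (w \<odot> y) = w \<odot> (u \<odot> y)"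
proof -
  have w: "w \<in> Im_oct" "w \<bullet> w = 1" using assms(1) by (simp_all add: unit_im_def)
  have "half_turn w u \<odot> (w \<odot> y) = (2 * (u \<bullet> w)) *\<^sub>R (w \<odot> (w \<odot> y)) - u \<odot> (w \<odot> y)"
    by (simp add: half_turn_def oct_mult_diff_left oct_mult_scale_left)
  also have "\<dots> = w \<odot> (u \<odot> y)"
    unfolding Clifford_square[OF w(1)] Clifford[OF assms(2) w(1)] w(2) by simp
  finally show ?thesis .
qed

lemma half_turn_inner: "unit_im w \<Longrightarrow> half_turn w u \<bullet> half_turn w v = u \<bullet> v"
  by (simp add: half_turn_def unit_im_def inner_diff_left inner_diff_right inner_commute algebra_simps)

lemma half_turn_involution: "unit_im w \<Longrightarrow> half_turn w (half_turn w u) = u"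
  by (simp add: half_turn_def unit_im_def inner_diff_left algebra_simps flip: scaleR_add_left)

lemma unit_mult_inner:
  assumes "unit_im w" shows "(w \<odot> x) \<bullet> (w \<odot> y) = x \<bullet> y"
proof -
  have w: "w \<in> Im_oct" "w \<bullet> w = 1" using assms(1) by (simp_all add: unit_im_def)
  have "x \<bullet> (w \<odot> (w \<odot> y)) = - ((w \<odot> x) \<bullet> (w \<odot> y))" by (rule inner_oct_mult_skew[OF w(1)])
  then show ?thesis unfolding Clifford_square[OF w(1)] w(2) by simp
qed

lemma wd_half_turn:
  assumes "unit_im w" "imag u"
  shows "wd (\<lambda>j. half_turn w (u j)) js (w \<odot> y) = w \<odot> wd u js y"
  by (induction js) (simp_all add: half_turn_mult assms)

lemma phi_unit:
  assumes "unit_im w" shows "phi (w \<odot> x) (w \<odot> y) (w \<odot> z) (w \<odot> v) = phi x y z v"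
proof -
  have w: "w \<in> Im_oct" "w \<bullet> w = 1" using assms(1) by (simp_all add: unit_im_def)
  have e: "(w \<odot> x) \<bullet> (oct_e a \<odot> (w \<odot> z)) = - (x \<bullet> (oct_e a \<odot> z)) + 2 * (w $ a * (x \<bullet> (w \<odot> z)))"
    if a: "a \<in> I7" for a x z
  proof -
    have "(w \<odot> x) \<bullet> (oct_e a \<odot> (w \<odot> z)) = - ((w \<odot> x) \<bullet> (w \<odot> (oct_e a \<odot> z))) - 2 * (w $ a * ((w \<odot> x) \<bullet> z))"
      unfolding Clifford[OF oct_e_Im[OF a] w(1)] by (simp add: inner_diff_right)
    then show ?thesis unfolding unit_mult_inner[OF assms] using inner_oct_mult_skew[OF w(1), of x z] by simp
  qed
  have n: "(\<Sum>a\<in>I7. w $ a * w $ a) = 1" using Im_inner[OF w(1), of w] w(2) by simp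
  define s where "s = x \<bullet> (w \<odot> z)"
  define t where "t = y \<bullet> (w \<odot> v)"
  have "(\<Sum>a\<in>I7. ((w \<odot> x) \<bullet> (oct_e a \<odot> (w \<odot> z))) * ((w \<odot> y) \<bullet> (oct_e a \<odot> (w \<odot> v))))
    = (\<Sum>a\<in>I7. (x \<bullet> (oct_e a \<odot> z)) * (y \<bullet> (oct_e a \<odot> v)) - 2 * t * (w $ a * (x \<bullet> (oct_e a \<odot> z)))
        - 2 * s * (w $ a * (y \<bullet> (oct_e a \<odot> v))) + 4 * s * t * (w $ a * w $ a))"
    by (rule sum.cong[OF refl]) (simp add: e s_def t_def algebra_simps)
  also have "\<dots> = (\<Sum>a\<in>I7. (x \<bullet> (oct_e a \<odot> z)) * (y \<bullet> (oct_e a \<odot> v)))"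
    unfolding sum.distrib sum_subtractf sum_distrib_left[symmetric] sum_I7_inner[OF w(1)] n
    by (simp add: s_def t_def)
  finally show ?thesis unfolding phi_def unit_mult_inner[OF assms] by simp
qed

text \<open>
  Invariance under the generators of the group suffices for all arguments below.
\<close>

definition half_turn_invariant :: "tuple_fun \<Rightarrow> bool" where
  "half_turn_invariant f \<longleftrightarrow> (\<forall>w u x. unit_im w \<longrightarrow> imag u \<longrightarrow> f (\<lambda>j. half_turn w (u j)) (\<lambda>k. w \<odot> x k) = f u x)"

text \<open>
  Seen through the alternated word, the determinant is an operator that commutes with the group.
\<close>

lemma det_Im_half_turn:
  assumes js: "distinct js" "length js = 7" and w: "unit_im w" and u: "imag u"
  shows "det_Im (map (\<lambda>j. half_turn w (u j)) js) = det_Im (map u js)"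
proof -
  let ?e = "oct_e 0"
  have r: "imag (\<lambda>j. half_turn w (u j))" using half_turn_Im[OF w] u by (simp add: imag_def)
  have "(\<Sum>p | p permutes set js. of_int (sign p) * ((w \<odot> ?e) \<bullet> wd (\<lambda>j. half_turn w (u j)) (map p js) (w \<odot> ?e)))
     = (\<Sum>p | p permutes set js. of_int (sign p) * (?e \<bullet> wd u (map p js) ?e))"
    by (simp only: wd_half_turn[OF w u] unit_mult_inner[OF w])
  then show ?thesis
    unfolding alternated_word[OF js r] alternated_word[OF js u] unit_mult_inner[OF w] by (simp add: oct_e_coords)
qed

lemma generator_half_turn_invariant: "generator J K f \<Longrightarrow> half_turn_invariant f"
proof (induction rule: generator.induct)
  case (inner_u j1 j2)
  then show ?case by (simp add: half_turn_invariant_def half_turn_inner)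
next
  case (det_u js)
  then have "distinct js" by (simp add: strict_sorted_iff)
  then show ?case using det_u by (simp add: half_turn_invariant_def det_Im_half_turn)
next
  case (inner_x js k1 k2)
  show ?case unfolding half_turn_invariant_def wd_def[symmetric] by (simp add: wd_half_turn unit_mult_inner)
next
  case (Cayley k1 k2 k3 k4)
  show ?case by (simp add: half_turn_invariant_def Cayley_form_phi phi_unit)
next
  case (Cayley_u k1 k2 k3 k4 j)
  show ?case by (simp add: half_turn_invariant_def Cayley_form_phi phi_unit half_turn_mult)
qed

lemma gen_product_half_turn_invariant: "gen_product J K p \<Longrightarrow> half_turn_invariant p"
proof (induction rule: gen_product.induct)
  case empty
  then show ?case by (simp add: half_turn_invariant_def)
next
  case (times J K f J' K' p)
  from generator_half_turn_invariant[OF times.hyps(1)] times.IH show ?case by (simp add: half_turn_invariant_def)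
qed

definition depends_on :: "nat set \<Rightarrow> nat set \<Rightarrow> tuple_fun \<Rightarrow> bool" where
  "depends_on J K f \<longleftrightarrow> (\<forall>u u' x x'. (\<forall>j\<in>J. u j = u' j) \<longrightarrow> (\<forall>k\<in>K. x k = x' k) \<longrightarrow> f u x = f u' x')"

lemma depends_onD: "depends_on J K f \<Longrightarrow> (\<And>j. j \<in> J \<Longrightarrow> u j = u' j) \<Longrightarrow> (\<And>k. k \<in> K \<Longrightarrow> x k = x' k) \<Longrightarrow> f u x = f u' x'"
  unfolding depends_on_def by blast

definition mlinear :: "nat set \<Rightarrow> nat set \<Rightarrow> tuple_fun \<Rightarrow> bool" where
  "mlinear J K f \<longleftrightarrow> (\<forall>j\<in>J. \<forall>u x. linear (\<lambda>v. f (u(j := v)) x)) \<and> (\<forall>k\<in>K. \<forall>u x. linear (\<lambda>y. f u (x(k := y))))"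

lemma generator_mlinear: "generator J K f \<Longrightarrow> depends_on J K f \<and> mlinear J K f"
proof (induction rule: generator.induct)
  case (inner_u j1 j2)
  then have "j1 \<noteq> j2" by simp
  then show ?case
    by (auto simp: depends_on_def mlinear_def intro!: linearI simp: inner_add_left inner_add_right)
next
  case (det_u js)
  then have d: "distinct js" by (simp add: strict_sorted_iff)
  show ?case
  proof
    show "depends_on (set js) {} (\<lambda>u x. det_Im (map u js))"
      unfolding depends_on_def by (intro allI impI arg_cong[of _ _ det_Im] map_cong refl) simp
    show "mlinear (set js) {} (\<lambda>u x. det_Im (map u js))"
      unfolding mlinear_def by (intro conjI ballI allI det_Im_map_linear d det_u(2)) auto
  qed
next
  case (inner_x js k1 k2)
  then have d: "distinct js" "k1 \<noteq> k2" by (simp_all add: strict_sorted_iff)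
  have l: "linear (\<lambda>v. x k1 \<bullet> wd (u(j := v)) js (x k2))" if "j \<in> set js" for u x j
  proof -
    note l0 = wd_linear_at[OF that d(1), of u "x k2"]
    show ?thesis
      by (intro linearI) (simp_all only: linear_add[OF l0] linear_scale[OF l0] inner_add_right inner_scaleR_right real_scaleR_def)
  qed
  have l1: "linear (\<lambda>y. y \<bullet> wd u js z)" for u z by (intro linearI) (simp_all add: inner_add_left)
  have l2: "linear (\<lambda>y. z \<bullet> wd u js y)" for u z
    by (intro linearI) (simp_all add: linear_add[OF wd_linear] linear_scale[OF wd_linear] inner_add_right)
  show ?case unfolding wd_def[symmetric]
  proof
    show "depends_on (set js) {k1, k2} (\<lambda>u x. x k1 \<bullet> wd u js (x k2))"
      unfolding depends_on_def
    proof (intro allI impI)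
      fix u u' x x' :: "nat \<Rightarrow> octonion" assume "\<forall>j\<in>set js. u j = u' j" "\<forall>k\<in>{k1, k2}. x k = x' k"
      then show "x k1 \<bullet> wd u js (x k2) = x' k1 \<bullet> wd u' js (x' k2)" using wd_cong[of js u u'] by simp
    qed
    show "mlinear (set js) {k1, k2} (\<lambda>u x. x k1 \<bullet> wd u js (x k2))"
      unfolding mlinear_def
    proof (intro conjI ballI allI)
      fix k and u x :: "nat \<Rightarrow> octonion" assume "k \<in> {k1, k2}"
      then consider "k = k1" | "k = k2" by blast
      then show "linear (\<lambda>y. (x(k := y)) k1 \<bullet> wd u js ((x(k := y)) k2))"
        by cases (use d(2) l1 l2 in simp_all)
    qed (rule l)
  qed
next
  case (Cayley k1 k2 k3 k4)
  then have "k1 \<noteq> k2" "k1 \<noteq> k3" "k1 \<noteq> k4" "k2 \<noteq> k3" "k2 \<noteq> k4" "k3 \<noteq> k4" by simp_all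
  then show ?case unfolding Cayley_form_phi depends_on_def mlinear_def
    using linear_compose_neg[OF phi_linear(1)] linear_compose_neg[OF phi_linear(2)]
      linear_compose_neg[OF phi_linear(3)] linear_compose_neg[OF phi_linear(4)] by auto
next
  case (Cayley_u k1 k2 k3 k4 j)
  then have d: "k1 \<noteq> k2" "k1 \<noteq> k3" "k1 \<noteq> k4" "k2 \<noteq> k3" "k2 \<noteq> k4" "k3 \<noteq> k4" by simp_all
  have 1: "linear (\<lambda>v. - phi (v \<odot> x) y z w)" for x y z w
    by (intro linearI) (simp_all add: oct_mult_add_left oct_mult_scale_left linear_add[OF phi_linear(1)] linear_scale[OF phi_linear(1)])
  have 2: "linear (\<lambda>x. - phi (v \<odot> x) y z w)" for v y z w
    by (intro linearI) (simp_all add: oct_mult_add_right oct_mult_scale_right linear_add[OF phi_linear(1)] linear_scale[OF phi_linear(1)])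
  show ?case unfolding Cayley_form_phi depends_on_def mlinear_def
    using d 1 2 linear_compose_neg[OF phi_linear(2)]
      linear_compose_neg[OF phi_linear(3)] linear_compose_neg[OF phi_linear(4)] by auto
qed

lemma mlinear_mult:
  assumes f: "depends_on J K f" "mlinear J K f" and p: "depends_on J' K' p" "mlinear J' K' p"
    and d: "J \<inter> J' = {}" "K \<inter> K' = {}"
  shows "depends_on (J \<union> J') (K \<union> K') (\<lambda>u x. f u x * p u x) \<and> mlinear (J \<union> J') (K \<union> K') (\<lambda>u x. f u x * p u x)"
proof
  show "depends_on (J \<union> J') (K \<union> K') (\<lambda>u x. f u x * p u x)"
    unfolding depends_on_def
  proof (intro allI impI)
    fix u u' x x' :: "nat \<Rightarrow> octonion" assume "\<forall>j\<in>J \<union> J'. u j = u' j" "\<forall>k\<in>K \<union> K'. x k = x' k"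
    then show "f u x * p u x = f u' x' * p u' x'"
      using depends_onD[OF f(1), of u u' x x'] depends_onD[OF p(1), of u u' x x'] by simp
  qed
  have fu: "f (u(j := v)) x = f u x" if "j \<notin> J" for u j v x by (rule depends_onD[OF f(1)]) (use that in auto)
  have pu: "p (u(j := v)) x = p u x" if "j \<notin> J'" for u j v x by (rule depends_onD[OF p(1)]) (use that in auto)
  have fx: "f u (x(k := v)) = f u x" if "k \<notin> K" for u k v x by (rule depends_onD[OF f(1)]) (use that in auto)
  have px: "p u (x(k := v)) = p u x" if "k \<notin> K'" for u k v x by (rule depends_onD[OF p(1)]) (use that in auto)
  have m: "linear g \<Longrightarrow> linear (\<lambda>v. g v * c)" "linear g \<Longrightarrow> linear (\<lambda>v. c * g v)" for g :: "octonion \<Rightarrow> real" and c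
    by (auto intro!: linearI simp: linear_add linear_scale algebra_simps)
  have "linear (\<lambda>v. f (u(j := v)) x * p (u(j := v)) x)" if "j \<in> J \<union> J'" for u j x
  proof (cases "j \<in> J")
    case True
    then have "linear (\<lambda>v. f (u(j := v)) x)" "j \<notin> J'" using f(2) d(1) unfolding mlinear_def by blast+
    then show ?thesis using m(1) by (simp add: pu)
  next
    case False
    then have "linear (\<lambda>v. p (u(j := v)) x)" using that p(2) unfolding mlinear_def by blast
    then show ?thesis using m(2) False by (simp add: fu)
  qed
  moreover have "linear (\<lambda>y. f u (x(k := y)) * p u (x(k := y)))" if "k \<in> K \<union> K'" for u k x
  proof (cases "k \<in> K")
    case True
    then have "linear (\<lambda>v. f u (x(k := v)))" "k \<notin> K'" using f(2) d(2) unfolding mlinear_def by blast+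
    then show ?thesis using m(1) by (simp add: px)
  next
    case False
    then have "linear (\<lambda>v. p u (x(k := v)))" using that p(2) unfolding mlinear_def by blast
    then show ?thesis using m(2) False by (simp add: fx)
  qed
  ultimately show "mlinear (J \<union> J') (K \<union> K') (\<lambda>u x. f u x * p u x)" unfolding mlinear_def by blast
qed

lemma gen_product_mlinear: "gen_product J K p \<Longrightarrow> depends_on J K p \<and> mlinear J K p"
proof (induction rule: gen_product.induct)
  case empty
  then show ?case by (simp add: depends_on_def mlinear_def)
next
  case (times J K f J' K' p)
  show ?case
    by (rule mlinear_mult) (use generator_mlinear[OF times.hyps(1)] times in auto)
qed

lemma finite_generator: "generator J K f \<Longrightarrow> finite J \<and> finite K"
  by (induction rule: generator.induct) auto

lemma finite_gen_product: "gen_product J K p \<Longrightarrow> finite J \<and> finite K"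
  by (induction rule: gen_product.induct) (auto dest: finite_generator)

text \<open>
  The working form of the invariant space: arbitrary finite index sets in place of initial segments,
  so that variables can be removed and fresh ones added, and total functions that ignore
  all other variables.
\<close>

definition invar :: "nat set \<Rightarrow> nat set \<Rightarrow> tuple_fun \<Rightarrow> bool" where
  "invar J K f \<longleftrightarrow> finite J \<and> finite K \<and> depends_on J K f \<and> (\<forall>j\<in>J. \<forall>x. lin_at j (\<lambda>u. f u x))
     \<and> (\<forall>k\<in>K. \<forall>u x. imag u \<longrightarrow> linear (\<lambda>y. f u (x(k := y)))) \<and> half_turn_invariant f"

lemma invarD:
  assumes "invar J K f"
  shows "finite J" "finite K" "depends_on J K f" "j \<in> J \<Longrightarrow> lin_at j (\<lambda>u. f u x)"
    "k \<in> K \<Longrightarrow> imag u \<Longrightarrow> linear (\<lambda>y. f u (x(k := y)))" "half_turn_invariant f"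
  using assms unfolding invar_def by blast+

lemma invar_gen_product: "gen_product J K p \<Longrightarrow> invar J K p"
  using finite_gen_product gen_product_mlinear gen_product_half_turn_invariant
  unfolding invar_def mlinear_def by (auto intro!: lin_atI)

lemma invar_add:
  assumes f: "invar J K f" and g: "invar J K g" shows "invar J K (\<lambda>u x. f u x + g u x)"
  unfolding invar_def
proof (intro conjI ballI allI impI)
  show "finite J" "finite K" using invarD(1,2)[OF f] .
  show "depends_on J K (\<lambda>u x. f u x + g u x)" unfolding depends_on_def
    by (intro allI impI arg_cong2[where f = "(+)"] depends_onD[OF invarD(3)[OF f]] depends_onD[OF invarD(3)[OF g]]) auto
  show "half_turn_invariant (\<lambda>u x. f u x + g u x)" using invarD(6)[OF f] invarD(6)[OF g] unfolding half_turn_invariant_def by simp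
  show "lin_at j (\<lambda>u. f u x + g u x)" if "j \<in> J" for j x
    by (intro lin_at_add invarD(4)[OF f that] invarD(4)[OF g that])
  show "linear (\<lambda>y. f u (x(k := y)) + g u (x(k := y)))" if "k \<in> K" "imag u" for k u x
    by (intro linear_compose_add invarD(5)[OF f that] invarD(5)[OF g that])
qed

lemma invar_scale:
  assumes f: "invar J K f" shows "invar J K (\<lambda>u x. c * f u x)"
  unfolding invar_def
proof (intro conjI ballI allI impI)
  show "finite J" "finite K" using invarD(1,2)[OF f] .
  show "depends_on J K (\<lambda>u x. c * f u x)" unfolding depends_on_def
    by (intro allI impI arg_cong[where f = "(*) c"] depends_onD[OF invarD(3)[OF f]]) auto
  show "half_turn_invariant (\<lambda>u x. c * f u x)" using invarD(6)[OF f] unfolding half_turn_invariant_def by simp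
  show "lin_at j (\<lambda>u. c * f u x)" if "j \<in> J" for j x
    by (intro lin_at_scale invarD(4)[OF f that])
  show "linear (\<lambda>y. c * f u (x(k := y)))" if "k \<in> K" "imag u" for k u x
    using linear_compose_scale_right[OF invarD(5)[OF f that], of c] by simp
qed

lemma invar_zero: "finite J \<Longrightarrow> finite K \<Longrightarrow> invar J K (\<lambda>u x. 0)"
  by (auto simp: invar_def depends_on_def lin_at_zero half_turn_invariant_def intro!: linearI)

lemma invar_sum:
  assumes "finite J" "finite K"
  shows "(\<And>i. i \<in> A \<Longrightarrow> invar J K (f i)) \<Longrightarrow> invar J K (\<lambda>u x. \<Sum>i\<in>A. f i u x)"
  by (induction A rule: infinite_finite_induct) (simp_all add: invar_zero assms invar_add)

lemma transpose_upd:
  "(u(l := v)) \<circ> Transposition.transpose i j = (u \<circ> Transposition.transpose i j)(Transposition.transpose i j l := v)"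
  by (auto simp: fun_eq_iff Transposition.transpose_def)

lemma invar_transpose:
  assumes "invar J K f" "i \<in> J" "j \<in> J"
  shows "invar J K (\<lambda>u x. f (u \<circ> Transposition.transpose i j) x)"
  unfolding invar_def
proof (intro conjI ballI allI impI)
  let ?t = "Transposition.transpose i j"
  have t: "?t l \<in> J" if "l \<in> J" for l using assms that by (simp add: Transposition.transpose_def)
  show "finite J" "finite K" using invarD(1,2)[OF assms(1)] .
  show "depends_on J K (\<lambda>u x. f (u \<circ> ?t) x)" unfolding depends_on_def
    by (intro allI impI depends_onD[OF invarD(3)[OF assms(1)]]) (use t in auto)
  show "lin_at l (\<lambda>u. f (u \<circ> ?t) x)" if "l \<in> J" for l x
    using invarD(4)[OF assms(1) t[OF that], of x] unfolding lin_at_def transpose_upd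
    using imag_comp by blast
  show "linear (\<lambda>y. f (u \<circ> ?t) (x(k := y)))" if "k \<in> K" "imag u" for k u x
    by (rule invarD(5)[OF assms(1)]) (use that in auto)
  show "half_turn_invariant (\<lambda>u x. f (u \<circ> ?t) x)"
    unfolding half_turn_invariant_def
  proof (intro allI impI)
    fix w u x assume "unit_im w" "imag u"
    then show "f ((\<lambda>j. half_turn w (u j)) \<circ> ?t) (\<lambda>k. w \<odot> x k) = f (u \<circ> ?t) x"
      using invarD(6)[OF assms(1)] imag_comp[of u ?t] unfolding half_turn_invariant_def by (simp add: comp_def)
  qed
qed

lemma lin_at_comb:
  assumes "lin_at j g" "imag u" "p \<in> Im_oct" "q \<in> Im_oct"
  shows "g (u(j := c *\<^sub>R p + d *\<^sub>R q)) = c * g (u(j := p)) + d * g (u(j := q))"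
  unfolding lin_atD[OF assms(1,2) Im_comb[OF assms(3,4)]] lin_atD[OF assms(1,2,3)] lin_atD[OF assms(1,2,4)]
  by (simp add: distrib_right sum.distrib sum_distrib_left mult.assoc)

text \<open>
  The tensor \<open>\<Sum>\<^sub>a e\<^sub>a \<otimes> e\<^sub>a\<close> is invariant under isometries.
\<close>

lemma contraction_half_turn:
  assumes "lin_at k g" "lin_at i g" "k \<noteq> i" "imag u" and w: "unit_im w"
  shows "(\<Sum>a\<in>I7. g (u(k := half_turn w (oct_e a), i := half_turn w (oct_e a)))) = (\<Sum>a\<in>I7. g (u(k := oct_e a, i := oct_e a)))"
proof -
  have wi: "w \<in> Im_oct" "w \<bullet> w = 1" using w by (simp_all add: unit_im_def)
  define F where "F p q = g (u(k := p, i := q))" for p q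
  have left: "F (c *\<^sub>R p + d *\<^sub>R p') q = c * F p q + d * F p' q" if "p \<in> Im_oct" "p' \<in> Im_oct" "q \<in> Im_oct" for p p' q c d
    unfolding F_def fun_upd_twist[OF assms(3), of u] by (rule lin_at_comb) (use assms that in \<open>auto simp: imag_def\<close>)
  have right: "F p (c *\<^sub>R q + d *\<^sub>R q') = c * F p q + d * F p q'" if "p \<in> Im_oct" "q \<in> Im_oct" "q' \<in> Im_oct" for p q q' c d
    unfolding F_def by (rule lin_at_comb) (use assms that in \<open>auto simp: imag_def\<close>)
  have r: "half_turn w (oct_e a) = (2 * w $ a) *\<^sub>R w + (-1) *\<^sub>R oct_e a" for a
    by (simp add: half_turn_def)
  have W1: "(\<Sum>a\<in>I7. w $ a * F (oct_e a) w) = F w w"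
    using lin_atD[OF assms(1) imag_upd[OF assms(4) wi(1), of i] wi(1)]
    unfolding F_def fun_upd_twist[OF assms(3), of u] by simp
  have W2: "(\<Sum>a\<in>I7. w $ a * F w (oct_e a)) = F w w"
    using lin_atD[OF assms(2) imag_upd[OF assms(4) wi(1), of k] wi(1)] unfolding F_def by simp
  have n: "(\<Sum>a\<in>I7. w $ a * w $ a) = 1" using Im_inner[OF wi(1), of w] wi(2) by simp
  have "(\<Sum>a\<in>I7. F (half_turn w (oct_e a)) (half_turn w (oct_e a)))
     = (\<Sum>a\<in>I7. 4 * F w w * (w $ a * w $ a) - 2 * (w $ a * F w (oct_e a)) - 2 * (w $ a * F (oct_e a) w) + F (oct_e a) (oct_e a))"
  proof (rule sum.cong[OF refl])
    fix a assume a: "a \<in> I7"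
    then have p: "(2 * w $ a) *\<^sub>R w + (-1) *\<^sub>R oct_e a \<in> Im_oct" by (intro Im_comb wi oct_e_Im)
    show "F (half_turn w (oct_e a)) (half_turn w (oct_e a)) = 4 * F w w * (w $ a * w $ a) - 2 * (w $ a * F w (oct_e a)) - 2 * (w $ a * F (oct_e a) w) + F (oct_e a) (oct_e a)"
      unfolding r left[OF wi(1) oct_e_Im[OF a] p] right[OF wi(1) wi(1) oct_e_Im[OF a]] right[OF oct_e_Im[OF a] wi(1) oct_e_Im[OF a]]
      by (simp add: algebra_simps)
  qed
  also have "\<dots> = (\<Sum>a\<in>I7. F (oct_e a) (oct_e a))"
    unfolding sum.distrib sum_subtractf sum_distrib_left[symmetric] n W1 W2 by simp
  finally show ?thesis unfolding F_def .
qed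

definition contr :: "nat \<Rightarrow> nat \<Rightarrow> tuple_fun \<Rightarrow> tuple_fun" where
  "contr k i f u x = (\<Sum>a\<in>I7. f (u(k := oct_e a, i := oct_e a)) x)"

lemma contr_invar:
  assumes f: "invar J K f" and ki: "k \<in> J" "i \<in> J" "k \<noteq> i"
  shows "invar (J - {k, i}) K (contr k i f)"
  unfolding invar_def
proof (intro conjI ballI allI impI)
  show "finite (J - {k, i})" "finite K" using invarD(1,2)[OF f] by auto
  show "depends_on (J - {k, i}) K (contr k i f)"
    unfolding depends_on_def contr_def
    by (intro allI impI sum.cong[OF refl] depends_onD[OF invarD(3)[OF f]]) auto
  show "lin_at l (\<lambda>u. contr k i f u x)" if "l \<in> J - {k, i}" for l x
    unfolding contr_def
  proof (intro lin_at_sum)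
    fix a assume a: "a \<in> I7"
    have l: "(u(l := v))(k := oct_e a, i := oct_e a) = (u(k := oct_e a, i := oct_e a))(l := v)" for u v
      using that by (auto simp: fun_eq_iff)
    show "lin_at l (\<lambda>u. f (u(k := oct_e a, i := oct_e a)) x)"
      unfolding lin_at_def l
      by (intro allI impI ballI lin_atD[OF invarD(4)[OF f]]) (use that a in auto)
  qed
  show "linear (\<lambda>y. contr k i f u (x(l := y)))" if "l \<in> K" "imag u" for l u x
    unfolding contr_def
    by (intro linear_compose_sum ballI invarD(5)[OF f]) (use that in auto)
  show "half_turn_invariant (contr k i f)"
    unfolding half_turn_invariant_def contr_def
  proof (intro allI impI)
    fix w u and x :: "nat \<Rightarrow> octonion" assume w: "unit_im w" and u: "imag u"
    let ?u = "\<lambda>j. half_turn w (u j)" and ?x = "\<lambda>k::nat. w \<odot> x k"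
    have "imag ?u" using half_turn_Im[OF w] u by (simp add: imag_def)
    then have "(\<Sum>a\<in>I7. f (?u(k := oct_e a, i := oct_e a)) ?x) = (\<Sum>a\<in>I7. f (?u(k := half_turn w (oct_e a), i := half_turn w (oct_e a))) ?x)"
      using contraction_half_turn[OF invarD(4)[OF f ki(1), of ?x] invarD(4)[OF f ki(2), of ?x] ki(3) _ w, of ?u] by simp
    also have "\<dots> = (\<Sum>a\<in>I7. f (u(k := oct_e a, i := oct_e a)) x)"
    proof (rule sum.cong[OF refl])
      fix a assume a: "a \<in> I7"
      have "?u(k := half_turn w (oct_e a), i := half_turn w (oct_e a)) = (\<lambda>j. half_turn w ((u(k := oct_e a, i := oct_e a)) j))"
        by (auto simp: fun_eq_iff)
      then show "f (?u(k := half_turn w (oct_e a), i := half_turn w (oct_e a))) ?x = f (u(k := oct_e a, i := oct_e a)) x"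
        using invarD(6)[OF f] w imag_upd[OF imag_upd[OF u oct_e_Im[OF a]] oct_e_Im[OF a]] unfolding half_turn_invariant_def by metis
    qed
    finally show "(\<Sum>a\<in>I7. f (?u(k := oct_e a, i := oct_e a)) ?x) = (\<Sum>a\<in>I7. f (u(k := oct_e a, i := oct_e a)) x)" .
  qed
qed

section \<open>The first fundamental theorem for vectors\<close>

text \<open>
  The product rule for a function of several vectors.
\<close>

lemma multilinear_derivative:
  assumes "finite S" "\<And>j. j \<in> S \<Longrightarrow> lin_at j g" "imag v"
    and "\<And>j t. \<gamma> j t \<in> Im_oct" "\<And>j. \<gamma>' j \<in> Im_oct"
    and "\<And>j a. ((\<lambda>t. \<gamma> j t $ a) has_real_derivative \<gamma>' j $ a) (at 0)"
  shows "((\<lambda>t. g (\<lambda>j. if j \<in> S then \<gamma> j t else v j)) has_real_derivative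
    (\<Sum>i\<in>S. g ((\<lambda>j. if j \<in> S then \<gamma> j 0 else v j)(i := \<gamma>' i)))) (at 0)"
  using assms(1-3)
proof (induction S arbitrary: v rule: finite_induct)
  case empty
  then show ?case by simp
next
  case (insert i S)
  let ?m = "\<lambda>v t j. if j \<in> S then \<gamma> j t else v j"
  have im: "imag (?m v t)" if "imag v" for v t using that assms(4) by (auto simp: imag_def)
  have e: "(\<lambda>j. if j \<in> insert i S then \<gamma> j t else v j) = (?m v t)(i := \<gamma> i t)" for t v
    using insert.hyps by (auto simp: fun_eq_iff)
  have m: "(?m v t)(i := p) = ?m (v(i := p)) t" for t p v
    using insert.hyps by (auto simp: fun_eq_iff)
  have lin: "lin_at i g" using insert.prems by simp
  have A: "g ((?m v t)(i := \<gamma> i t)) = (\<Sum>a\<in>I7. \<gamma> i t $ a * g (?m (v(i := oct_e a)) t))" for t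
    using lin_atD[OF lin im[OF insert.prems(2), of t] assms(4)[of i t]] unfolding m .
  have B: "((\<lambda>t. \<Sum>a\<in>I7. \<gamma> i t $ a * g (?m (v(i := oct_e a)) t)) has_real_derivative
      (\<Sum>a\<in>I7. \<gamma>' i $ a * g (?m (v(i := oct_e a)) 0) + (\<Sum>l\<in>S. g ((?m (v(i := oct_e a)) 0)(l := \<gamma>' l))) * \<gamma> i 0 $ a)) (at 0)"
    by (intro DERIV_sum DERIV_mult assms(6) insert.IH) (use insert.prems in \<open>auto simp: imag_def\<close>)
  have C: "(\<Sum>a\<in>I7. \<gamma>' i $ a * g (?m (v(i := oct_e a)) 0) + (\<Sum>l\<in>S. g ((?m (v(i := oct_e a)) 0)(l := \<gamma>' l))) * \<gamma> i 0 $ a)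
     = (\<Sum>l\<in>insert i S. g (((?m v 0)(i := \<gamma> i 0))(l := \<gamma>' l)))"
  proof -
    have "(\<Sum>a\<in>I7. \<gamma>' i $ a * g (?m (v(i := oct_e a)) 0)) = g ((?m v 0)(i := \<gamma>' i))"
      using lin_atD[OF lin im[OF insert.prems(2), of 0] assms(5)[of i]] unfolding m by simp
    moreover have "(\<Sum>a\<in>I7. (\<Sum>l\<in>S. g ((?m (v(i := oct_e a)) 0)(l := \<gamma>' l))) * \<gamma> i 0 $ a)
       = (\<Sum>l\<in>S. g (((?m v 0)(i := \<gamma> i 0))(l := \<gamma>' l)))"
      unfolding sum_distrib_right
    proof (subst sum.swap, rule sum.cong[OF refl])
      fix l assume "l \<in> S"
      then have "i \<noteq> l" using insert.hyps by auto
      then have tw: "((?m v 0)(i := p))(l := \<gamma>' l) = ((?m v 0)(l := \<gamma>' l))(i := p)" for p by (rule fun_upd_twist)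
      have "imag ((?m v 0)(l := \<gamma>' l))" using im[OF insert.prems(2), of 0] assms(5) by (rule imag_upd)
      from lin_atD[OF lin this assms(4)[of i 0]]
      show "(\<Sum>a\<in>I7. g ((?m (v(i := oct_e a)) 0)(l := \<gamma>' l)) * \<gamma> i 0 $ a) = g (((?m v 0)(i := \<gamma> i 0))(l := \<gamma>' l))"
        unfolding m[symmetric] tw by (simp add: mult.commute)
    qed
    ultimately show ?thesis using insert.hyps by (simp add: sum.distrib)
  qed
  show ?case unfolding e A using B unfolding C .
qed

definition inf_rot :: "8 \<Rightarrow> 8 \<Rightarrow> octonion \<Rightarrow> octonion" where
  "inf_rot a b v = v $ a *\<^sub>R oct_e b + (- v $ b) *\<^sub>R oct_e a"

lemma inf_rot_Im: "a \<in> I7 \<Longrightarrow> b \<in> I7 \<Longrightarrow> inf_rot a b v \<in> Im_oct"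
  unfolding inf_rot_def by (intro Im_comb oct_e_Im)

text \<open>
  The half turn about \<open>cos t e\<^sub>a + sin t e\<^sub>b\<close>, preceded by the one about \<open>e\<^sub>a\<close>, is a rotation that is the
  identity at \<open>t = 0\<close>.  Its derivative there is twice the infinitesimal rotation of the plane.
\<close>

lemma infinitesimal:
  assumes f: "invar J {} f" and u: "imag u" and ab: "a \<in> I7" "b \<in> I7"
  shows "(\<Sum>i\<in>J. f (u(i := inf_rot a b (u i))) x) = 0"
proof (cases "a = b")
  case True
  have "f (u(i := 0)) x = 0" if "i \<in> J" for i
    using lin_atD[OF invarD(4)[OF f that] u, of 0] by (simp add: Im_oct_iff)
  then show ?thesis using True by (simp add: inf_rot_def flip: scaleR_add_left)
next
  case False
  define w where "w t = cos t *\<^sub>R oct_e a + sin t *\<^sub>R oct_e b" for t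
  have unit: "unit_im (w t)" for t
    unfolding unit_im_def w_def
  proof
    show "cos t *\<^sub>R oct_e a + sin t *\<^sub>R oct_e b \<in> Im_oct" by (intro Im_comb oct_e_Im ab)
    show "(cos t *\<^sub>R oct_e a + sin t *\<^sub>R oct_e b) \<bullet> (cos t *\<^sub>R oct_e a + sin t *\<^sub>R oct_e b) = 1"
      using False sin_cos_squared_add[of t]
      by (simp add: inner_add_left inner_add_right oct_e_coords power2_eq_square add.commute)
  qed
  define v where "v j = half_turn (oct_e a) (u j)" for j
  have ua: "unit_im (oct_e a)" using unit[of 0] by (simp add: w_def)
  have v: "imag v" using half_turn_Im[OF ua] u by (simp add: imag_def v_def)
  define \<gamma> where "\<gamma> j t = half_turn (w t) (v j)" for j t
  define \<gamma>' where "\<gamma>' j = 2 *\<^sub>R inf_rot a b (u j)" for j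
  have \<gamma>0: "\<gamma> j 0 = u j" for j by (simp add: \<gamma>_def v_def w_def half_turn_involution[OF ua])
  have va: "v j $ a = u j $ a" "v j $ b = - u j $ b" for j
    using False by (simp_all add: v_def half_turn_def oct_e_coords)
  have deriv: "((\<lambda>t. \<gamma> j t $ c) has_real_derivative \<gamma>' j $ c) (at 0)" for j c
  proof -
    have "((\<lambda>t. 2 * (cos t * v j $ a + sin t * v j $ b) * (cos t * oct_e a $ c + sin t * oct_e b $ c) - v j $ c)
       has_real_derivative 2 * (v j $ b * oct_e a $ c + v j $ a * oct_e b $ c)) (at 0)"
      by (auto intro!: derivative_eq_intros)
    moreover have "\<gamma> j t $ c = 2 * (cos t * v j $ a + sin t * v j $ b) * (cos t * oct_e a $ c + sin t * oct_e b $ c) - v j $ c" for t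
      by (simp add: \<gamma>_def half_turn_def w_def inner_add_right algebra_simps)
    moreover have "\<gamma>' j $ c = 2 * (v j $ b * oct_e a $ c + v j $ a * oct_e b $ c)"
      by (simp add: \<gamma>'_def inf_rot_def va algebra_simps)
    ultimately show ?thesis by simp
  qed
  have const: "f (\<lambda>j. if j \<in> J then \<gamma> j t else v j) x = f v x" for t
  proof -
    have "f (\<lambda>j. if j \<in> J then \<gamma> j t else v j) x = f (\<lambda>j. half_turn (w t) (v j)) (\<lambda>k. w t \<odot> x k)"
      by (rule depends_onD[OF invarD(3)[OF f]]) (auto simp: \<gamma>_def)
    then show ?thesis using invarD(6)[OF f] unit v unfolding half_turn_invariant_def by metis
  qed
  have "((\<lambda>t. f (\<lambda>j. if j \<in> J then \<gamma> j t else v j) x) has_real_derivative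
    (\<Sum>i\<in>J. f ((\<lambda>j. if j \<in> J then \<gamma> j 0 else v j)(i := \<gamma>' i)) x)) (at 0)"
  proof (rule multilinear_derivative[where g = "\<lambda>u. f u x"])
    show "finite J" by (rule invarD(1)[OF f])
    show "lin_at j (\<lambda>u. f u x)" if "j \<in> J" for j by (rule invarD(4)[OF f that])
    show "\<gamma> j t \<in> Im_oct" for j t unfolding \<gamma>_def by (rule half_turn_Im[OF unit]) (use v in simp)
    show "\<gamma>' j \<in> Im_oct" for j using inf_rot_Im[OF ab, of "u j"] by (simp add: \<gamma>'_def Im_oct_iff)
  qed (use v deriv in auto)
  moreover have "((\<lambda>t. f (\<lambda>j. if j \<in> J then \<gamma> j t else v j) x) has_real_derivative 0) (at 0)"
    unfolding const by simp
  ultimately have "(\<Sum>i\<in>J. f ((\<lambda>j. if j \<in> J then \<gamma> j 0 else v j)(i := \<gamma>' i)) x) = 0"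
    by (rule DERIV_unique)
  moreover have "f ((\<lambda>j. if j \<in> J then \<gamma> j 0 else v j)(i := \<gamma>' i)) x = 2 * f (u(i := inf_rot a b (u i))) x" if "i \<in> J" for i
  proof -
    have "f ((\<lambda>j. if j \<in> J then \<gamma> j 0 else v j)(i := \<gamma>' i)) x = f (u(i := \<gamma>' i)) x"
      by (rule depends_onD[OF invarD(3)[OF f]]) (auto simp: \<gamma>0)
    also have "\<dots> = 2 * f (u(i := inf_rot a b (u i))) x"
      using lin_at_comb[OF invarD(4)[OF f that, of x] u inf_rot_Im[OF ab, of "u i"] inf_rot_Im[OF ab, of "u i"], where c = 2 and d = 0]
      by (simp add: \<gamma>'_def)
    finally show ?thesis .
  qed
  ultimately have "(\<Sum>i\<in>J. 2 * f (u(i := inf_rot a b (u i))) x) = 0" by simp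
  then show ?thesis by (simp flip: sum_distrib_left)
qed

text \<open>
  The infinitesimal rotation of the plane of \<open>a\<close> and \<open>b\<close> is applied to the variable \<open>k\<close>, then its invariance
  is used once more, and the result is summed over all \<open>a\<close>, \<open>b\<close>.  The square on the variable \<open>k\<close> is the
  scalar \<open>-12\<close>; its pairing with another variable is twice an inner product times a
  contraction, minus twice a transposition.
\<close>

lemma Casimir:
  assumes f: "invar J {} f" and u: "imag u" and k: "k \<in> J"
  shows "6 * f u x + (\<Sum>i\<in>J - {k}. f (u \<circ> Transposition.transpose k i) x)
     = (\<Sum>i\<in>J - {k}. (u k \<bullet> u i) * contr k i f u x)"
proof -
  have fin: "finite J" by (rule invarD(1)[OF f])
  have lin: "lin_at j (\<lambda>u. f u x)" if "j \<in> J" for j by (rule invarD(4)[OF f that])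
  have cI: "(\<Sum>a\<in>I7. (r::real)) = 7 * r" for r by (simp add: card_I7)
  have self: "(\<Sum>a\<in>I7. \<Sum>b\<in>I7. f (u(k := inf_rot a b (inf_rot a b (u k)))) x) = - 12 * f u x"
  proof -
    define v where "v = u k"
    define H where "H a = f (u(k := oct_e a)) x" for a
    have "f (u(k := inf_rot a b (inf_rot a b v))) x = (if a = b then v $ a * H a + v $ a * H a else 0) - v $ b * H b - v $ a * H a"
      if "a \<in> I7" "b \<in> I7" for a b
      unfolding inf_rot_def[of a b "inf_rot a b v"]
      by (subst lin_at_comb[OF lin[OF k] u]) (use that in \<open>auto simp: inf_rot_def oct_e_coords H_def[symmetric] algebra_simps\<close>)
    then have "(\<Sum>a\<in>I7. \<Sum>b\<in>I7. f (u(k := inf_rot a b (inf_rot a b v))) x)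
      = (\<Sum>a\<in>I7. \<Sum>b\<in>I7. (if a = b then v $ a * H a + v $ a * H a else 0) - v $ b * H b - v $ a * H a)"
      by (intro sum.cong) auto
    also have "\<dots> = - 12 * (\<Sum>a\<in>I7. v $ a * H a)"
    proof -
      have "(\<Sum>a\<in>I7. if a \<in> I7 then v $ a * H a + v $ a * H a else 0) = 2 * (\<Sum>a\<in>I7. v $ a * H a)"
        unfolding sum_distrib_left by (rule sum.cong) auto
      moreover have "(\<Sum>a\<in>I7. v $ a * (7 * H a)) = 7 * (\<Sum>a\<in>I7. v $ a * H a)"
        unfolding sum_distrib_left by (rule sum.cong) auto
      ultimately show ?thesis
        unfolding sum_subtractf cI sum.delta'[OF finite_I7] sum_distrib_left[symmetric] by linarith
    qed
    also have "(\<Sum>a\<in>I7. v $ a * H a) = f u x"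
      using lin_atD[OF lin[OF k] u, of "u k"] u unfolding H_def v_def by simp
    finally show ?thesis unfolding v_def .
  qed
  have cross: "(\<Sum>a\<in>I7. \<Sum>b\<in>I7. f (u(k := inf_rot a b (u k), i := inf_rot a b (u i))) x)
      = 2 * ((u k \<bullet> u i) * contr k i f u x) - 2 * f (u \<circ> Transposition.transpose k i) x"
    if i: "i \<in> J - {k}" for i
  proof -
    define v where "v = u k"
    define w where "w = u i"
    define G where "G p q = f (u(k := p, i := q)) x" for p q
    have ki: "k \<noteq> i" "i \<in> J" using i by auto
    have vw: "v \<in> Im_oct" "w \<in> Im_oct" using u by (auto simp: v_def w_def)
    have G1: "G (c *\<^sub>R p + d *\<^sub>R p') q = c * G p q + d * G p' q" if "p \<in> Im_oct" "p' \<in> Im_oct" "q \<in> Im_oct" for p p' q c d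
      unfolding G_def fun_upd_twist[OF ki(1), of u] by (rule lin_at_comb[OF lin[OF k]]) (use u that in \<open>auto simp: imag_def\<close>)
    have G2: "G p (c *\<^sub>R q + d *\<^sub>R q') = c * G p q + d * G p q'" if "p \<in> Im_oct" "q \<in> Im_oct" "q' \<in> Im_oct" for p q q' c d
      unfolding G_def by (rule lin_at_comb[OF lin[OF ki(2)]]) (use u that in \<open>auto simp: imag_def\<close>)
    have Gs: "(\<Sum>b\<in>I7. w $ b * G (oct_e b) q) = G w q" if "q \<in> Im_oct" for q
      using lin_atD[OF lin[OF k] imag_upd[OF u that, of i] vw(2)]
      unfolding G_def fun_upd_twist[OF ki(1), of u] by simp
    have Gs2: "(\<Sum>a\<in>I7. v $ a * G w (oct_e a)) = G w v"
      using lin_atD[OF lin[OF ki(2)] imag_upd[OF u vw(2), of k] vw(1)] unfolding G_def by simp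
    have "G (inf_rot a b v) (inf_rot a b w) = (v $ a * w $ a) * G (oct_e b) (oct_e b) - v $ a * (w $ b * G (oct_e b) (oct_e a))
         - w $ a * (v $ b * G (oct_e a) (oct_e b)) + (v $ b * w $ b) * G (oct_e a) (oct_e a)"
      if ab: "a \<in> I7" "b \<in> I7" for a b
    proof -
      have r: "w $ a *\<^sub>R oct_e b + (- w $ b) *\<^sub>R oct_e a \<in> Im_oct" by (intro Im_comb oct_e_Im ab)
      show ?thesis
        unfolding inf_rot_def G1[OF oct_e_Im[OF ab(2)] oct_e_Im[OF ab(1)] r]
          G2[OF oct_e_Im[OF ab(2)] oct_e_Im[OF ab(2)] oct_e_Im[OF ab(1)]]
          G2[OF oct_e_Im[OF ab(1)] oct_e_Im[OF ab(2)] oct_e_Im[OF ab(1)]]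
        by (simp add: algebra_simps)
    qed
    then have "(\<Sum>a\<in>I7. \<Sum>b\<in>I7. G (inf_rot a b v) (inf_rot a b w))
      = (\<Sum>a\<in>I7. \<Sum>b\<in>I7. (v $ a * w $ a) * G (oct_e b) (oct_e b)) - (\<Sum>a\<in>I7. \<Sum>b\<in>I7. v $ a * (w $ b * G (oct_e b) (oct_e a)))
         - (\<Sum>a\<in>I7. \<Sum>b\<in>I7. w $ a * (v $ b * G (oct_e a) (oct_e b))) + (\<Sum>a\<in>I7. \<Sum>b\<in>I7. (v $ b * w $ b) * G (oct_e a) (oct_e a))"
      by (simp add: sum.distrib sum_subtractf)
    also have "(\<Sum>a\<in>I7. \<Sum>b\<in>I7. (v $ a * w $ a) * G (oct_e b) (oct_e b)) = (v \<bullet> w) * (\<Sum>b\<in>I7. G (oct_e b) (oct_e b))"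
      unfolding Im_inner[OF vw(1)] by (simp only: sum_distrib_left[symmetric] sum_distrib_right[symmetric])
    also have "(\<Sum>a\<in>I7. \<Sum>b\<in>I7. (v $ b * w $ b) * G (oct_e a) (oct_e a)) = (v \<bullet> w) * (\<Sum>b\<in>I7. G (oct_e b) (oct_e b))"
      unfolding Im_inner[OF vw(1)] by (simp only: sum_distrib_left[symmetric] sum_distrib_right[symmetric])
    also have "(\<Sum>a\<in>I7. \<Sum>b\<in>I7. v $ a * (w $ b * G (oct_e b) (oct_e a))) = G w v"
      by (simp only: sum_distrib_left[symmetric] Gs[OF oct_e_Im] Gs2 cong: sum.cong)
    also have "(\<Sum>a\<in>I7. \<Sum>b\<in>I7. w $ a * (v $ b * G (oct_e a) (oct_e b))) = (\<Sum>a\<in>I7. \<Sum>b\<in>I7. v $ a * (w $ b * G (oct_e b) (oct_e a)))"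
      by (subst sum.swap) (simp only: mult.left_commute)
    also have "\<dots> = G w v"
      by (simp only: sum_distrib_left[symmetric] Gs[OF oct_e_Im] Gs2 cong: sum.cong)
    also have "G w v = f (u \<circ> Transposition.transpose k i) x"
    proof -
      have "u(k := w, i := v) = u \<circ> Transposition.transpose k i"
        using ki by (auto simp: fun_eq_iff Transposition.transpose_def v_def w_def)
      then show ?thesis by (simp add: G_def)
    qed
    finally show ?thesis unfolding G_def contr_def v_def w_def by simp
  qed
  \<comment> \<open>infinitesimal invariance at the point where \<open>k\<close> has already been rotated\<close>
  have "(\<Sum>a\<in>I7. \<Sum>b\<in>I7. f (u(k := inf_rot a b (inf_rot a b (u k)))) x
       + (\<Sum>i\<in>J - {k}. f (u(k := inf_rot a b (u k), i := inf_rot a b (u i))) x)) = 0"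
  proof (intro sum.neutral ballI)
    fix a b assume ab: "a \<in> I7" "b \<in> I7"
    let ?u = "u(k := inf_rot a b (u k))"
    have "imag ?u" using u inf_rot_Im[OF ab] by simp
    from infinitesimal[OF f this ab, of x]
    have "f (?u(k := inf_rot a b (?u k))) x + (\<Sum>i\<in>J - {k}. f (?u(i := inf_rot a b (?u i))) x) = 0"
      using fin k by (simp only: sum.remove)
    moreover have "(\<Sum>i\<in>J - {k}. f (?u(i := inf_rot a b (?u i))) x) = (\<Sum>i\<in>J - {k}. f (u(k := inf_rot a b (u k), i := inf_rot a b (u i))) x)"
      by (rule sum.cong) auto
    ultimately show "f (u(k := inf_rot a b (inf_rot a b (u k)))) x
       + (\<Sum>i\<in>J - {k}. f (u(k := inf_rot a b (u k), i := inf_rot a b (u i))) x) = 0" by simp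
  qed
  then have "- 12 * f u x + (\<Sum>a\<in>I7. \<Sum>b\<in>I7. \<Sum>i\<in>J - {k}. f (u(k := inf_rot a b (u k), i := inf_rot a b (u i))) x) = 0"
    unfolding sum.distrib self .
  also have "(\<Sum>a\<in>I7. \<Sum>b\<in>I7. \<Sum>i\<in>J - {k}. f (u(k := inf_rot a b (u k), i := inf_rot a b (u i))) x)
     = (\<Sum>i\<in>J - {k}. \<Sum>a\<in>I7. \<Sum>b\<in>I7. f (u(k := inf_rot a b (u k), i := inf_rot a b (u i))) x)"
    by (simp only: sum.swap[of _ "J - {k}" I7])
  also have "\<dots> = (\<Sum>i\<in>J - {k}. 2 * ((u k \<bullet> u i) * contr k i f u x) - 2 * f (u \<circ> Transposition.transpose k i) x)"
    by (rule sum.cong[OF refl]) (rule cross)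
  finally show ?thesis
    by (simp add: sum_subtractf sum_distrib_left[symmetric])
qed

text \<open>
  Antisymmetrizing over the coset representatives \<open>1\<close> and \<open>(i j)\<close>, \<open>i \<in> S\<close>, of the permutations of \<open>S\<close> in those
  of \<open>insert j S\<close>.
\<close>

lemma alternating_extend:
  assumes alt: "alternating S g" and "finite S" and j: "j \<notin> S"
  shows "alternating (insert j S) (\<lambda>u. g u - (\<Sum>i\<in>S. g (u \<circ> Transposition.transpose i j)))"
proof -
  let ?t = "Transposition.transpose"
  define F where "F u = g u - (\<Sum>i\<in>S. g (u \<circ> ?t i j))" for u
  have in_S: "F (u \<circ> ?t p q) = - F u" if u: "imag u" and pq: "p \<in> S" "q \<in> S" "p \<noteq> q" for u p q
  proof -
    have "(\<Sum>i\<in>S. g ((u \<circ> ?t p q) \<circ> ?t i j)) = (\<Sum>i\<in>S. - g (u \<circ> ?t i j))"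
    proof (rule sum.reindex_bij_witness[of _ "?t p q" "?t p q"])
      fix i assume i: "i \<in> S"
      show "?t p q (?t p q i) = i" by simp
      then show "?t p q (?t p q i) = i" .
      show tS: "?t p q i \<in> S" using i pq by (simp add: Transposition.transpose_def)
      then show "?t p q i \<in> S" .
      have "(u \<circ> ?t p q) \<circ> ?t i j = (u \<circ> ?t (?t p q i) j) \<circ> ?t p q"
        using i j pq by (auto simp: fun_eq_iff Transposition.transpose_def)
      then show "- g (u \<circ> ?t (?t p q i) j) = g ((u \<circ> ?t p q) \<circ> ?t i j)"
        using alternatingD[OF alt imag_comp[OF u] pq] by simp
    qed
    then show ?thesis unfolding F_def using alternatingD[OF alt u pq] by (simp add: sum_negf)
  qed
  have with_j: "F (u \<circ> ?t p j) = - F u" if u: "imag u" and p: "p \<in> S" for u p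
  proof -
    have "(\<Sum>i\<in>S. g ((u \<circ> ?t p j) \<circ> ?t i j)) = g u + (\<Sum>i\<in>S - {p}. - g (u \<circ> ?t i j))"
    proof -
      have "(u \<circ> ?t p j) \<circ> ?t p j = u" by (simp add: fun_eq_iff)
      moreover have "g ((u \<circ> ?t p j) \<circ> ?t i j) = - g (u \<circ> ?t i j)" if "i \<in> S - {p}" for i
      proof -
        have "(u \<circ> ?t p j) \<circ> ?t i j = (u \<circ> ?t i j) \<circ> ?t i p"
          using that j p by (auto simp: fun_eq_iff Transposition.transpose_def)
        then show ?thesis using alternatingD[OF alt imag_comp[OF u], of i p] that p by simp
      qed
      ultimately show ?thesis using \<open>finite S\<close> p by (simp add: sum.remove)
    qed
    moreover have "(\<Sum>i\<in>S. g (u \<circ> ?t i j)) = g (u \<circ> ?t p j) + (\<Sum>i\<in>S - {p}. g (u \<circ> ?t i j))"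
      using \<open>finite S\<close> p by (simp add: sum.remove)
    ultimately show ?thesis unfolding F_def by (simp add: sum_negf)
  qed
  show ?thesis
    unfolding alternating_def F_def[symmetric]
    using in_S with_j by (metis insertE Transposition.transpose_commute)
qed

text \<open>
  By induction, the right-hand side of \<open>Casimir\<close> lies in the span.  Let \<open>f\<close> alternate in the variables of
  a set \<open>S\<close> of size \<open>s\<close>, and let \<open>f\<^sub>j\<close> be its antisymmetrization with one more variable \<open>j\<close>.  Adding up \<open>f\<^sub>j\<close> over
  \<open>j \<notin> S\<close> and the Casimir relations of all \<open>k \<in> S\<close>, the transpositions between \<open>S\<close> and its complement cancel and a
  multiple \<open>(l - s) + s(7 - s)\<close> of \<open>f\<close> remains, where \<open>l\<close> is the number of variables.  The factor is positive
  unless \<open>s = l = 7\<close>, when \<open>f\<close> is a multiple of the determinant.  So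
  \<open>f\<close> lies in the span if all \<open>f\<^sub>j\<close> do, and the downward induction on \<open>s\<close> starts with \<open>s = 8\<close>, where
  alternating functions vanish.  At \<open>s = 1\<close> the assumption on \<open>f\<close> is void.
\<close>

theorem FFT_vectors: "invar J {} f \<Longrightarrow> spanned J {} f"
proof (induction "card J" arbitrary: J f rule: less_induct)
  case less
  have fin: "finite J" by (rule invarD(1)[OF less.prems])
  have Cas: "spanned J {} (\<lambda>u x. 6 * f u x + (\<Sum>i\<in>J - {k}. f (u \<circ> Transposition.transpose k i) x))"
    if f: "invar J {} f" and k: "k \<in> J" for f k
  proof -
    have "spanned J {} (\<lambda>u x. (u k \<bullet> u i) * contr k i f u x)" if i: "i \<in> J - {k}" for i
    proof -
      have "card (J - {k, i}) < card J" using fin k i by (intro psubset_card_mono) auto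
      moreover have "invar (J - {k, i}) {} (contr k i f)" using contr_invar[OF f k] i by auto
      ultimately have "spanned (J - {k, i}) {} (contr k i f)" by (rule less.hyps)
      from spanned_mult[OF spanned_inner_u this, of k i]
      have "spanned ({k, i} \<union> (J - {k, i})) {} (\<lambda>u x. (u k \<bullet> u i) * contr k i f u x)" using i by auto
      then show ?thesis by (rule spanned_sets) (use i k in auto)
    qed
    from spanned_sum[of "J - {k}", OF this] show ?thesis
      by (rule spanned.cong) (simp_all add: Casimir[OF f _ k])
  qed
  have claim: "spanned J {} f"
    if "invar J {} f" "S \<subseteq> J" "1 \<le> card S" "card S \<le> 8" "\<And>x. alternating S (\<lambda>u. f u x)" for S f
    using that
  proof (induction "8 - card S" arbitrary: S f rule: less_induct)
    case less
    note f = less.prems(1) and S = less.prems(2-4) and alt = less.prems(5)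
    have finS: "finite S" using S fin finite_subset by blast
    define s where "s = card S"
    consider "s = 8" | "s = 7" "S = J" | "s \<le> 7" "s < 7 \<or> S \<noteq> J" using S(3) unfolding s_def by linarith
    then show ?case
    proof cases
      case 1
      show ?thesis
      proof (rule spanned.cong[OF spanned.zero])
        fix u x :: "nat \<Rightarrow> octonion" assume "imag u"
        have "f u x = 0"
          by (rule alternating_too_many[OF alt finS _ _ \<open>imag u\<close>]) (use 1 S invarD(4)[OF f] in \<open>auto simp: s_def\<close>)
        then show "0 = f u x" by simp
      qed
    next
      case 2
      define js where "js = sorted_list_of_set J"
      have js: "distinct js" "length js = 7" "set js = J"
        using fin 2 by (simp_all add: js_def s_def)
      have "spanned J {} (\<lambda>u x. f (std_assign js) (\<lambda>k. 0) * det_Im (map u js))"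
        using spanned_scale[OF spanned_det[OF js(1,2)]] js(3) by simp
      then show ?thesis
      proof (rule spanned.cong)
        fix u x :: "nat \<Rightarrow> octonion" assume u: "imag u"
        have "f u x = det_Im (map u js) * f (std_override js u) x"
          by (rule alternating_det[OF js(1,2) _ _ u]) (use alt 2 js invarD(4)[OF f] in auto)
        also have "f (std_override js u) x = f (std_assign js) (\<lambda>k. 0)"
          by (rule depends_onD[OF invarD(3)[OF f]]) (auto simp: std_override_def js(3))
        finally show "f (std_assign js) (\<lambda>k. 0) * det_Im (map u js) = f u x" by simp
      qed
    next
      case 3
      define l where "l = card J"
      have sl: "s \<le> l" unfolding s_def l_def using S fin by (simp add: card_mono)
      have ls: "card (J - S) = l - s" unfolding s_def l_def using S finS by (simp add: card_Diff_subset)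
      have lt: "S \<noteq> J \<Longrightarrow> s < l" unfolding s_def l_def using S fin by (simp add: psubset_card_mono psubset_eq)
      define fj where "fj j u x = f u x - (\<Sum>i\<in>S. f (u \<circ> Transposition.transpose i j) x)" for j u x
      have fj: "spanned J {} (fj j)" if j: "j \<in> J - S" for j
      proof (rule less.hyps[of "insert j S"])
        have "card (insert j S) = Suc s" using j finS by (simp add: s_def)
        then show "8 - card (insert j S) < 8 - card S" "1 \<le> card (insert j S)" "card (insert j S) \<le> 8"
          using 3(1) by (simp_all add: s_def)
        show "insert j S \<subseteq> J" using j S by auto
        show "alternating (insert j S) (\<lambda>u. fj j u x)" for x
          unfolding fj_def by (rule alternating_extend[OF alt finS]) (use j in auto)
        have "invar J {} (\<lambda>u x. f u x + (-1) * (\<Sum>i\<in>S. f (u \<circ> Transposition.transpose i j) x))"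
          by (intro invar_add invar_scale invar_sum invar_transpose f fin) (use j S in auto)
        then show "invar J {} (fj j)" unfolding fj_def[abs_def] by simp
      qed
      have "spanned J {} (\<lambda>u x. (\<Sum>j\<in>J - S. fj j u x)
           + (\<Sum>k\<in>S. 6 * f u x + (\<Sum>i\<in>J - {k}. f (u \<circ> Transposition.transpose k i) x)))"
        by (intro spanned_add spanned_sum fj Cas f) (use S in auto)
      from spanned_scale[OF this, of "1 / ((real l - real s) + real s * (7 - real s))"]
      show ?thesis
      proof (rule spanned.cong)
        fix u x :: "nat \<Rightarrow> octonion" assume u: "imag u"
        have "(\<Sum>i\<in>J - {k}. f (u \<circ> Transposition.transpose k i) x)
            = - (real s - 1) * f u x + (\<Sum>j\<in>J - S. f (u \<circ> Transposition.transpose k j) x)" if k: "k \<in> S" for k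
        proof -
          have "J - {k} = (S - {k}) \<union> (J - S)" using S k by auto
          then have "(\<Sum>i\<in>J - {k}. f (u \<circ> Transposition.transpose k i) x)
             = (\<Sum>i\<in>S - {k}. f (u \<circ> Transposition.transpose k i) x) + (\<Sum>j\<in>J - S. f (u \<circ> Transposition.transpose k j) x)"
            using fin finS by (simp only:) (rule sum.union_disjoint, auto)
          also have "(\<Sum>i\<in>S - {k}. f (u \<circ> Transposition.transpose k i) x) = (\<Sum>i\<in>S - {k}. - f u x)"
            by (rule sum.cong[OF refl]) (use alternatingD[OF alt u k] in auto)
          also have "\<dots> = - (real s - 1) * f u x"
            using finS k S(2) by (simp add: s_def of_nat_diff algebra_simps)
          finally show ?thesis .
        qed
        then have "(\<Sum>k\<in>S. 6 * f u x + (\<Sum>i\<in>J - {k}. f (u \<circ> Transposition.transpose k i) x))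
          = (\<Sum>k\<in>S. (7 - real s) * f u x + (\<Sum>j\<in>J - S. f (u \<circ> Transposition.transpose k j) x))"
          by (intro sum.cong) (auto simp: algebra_simps)
        also have "\<dots> = real s * ((7 - real s) * f u x) + (\<Sum>j\<in>J - S. \<Sum>k\<in>S. f (u \<circ> Transposition.transpose k j) x)"
          unfolding sum.distrib by (subst sum.swap) (simp add: s_def)
        finally have "(\<Sum>j\<in>J - S. fj j u x)
           + (\<Sum>k\<in>S. 6 * f u x + (\<Sum>i\<in>J - {k}. f (u \<circ> Transposition.transpose k i) x))
          = ((real l - real s) + real s * (7 - real s)) * f u x"
          unfolding fj_def sum_subtractf by (simp add: ls of_nat_diff[OF sl] algebra_simps)
        moreover have "(real l - real s) + real s * (7 - real s) > 0"
        proof (cases "S = J")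
          case True
          then have "real s * (7 - real s) > 0" using 3 S(2) by (simp add: s_def)
          then show ?thesis using sl by simp
        next
          case False
          moreover have "real s * (7 - real s) \<ge> 0" using 3(1) by simp
          ultimately show ?thesis using lt by simp
        qed
        ultimately show "1 / ((real l - real s) + real s * (7 - real s)) * ((\<Sum>j\<in>J - S. fj j u x)
           + (\<Sum>k\<in>S. 6 * f u x + (\<Sum>i\<in>J - {k}. f (u \<circ> Transposition.transpose k i) x))) = f u x"
          by simp
      qed
    qed
  qed
  show ?case
  proof (cases "J = {}")
    case True
    have "f u x = f (\<lambda>j. 0) (\<lambda>k. 0)" for u x
      by (rule depends_onD[OF invarD(3)[OF less.prems]]) (use True in auto)
    then show ?thesis unfolding True by (intro spanned.cong[OF spanned_const[of "f (\<lambda>j. 0) (\<lambda>k. 0)"]]) (rule sym)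
  next
    case False
    then obtain k where "k \<in> J" by blast
    then show ?thesis using claim[OF less.prems, of "{k}"] by (simp add: alternating_def)
  qed
qed

section \<open>Contraction of two vector variables\<close>

lemma sum_I7_wd:
  assumes "v \<in> Im_oct"
  shows "(\<Sum>a\<in>I7. v $ a * (y \<bullet> wd u P (oct_e a \<odot> r))) = y \<bullet> wd u P (v \<odot> r)"
proof -
  have "v \<odot> r = (\<Sum>a\<in>I7. v $ a *\<^sub>R (oct_e a \<odot> r))"
    by (subst Im_oct_expand[OF assms]) (simp only: oct_mult_sum_left oct_mult_scale_left)
  then show ?thesis
    by (simp only: linear_sum[OF wd_linear] linear_scale[OF wd_linear] inner_sum_right inner_scaleR_right)
qed

text \<open>
  Moving \<open>L\<^sub>a\<close> through the word \<open>Q\<close> with the Clifford relations until it meets its partner, where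
  \<open>\<Sum>\<^sub>a L\<^sub>a\<^sup>2 = -7\<close>.
\<close>

lemma spanned_sandwich:
  assumes "distinct (P @ Q @ R)" "k \<noteq> l"
  shows "spanned (set P \<union> set Q \<union> set R) {k, l}
    (\<lambda>u x. \<Sum>a\<in>I7. x k \<bullet> wd u P (oct_e a \<odot> wd u Q (oct_e a \<odot> wd u R (x l))))"
  using assms(1)
proof (induction Q arbitrary: P)
  case Nil
  have "spanned (set (P @ R)) {k, l} (\<lambda>u x. -7 * (x k \<bullet> wd u (P @ R) (x l)))"
    by (intro spanned_scale spanned_bracket) (use Nil assms(2) in auto)
  then have "spanned (set P \<union> set [] \<union> set R) {k, l} (\<lambda>u x. -7 * (x k \<bullet> wd u (P @ R) (x l)))" by simp
  then show ?case
  proof (rule spanned.cong)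
    fix u x :: "nat \<Rightarrow> octonion"
    have "oct_e a \<odot> (oct_e a \<odot> y) = - y" if "a \<in> I7" for a y
      using Clifford_square[OF oct_e_Im[OF that]] by (simp add: oct_e_coords)
    then have "(\<Sum>a\<in>I7. x k \<bullet> wd u P (oct_e a \<odot> wd u [] (oct_e a \<odot> wd u R (x l))))
       = (\<Sum>a\<in>I7. - (x k \<bullet> wd u (P @ R) (x l)))"
      by (intro sum.cong) (simp_all add: linear_neg[OF wd_linear])
    then show "-7 * (x k \<bullet> wd u (P @ R) (x l)) = (\<Sum>a\<in>I7. x k \<bullet> wd u P (oct_e a \<odot> wd u [] (oct_e a \<odot> wd u R (x l))))"
      by (simp add: card_I7)
  qed
next
  case (Cons q Q)
  have 1: "spanned (set (P @ [q]) \<union> set Q \<union> set R) {k, l}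
    (\<lambda>u x. \<Sum>a\<in>I7. x k \<bullet> wd u (P @ [q]) (oct_e a \<odot> wd u Q (oct_e a \<odot> wd u R (x l))))"
    by (rule Cons.IH) (use Cons.prems in auto)
  have 2: "spanned (set (P @ Q @ q # R)) {k, l} (\<lambda>u x. x k \<bullet> wd u (P @ Q @ q # R) (x l))"
    by (rule spanned_bracket) (use Cons.prems assms(2) in auto)
  have sets: "set (P @ [q]) \<union> set Q \<union> set R = set P \<union> set (q # Q) \<union> set R"
    "set (P @ Q @ q # R) = set P \<union> set (q # Q) \<union> set R" by auto
  from spanned_diff[OF spanned_neg[OF 1[unfolded sets]] spanned_scale[OF 2[unfolded sets], of 2]]
  show ?case
  proof (rule spanned.cong)
    fix u x :: "nat \<Rightarrow> octonion" assume u: "imag u"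
    let ?y = "\<lambda>a. wd u Q (oct_e a \<odot> wd u R (x l))"
    have "x k \<bullet> wd u P (oct_e a \<odot> wd u (q # Q) (oct_e a \<odot> wd u R (x l)))
       = - (x k \<bullet> wd u (P @ [q]) (oct_e a \<odot> ?y a)) - 2 * (u q $ a * (x k \<bullet> wd u (P @ Q) (oct_e a \<odot> wd u R (x l))))"
      if a: "a \<in> I7" for a
    proof -
      have "oct_e a \<odot> (u q \<odot> ?y a) = - (u q \<odot> (oct_e a \<odot> ?y a)) - (2 * (u q $ a)) *\<^sub>R ?y a"
        using Clifford[OF oct_e_Im[OF a] imagD[OF u, of q]] by simp
      then show ?thesis
        by (simp add: linear_diff[OF wd_linear] linear_neg[OF wd_linear] linear_scale[OF wd_linear] inner_diff_right)
    qed
    then have "(\<Sum>a\<in>I7. x k \<bullet> wd u P (oct_e a \<odot> wd u (q # Q) (oct_e a \<odot> wd u R (x l))))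
      = - (\<Sum>a\<in>I7. x k \<bullet> wd u (P @ [q]) (oct_e a \<odot> ?y a))
        - 2 * (\<Sum>a\<in>I7. u q $ a * (x k \<bullet> wd u (P @ Q) (oct_e a \<odot> wd u R (x l))))"
      by (simp only: sum_subtractf sum_negf sum_distrib_left cong: sum.cong)
    also have "(\<Sum>a\<in>I7. u q $ a * (x k \<bullet> wd u (P @ Q) (oct_e a \<odot> wd u R (x l)))) = x k \<bullet> wd u (P @ Q @ q # R) (x l)"
      unfolding sum_I7_wd[OF imagD[OF u]] by simp
    finally show "- (\<Sum>a\<in>I7. x k \<bullet> wd u (P @ [q]) (oct_e a \<odot> ?y a)) - 2 * (x k \<bullet> wd u (P @ Q @ q # R) (x l))
       = (\<Sum>a\<in>I7. x k \<bullet> wd u P (oct_e a \<odot> wd u (q # Q) (oct_e a \<odot> wd u R (x l))))" by simp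
  qed
qed

lemma spanned_bracket_phi:
  assumes "distinct (A @ B @ C @ D @ E @ F)" "distinct [k1, k2, k3, k4, k5, k6]"
    and "J = set A \<union> set B \<union> set C \<union> set D \<union> set E \<union> set F" "K = {k1, k2, k3, k4, k5, k6}"
  shows "spanned J K (\<lambda>u x. (wd u A (x k1) \<bullet> wd u B (x k2)) *
     phi (wd u C (x k3)) (wd u D (x k4)) (wd u E (x k5)) (wd u F (x k6)))"
  by (rule spanned_bracket_mult[OF _ _ spanned_phi_words[OF _ _ refl refl]]) (use assms in auto)

lemma spanned_three_brackets:
  assumes "distinct (A @ B @ C @ D @ E @ F)" "distinct [k1, k2, k3, k4, k5, k6]"
    and "J = set A \<union> set B \<union> set C \<union> set D \<union> set E \<union> set F" "K = {k1, k2, k3, k4, k5, k6}"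
  shows "spanned J K (\<lambda>u x. (wd u A (x k1) \<bullet> wd u B (x k2)) *
     ((wd u C (x k3) \<bullet> wd u D (x k4)) * (wd u E (x k5) \<bullet> wd u F (x k6))))"
  by (rule spanned_bracket_mult[OF _ _ spanned_two_brackets[OF _ _ refl refl]]) (use assms in auto)

lemma spanned_bracket_phi_words:
  assumes "distinct (A @ B @ C @ D @ E @ F)" "distinct [k1, k2, k3, k4, k5, k6]"
    and "J = set A \<union> set B \<union> set C \<union> set D \<union> set E \<union> set F" "K = {k1, k2, k3, k4, k5, k6}"
  shows "spanned J K (\<lambda>u x. bracket_phi (wd u A (x k1)) (wd u B (x k2)) (wd u C (x k3)) (wd u D (x k4)) (wd u E (x k5)) (wd u F (x k6)))"
  unfolding bracket_phi_formula mult_minus_left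
  by (intro spanned_add spanned_diff spanned_neg; (rule spanned_bracket_phi spanned_three_brackets); use assms in auto)

lemma wd_split_inner:
  assumes "imag u"
  shows "x \<bullet> wd u C y = (-1) ^ length C * (wd u (rev C) x \<bullet> y)"
  using wd_inner[OF assms, of "rev C" x y] by (simp flip: mult.assoc power_add)

lemma wd_upd_split:
  assumes "distinct (C @ d # D)"
  shows "wd (u(d := v)) (C @ d # D) y = wd u C (v \<odot> wd u D y)"
  using assms by simp

text \<open>
  A bracket contracted with each basic function.  An inner product renames the contracted letter; two
  brackets give \<open>phi\<close> and products of brackets; a bracket and \<open>phi\<close> are covered by
  \<open>bracket_phi_formula\<close>; a determinant times an operator is an alternated word, so that the
  contraction takes place within a single word.
\<close>

lemma contr_bracket_generator:
  assumes "generator J K f" "d \<in> J" "distinct (A @ B)" "(set A \<union> set B) \<inter> J = {}" "k \<noteq> l" "{k, l} \<inter> K = {}"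
  shows "spanned (set A \<union> set B \<union> (J - {d})) ({k, l} \<union> K)
    (\<lambda>u x. \<Sum>a\<in>I7. (wd u A (x k) \<bullet> (oct_e a \<odot> wd u B (x l))) * f (u(d := oct_e a)) x)"
  using assms
proof (induction rule: generator.induct)
  case (inner_u j1 j2)
  define c where "c = (if d = j1 then j2 else j1)"
  have c: "{j1, j2} - {d} = {c}" "c \<noteq> d" "c \<notin> set A \<union> set B" "{j1, j2} = {c, d}"
    using inner_u by (auto simp: c_def)
  have "spanned (set A \<union> set (c # B)) {k, l} (\<lambda>u x. wd u A (x k) \<bullet> wd u (c # B) (x l))"
    by (rule spanned_bracket_words) (use inner_u c in auto)
  then have "spanned (set A \<union> set B \<union> ({j1, j2} - {d})) ({k, l} \<union> {}) (\<lambda>u x. wd u A (x k) \<bullet> wd u (c # B) (x l))"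
    by (rule spanned_sets) (use c in auto)
  then show ?case
  proof (rule spanned.cong)
    fix u x :: "nat \<Rightarrow> octonion" assume u: "imag u"
    have "(u(d := v)) j1 \<bullet> (u(d := v)) j2 = u c \<bullet> v" for v
      using c(2) inner_u(1,2) by (auto simp: c_def inner_commute)
    then show "wd u A (x k) \<bullet> wd u (c # B) (x l)
      = (\<Sum>a\<in>I7. (wd u A (x k) \<bullet> (oct_e a \<odot> wd u B (x l))) * ((u(d := oct_e a)) j1 \<bullet> (u(d := oct_e a)) j2))"
      using sum_I7_inner[OF imagD[OF u, of c], of "wd u A (x k)" "wd u B (x l)"] by (simp add: mult.commute)
  qed
next
  case (det_u js)
  then have js: "distinct js" "length js = 7" by (simp_all add: strict_sorted_iff)
  have one: "spanned (set A \<union> set B \<union> (set js - {d})) ({k, l} \<union> {})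
     (\<lambda>u x. \<Sum>a\<in>I7. wd u A (x k) \<bullet> wd (u(d := oct_e a)) (map p js) (oct_e a \<odot> wd u B (x l)))"
    if p: "p permutes set js" for p
  proof -
    have m: "distinct (map p js)" "set (map p js) = set js"
      using js(1) p by (auto simp: distinct_map permutes_image intro: permutes_inj_on)
    then obtain P Q where PQ: "map p js = P @ d # Q" using det_u(3) by (metis split_list)
    have d: "distinct (P @ d # Q)" "set P \<union> set Q = set js - {d}" using m unfolding PQ by auto
    have "spanned (set (rev A @ P) \<union> set Q \<union> set B) {k, l}
      (\<lambda>u x. \<Sum>a\<in>I7. x k \<bullet> wd u (rev A @ P) (oct_e a \<odot> wd u Q (oct_e a \<odot> wd u B (x l))))"
      by (rule spanned_sandwich) (use d det_u in auto)
    from spanned_scale[OF this, of "(-1) ^ length A"]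
    have "spanned (set A \<union> set B \<union> (set js - {d})) ({k, l} \<union> {})
      (\<lambda>u x. (-1) ^ length A * (\<Sum>a\<in>I7. x k \<bullet> wd u (rev A @ P) (oct_e a \<odot> wd u Q (oct_e a \<odot> wd u B (x l)))))"
      by (rule spanned_sets) (use d in auto)
    then show ?thesis
      by (rule spanned.cong) (unfold PQ wd_upd_split[OF d(1)], simp only: sum_distrib_left wd_inner wd_append)
  qed
  have "spanned (set A \<union> set B \<union> (set js - {d})) ({k, l} \<union> {})
     (\<lambda>u x. - 1 / fact 7 * (\<Sum>p | p permutes set js. of_int (sign p) *
       (\<Sum>a\<in>I7. wd u A (x k) \<bullet> wd (u(d := oct_e a)) (map p js) (oct_e a \<odot> wd u B (x l)))))"
    by (intro spanned_scale spanned_sum one) simp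
  then show ?case
  proof (rule spanned.cong)
    fix u x :: "nat \<Rightarrow> octonion" assume u: "imag u"
    let ?X = "wd u A (x k)" and ?Y = "wd u B (x l)"
    have "(\<Sum>p | p permutes set js. of_int (sign p) * (\<Sum>a\<in>I7. ?X \<bullet> wd (u(d := oct_e a)) (map p js) (oct_e a \<odot> ?Y)))
      = (\<Sum>a\<in>I7. \<Sum>p | p permutes set js. of_int (sign p) * (?X \<bullet> wd (u(d := oct_e a)) (map p js) (oct_e a \<odot> ?Y)))"
      unfolding sum_distrib_left by (rule sum.swap)
    also have "\<dots> = (\<Sum>a\<in>I7. - fact 7 * det_Im (map (u(d := oct_e a)) js) * (?X \<bullet> (oct_e a \<odot> ?Y)))"
      by (rule sum.cong[OF refl]) (rule alternated_word[OF js imag_upd[OF u oct_e_Im]])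
    also have "\<dots> = - fact 7 * (\<Sum>a\<in>I7. (?X \<bullet> (oct_e a \<odot> ?Y)) * det_Im (map (u(d := oct_e a)) js))"
      unfolding sum_distrib_left by (rule sum.cong) simp_all
    finally show "- 1 / fact 7 * (\<Sum>p | p permutes set js. of_int (sign p) * (\<Sum>a\<in>I7. ?X \<bullet> wd (u(d := oct_e a)) (map p js) (oct_e a \<odot> ?Y)))
      = (\<Sum>a\<in>I7. (?X \<bullet> (oct_e a \<odot> ?Y)) * det_Im (map (u(d := oct_e a)) js))"
      by simp
  qed
next
  case (inner_x js k1 k2)
  obtain C D where js: "js = C @ d # D" using inner_x(4) by (meson split_list)
  have d: "distinct (C @ d # D)" using inner_x(1) by (simp add: strict_sorted_iff js)
  have sides: "distinct (A @ B @ rev C @ D)" "distinct [k, l, k1, k2]" using inner_x d by (auto simp: js)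
  have J: "set A \<union> set B \<union> (set js - {d}) = set A \<union> set B \<union> set C \<union> set D" using d by (auto simp: js)
  have 1: "spanned (set A \<union> set B \<union> (set js - {d})) ({k, l} \<union> {k1, k2})
      (\<lambda>u x. (wd u B (x l) \<bullet> wd u D (x k2)) * (wd u A (x k) \<bullet> wd u (rev C) (x k1)))"
    by (rule spanned_two_brackets) (use sides J in auto)
  have 2: "spanned (set A \<union> set B \<union> (set js - {d})) ({k, l} \<union> {k1, k2})
      (\<lambda>u x. (wd u A (x k) \<bullet> wd u D (x k2)) * (wd u (rev C) (x k1) \<bullet> wd u B (x l)))"
    by (rule spanned_two_brackets) (use sides J in auto)
  have 3: "spanned (set A \<union> set B \<union> (set js - {d})) ({k, l} \<union> {k1, k2})
      (\<lambda>u x. phi (wd u A (x k)) (wd u (rev C) (x k1)) (wd u B (x l)) (wd u D (x k2)))"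
    by (rule spanned_phi_words) (use sides J in auto)
  from spanned_scale[OF spanned_add[OF spanned_diff[OF 1 2] 3], of "(-1) ^ length C"]
  show ?case
  proof (rule spanned.cong)
    fix u x :: "nat \<Rightarrow> octonion" assume u: "imag u"
    have "x k1 \<bullet> wd (u(d := oct_e a)) js (x k2) = (-1) ^ length C * (wd u (rev C) (x k1) \<bullet> (oct_e a \<odot> wd u D (x k2)))" for a
      unfolding js wd_upd_split[OF d] by (rule wd_split_inner[OF u])
    then have "x k1 \<bullet> foldr (\<lambda>j. (\<odot>) ((u(d := oct_e a)) j)) js (x k2)
        = (-1) ^ length C * (wd u (rev C) (x k1) \<bullet> (oct_e a \<odot> wd u D (x k2)))" for a
      using wd_def[of "u(d := oct_e a)" js "x k2"] by metis
    then show "(-1) ^ length C * ((wd u B (x l) \<bullet> wd u D (x k2)) * (wd u A (x k) \<bullet> wd u (rev C) (x k1))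
        - (wd u A (x k) \<bullet> wd u D (x k2)) * (wd u (rev C) (x k1) \<bullet> wd u B (x l))
        + phi (wd u A (x k)) (wd u (rev C) (x k1)) (wd u B (x l)) (wd u D (x k2)))
      = (\<Sum>a\<in>I7. (wd u A (x k) \<bullet> (oct_e a \<odot> wd u B (x l))) * (x k1 \<bullet> foldr (\<lambda>j. (\<odot>) ((u(d := oct_e a)) j)) js (x k2)))"
      unfolding sum_brackets[symmetric] sum_distrib_left by (simp only: mult_ac)
  qed
next
  case (Cayley k1 k2 k3 k4)
  then show ?case by simp
next
  case (Cayley_u k1 k2 k3 k4 j)
  have "spanned (set A \<union> set B \<union> ({j} - {d})) ({k, l} \<union> {k1, k2, k3, k4})
    (\<lambda>u x. bracket_phi (wd u A (x k)) (wd u B (x l)) (wd u [] (x k1)) (wd u [] (x k2)) (wd u [] (x k3)) (wd u [] (x k4)))"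
    by (rule spanned_bracket_phi_words) (use Cayley_u in auto)
  from spanned_neg[OF this] show ?case
    by (rule spanned.cong) (use Cayley_u(4) in \<open>simp add: bracket_phi_def Cayley_form_phi sum_negf\<close>)
qed

lemma gen_product_dep: "gen_product J K p \<Longrightarrow> j \<notin> J \<Longrightarrow> p (u(j := v)) x = p u x"
  using gen_product_mlinear by (intro depends_onD[of J K]) auto

lemma generator_dep: "generator J K p \<Longrightarrow> j \<notin> J \<Longrightarrow> p (u(j := v)) x = p u x"
  using generator_mlinear by (intro depends_onD[of J K]) auto

lemma contr_bracket:
  assumes "gen_product J K p" "d \<in> J" "distinct (A @ B)" "(set A \<union> set B) \<inter> J = {}" "k \<noteq> l" "{k, l} \<inter> K = {}"
  shows "spanned (set A \<union> set B \<union> (J - {d})) ({k, l} \<union> K)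
    (\<lambda>u x. \<Sum>a\<in>I7. (wd u A (x k) \<bullet> (oct_e a \<odot> wd u B (x l))) * p (u(d := oct_e a)) x)"
  using assms
proof (induction rule: gen_product.induct)
  case empty
  then show ?case by simp
next
  case (times J1 K1 f J2 K2 p)
  show ?case
  proof (cases "d \<in> J1")
    case True
    then have d2: "d \<notin> J2" using times.hyps by auto
    have "spanned (set A \<union> set B \<union> (J1 - {d})) ({k, l} \<union> K1)
      (\<lambda>u x. \<Sum>a\<in>I7. (wd u A (x k) \<bullet> (oct_e a \<odot> wd u B (x l))) * f (u(d := oct_e a)) x)"
      by (rule contr_bracket_generator[OF times.hyps(1) True]) (use times.prems in auto)
    from spanned_mult[OF this spanned_gen[OF times.hyps(2)]]
    have "spanned (set A \<union> set B \<union> (J1 - {d}) \<union> J2) ({k, l} \<union> K1 \<union> K2)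
      (\<lambda>u x. (\<Sum>a\<in>I7. (wd u A (x k) \<bullet> (oct_e a \<odot> wd u B (x l))) * f (u(d := oct_e a)) x) * p u x)"
      using times.prems times.hyps by blast
    then have "spanned (set A \<union> set B \<union> (J1 \<union> J2 - {d})) ({k, l} \<union> (K1 \<union> K2))
      (\<lambda>u x. (\<Sum>a\<in>I7. (wd u A (x k) \<bullet> (oct_e a \<odot> wd u B (x l))) * f (u(d := oct_e a)) x) * p u x)"
      by (rule spanned_sets) (use d2 in auto)
    then show ?thesis
      by (rule spanned.cong) (simp only: gen_product_dep[OF times.hyps(2) d2] sum_distrib_right mult.assoc)
  next
    case False
    then have d2: "d \<in> J2" using times.prems by auto
    have "spanned (set A \<union> set B \<union> (J2 - {d})) ({k, l} \<union> K2)
      (\<lambda>u x. \<Sum>a\<in>I7. (wd u A (x k) \<bullet> (oct_e a \<odot> wd u B (x l))) * p (u(d := oct_e a)) x)"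
      by (rule times.IH[OF d2]) (use times.prems in auto)
    from spanned_mult[OF spanned_generator[OF times.hyps(1)] this]
    have "spanned (J1 \<union> (set A \<union> set B \<union> (J2 - {d}))) (K1 \<union> ({k, l} \<union> K2))
      (\<lambda>u x. f u x * (\<Sum>a\<in>I7. (wd u A (x k) \<bullet> (oct_e a \<odot> wd u B (x l))) * p (u(d := oct_e a)) x))"
      using times.prems times.hyps by blast
    then have "spanned (set A \<union> set B \<union> (J1 \<union> J2 - {d})) ({k, l} \<union> (K1 \<union> K2))
      (\<lambda>u x. f u x * (\<Sum>a\<in>I7. (wd u A (x k) \<bullet> (oct_e a \<odot> wd u B (x l))) * p (u(d := oct_e a)) x))"
      by (rule spanned_sets) (use False in auto)
    then show ?thesis
      by (rule spanned.cong) (simp only: generator_dep[OF times.hyps(1) False] sum_distrib_left mult.left_commute)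
  qed
qed

lemma contr_bracket_spanned:
  assumes "spanned J K p" "d \<in> J" "distinct (A @ B)" "(set A \<union> set B) \<inter> J = {}" "k \<noteq> l" "{k, l} \<inter> K = {}"
  shows "spanned (set A \<union> set B \<union> (J - {d})) ({k, l} \<union> K)
    (\<lambda>u x. \<Sum>a\<in>I7. (wd u A (x k) \<bullet> (oct_e a \<odot> wd u B (x l))) * p (u(d := oct_e a)) x)"
proof (rule spanned_lift[where T = "\<lambda>p u x. \<Sum>a\<in>I7. (wd u A (x k) \<bullet> (oct_e a \<odot> wd u B (x l))) * p (u(d := oct_e a)) x", OF assms(1)])
  fix f g :: tuple_fun and u x assume "\<And>u x. imag u \<Longrightarrow> f u x = g u x" "imag u"
  then show "(\<Sum>a\<in>I7. (wd u A (x k) \<bullet> (oct_e a \<odot> wd u B (x l))) * f (u(d := oct_e a)) x)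
    = (\<Sum>a\<in>I7. (wd u A (x k) \<bullet> (oct_e a \<odot> wd u B (x l))) * g (u(d := oct_e a)) x)"
    by (intro sum.cong) auto
qed (use contr_bracket[OF _ assms(2-6)] in \<open>auto simp: distrib_left sum.distrib sum_distrib_left mult_ac\<close>)

lemma fun_upd_as_comp: "u(d := u c) = u \<circ> id(d := c)"
  by (auto simp: fun_eq_iff)

lemma inj_on_id_upd: "c \<notin> J \<Longrightarrow> inj_on (id(d := c)) J"
  by (auto simp: inj_on_def)

lemma image_id_upd: "d \<in> J \<Longrightarrow> id(d := c) ` J = insert c (J - {d})"
  by (auto simp: image_def)

lemma subst_generator:
  assumes "generator J K f" "d \<in> J" "c \<notin> J"
  shows "spanned (insert c (J - {d})) K (\<lambda>u x. f (u(d := u c)) x)"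
  using assms
proof (induction rule: generator.induct)
  case (inner_u j1 j2)
  let ?r = "id(d := c)"
  have "spanned {?r j1, ?r j2} {} (\<lambda>u x. u (?r j1) \<bullet> u (?r j2))"
    by (rule spanned_inner_u) (use inner_u in auto)
  moreover have "{?r j1, ?r j2} = insert c ({j1, j2} - {d})" using inner_u by auto
  ultimately show ?case unfolding fun_upd_as_comp by simp
next
  case (det_u js)
  have js: "distinct js" using det_u by (simp add: strict_sorted_iff)
  have "spanned (set (map (id(d := c)) js)) {} (\<lambda>u x. det_Im (map u (map (id(d := c)) js)))"
    by (rule spanned_det) (use det_u js inj_on_id_upd in \<open>auto simp: distinct_map\<close>)
  then show ?case unfolding fun_upd_as_comp set_map image_id_upd[OF det_u(3)] by (simp only: map_map)
next
  case (inner_x js k1 k2)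
  have js: "distinct js" using inner_x by (simp add: strict_sorted_iff)
  have "spanned (set (map (id(d := c)) js)) {k1, k2} (\<lambda>u x. x k1 \<bullet> wd u (map (id(d := c)) js) (x k2))"
    by (rule spanned_bracket) (use inner_x js inj_on_id_upd in \<open>auto simp: distinct_map\<close>)
  then show ?case unfolding fun_upd_as_comp set_map image_id_upd[OF inner_x(4)] wd_def[symmetric] wd_comp .
next
  case (Cayley k1 k2 k3 k4)
  then show ?case by simp
next
  case (Cayley_u k1 k2 k3 k4 j)
  from spanned_generator[OF generator.Cayley_u[OF Cayley_u(1-3), of c]]
  show ?case using Cayley_u(4) by simp
qed

text \<open>
  Renaming one vector variable may destroy the order of the indices, but unsorted basic functions
  still lie in the span.
\<close>

lemma subst_gen_product:
  assumes "gen_product J K p" "d \<in> J" "c \<notin> J"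
  shows "spanned (insert c (J - {d})) K (\<lambda>u x. p (u(d := u c)) x)"
  using assms
proof (induction rule: gen_product.induct)
  case empty
  then show ?case by simp
next
  case (times J1 K1 f J2 K2 p)
  show ?case
  proof (cases "d \<in> J1")
    case True
    then have d2: "d \<notin> J2" using times.hyps by auto
    have "spanned (insert c (J1 - {d}) \<union> J2) (K1 \<union> K2) (\<lambda>u x. f (u(d := u c)) x * p u x)"
      by (rule spanned_mult[OF subst_generator[OF times.hyps(1) True] spanned_gen[OF times.hyps(2)]]) (use times in auto)
    then have "spanned (insert c (J1 \<union> J2 - {d})) (K1 \<union> K2) (\<lambda>u x. f (u(d := u c)) x * p u x)"
      by (rule spanned_sets) (use d2 in auto)
    then show ?thesis by (simp only: gen_product_dep[OF times.hyps(2) d2])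
  next
    case False
    then have d2: "d \<in> J2" using times.prems by auto
    have "spanned (J1 \<union> insert c (J2 - {d})) (K1 \<union> K2) (\<lambda>u x. f u x * p (u(d := u c)) x)"
      by (rule spanned_mult[OF spanned_generator[OF times.hyps(1)] times.IH[OF d2]]) (use times in auto)
    then have "spanned (insert c (J1 \<union> J2 - {d})) (K1 \<union> K2) (\<lambda>u x. f u x * p (u(d := u c)) x)"
      by (rule spanned_sets) (use False in auto)
    then show ?thesis by (simp only: generator_dep[OF times.hyps(1) False])
  qed
qed

definition cross_contr :: "nat \<Rightarrow> nat \<Rightarrow> tuple_fun \<Rightarrow> tuple_fun \<Rightarrow> tuple_fun" where
  "cross_contr c d f p u x = (\<Sum>a\<in>I7. f (u(c := oct_e a)) x * p (u(d := oct_e a)) x)"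

text \<open>
  The contraction of a basic function with a product.  If the basic function is \<open>phi\<close> with a letter
  inside, it is itself rewritten as a contraction of two brackets over a fresh letter, so that the
  contraction of brackets is applied twice.
\<close>

lemma cross_contr_nondet:
  assumes "generator J1 K1 f" "gen_product J2 K2 p" "c \<in> J1" "d \<in> J2" "J1 \<inter> J2 = {}" "K1 \<inter> K2 = {}"
  shows "spanned ((J1 - {c}) \<union> (J2 - {d})) (K1 \<union> K2) (cross_contr c d f p)
    \<or> (\<exists>js. distinct js \<and> length js = 7 \<and> J1 = set js \<and> K1 = {} \<and> f = (\<lambda>u x. det_Im (map u js)))"
  using assms
proof (induction rule: generator.induct)
  case (inner_u j1 j2)
  define e where "e = (if c = j1 then j2 else j1)"
  have e: "{j1, j2} - {c} = {e}" "e \<noteq> c" "{j1, j2} = {e, c}"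
    using inner_u by (auto simp: e_def)
  then have "e \<notin> J2" using inner_u by auto
  have "spanned (insert e (J2 - {d})) K2 (\<lambda>u x. p (u(d := u e)) x)"
    by (rule subst_gen_product[OF inner_u(2) inner_u(4) \<open>e \<notin> J2\<close>])
  then have "spanned (({j1, j2} - {c}) \<union> (J2 - {d})) ({} \<union> K2) (\<lambda>u x. p (u(d := u e)) x)"
    by (rule spanned_sets) (use e in auto)
  then have "spanned (({j1, j2} - {c}) \<union> (J2 - {d})) ({} \<union> K2) (cross_contr c d (\<lambda>u x. u j1 \<bullet> u j2) p)"
  proof (rule spanned.cong)
    fix u x :: "nat \<Rightarrow> octonion" assume u: "imag u"
    have "(u(c := v)) j1 \<bullet> (u(c := v)) j2 = u e \<bullet> v" for v
      using e(2) inner_u(1,3) by (auto simp: e_def inner_commute)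
    moreover have "lin_at d (\<lambda>u. p u x)"
      using invarD(4)[OF invar_gen_product[OF inner_u(2)] inner_u(4)] .
    ultimately show "p (u(d := u e)) x = cross_contr c d (\<lambda>u x. u j1 \<bullet> u j2) p u x"
      using lin_atD[of d "\<lambda>u. p u x" u "u e"] u by (simp add: cross_contr_def)
  qed
  then show ?case by blast
next
  case (det_u js)
  then show ?case by (auto simp: strict_sorted_iff)
next
  case (inner_x js k1 k2)
  obtain C D where js: "js = C @ c # D" using inner_x(5) by (meson split_list)
  have dist: "distinct (C @ c # D)" using inner_x(1) by (simp add: strict_sorted_iff js)
  have "spanned (set (rev C) \<union> set D \<union> (J2 - {d})) ({k1, k2} \<union> K2)
    (\<lambda>u x. \<Sum>a\<in>I7. (wd u (rev C) (x k1) \<bullet> (oct_e a \<odot> wd u D (x k2))) * p (u(d := oct_e a)) x)"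
    by (rule contr_bracket[OF inner_x(4) inner_x(6)]) (use inner_x dist in \<open>auto simp: js\<close>)
  from spanned_scale[OF this, of "(-1) ^ length C"]
  have "spanned ((set js - {c}) \<union> (J2 - {d})) ({k1, k2} \<union> K2)
    (\<lambda>u x. (-1) ^ length C * (\<Sum>a\<in>I7. (wd u (rev C) (x k1) \<bullet> (oct_e a \<odot> wd u D (x k2))) * p (u(d := oct_e a)) x))"
    by (rule spanned_sets) (use dist in \<open>auto simp: js\<close>)
  then have "spanned ((set js - {c}) \<union> (J2 - {d})) ({k1, k2} \<union> K2) (cross_contr c d (\<lambda>u x. x k1 \<bullet> foldr (\<lambda>j y. u j \<odot> y) js (x k2)) p)"
  proof (rule spanned.cong)
    fix u x :: "nat \<Rightarrow> octonion" assume u: "imag u"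
    have "x k1 \<bullet> wd (u(c := oct_e a)) js (x k2) = (-1) ^ length C * (wd u (rev C) (x k1) \<bullet> (oct_e a \<odot> wd u D (x k2)))" for a
      unfolding js wd_upd_split[OF dist] by (rule wd_split_inner[OF u])
    then show "(-1) ^ length C * (\<Sum>a\<in>I7. (wd u (rev C) (x k1) \<bullet> (oct_e a \<odot> wd u D (x k2))) * p (u(d := oct_e a)) x)
       = cross_contr c d (\<lambda>u x. x k1 \<bullet> foldr (\<lambda>j y. u j \<odot> y) js (x k2)) p u x"
      unfolding cross_contr_def wd_def[symmetric] sum_distrib_left by (simp add: mult.assoc)
  qed
  then show ?case by blast
next
  case (Cayley k1 k2 k3 k4)
  then show ?case by simp
next
  case (Cayley_u k1 k2 k3 k4 j)
  have cj: "c = j" using Cayley_u(5) by simp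
  have ks: "distinct [k1, k2, k3, k4]" "{k1, k2, k3, k4} \<inter> K2 = {}" using Cayley_u by auto
  note p = Cayley_u(4) and d = Cayley_u(6)
  have "infinite (UNIV :: nat set)" "finite J2" using finite_gen_product[OF p] by simp_all
  then obtain b where b: "b \<notin> J2" using ex_new_if_finite by blast
  define R where "R u x = (\<Sum>a\<in>I7. (wd u [b] (x k3) \<bullet> (oct_e a \<odot> wd u [] (x k1))) * p (u(d := oct_e a)) x)" for u x
  have "spanned (set [b] \<union> set [] \<union> (J2 - {d})) ({k3, k1} \<union> K2) R"
    unfolding R_def[abs_def] by (rule contr_bracket[OF p d]) (use b ks in auto)
  then have "spanned (insert b (J2 - {d})) ({k3, k1} \<union> K2) R" by simp
  note R = this
  have "spanned (set [] \<union> set [] \<union> (insert b (J2 - {d}) - {b})) ({k2, k4} \<union> ({k3, k1} \<union> K2))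
     (\<lambda>u x. \<Sum>e\<in>I7. (wd u [] (x k2) \<bullet> (oct_e e \<odot> wd u [] (x k4))) * R (u(b := oct_e e)) x)"
    by (rule contr_bracket_spanned[OF R]) (use ks in auto)
  then have 1: "spanned (J2 - {d}) ({k1, k2, k3, k4} \<union> K2)
     (\<lambda>u x. \<Sum>e\<in>I7. (wd u [] (x k2) \<bullet> (oct_e e \<odot> wd u [] (x k4))) * R (u(b := oct_e e)) x)"
    by (rule spanned_sets) (use b in auto)
  have br: "spanned (J2 - {d}) ({k, k1} \<union> K2) (\<lambda>u x. \<Sum>a\<in>I7. (wd u [] (x k) \<bullet> (oct_e a \<odot> wd u [] (x k1))) * p (u(d := oct_e a)) x)"
    if "k \<in> {k2, k4}" for k
    by (rule spanned_sets[OF contr_bracket[OF p d, of "[]" "[]" k k1]]) (use ks that in auto)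
  have 2: "spanned (J2 - {d}) ({k1, k2, k3, k4} \<union> K2)
     (\<lambda>u x. (wd u [] (x k3) \<bullet> wd u [] (x k4)) * (\<Sum>a\<in>I7. (wd u [] (x k2) \<bullet> (oct_e a \<odot> wd u [] (x k1))) * p (u(d := oct_e a)) x))"
    by (rule spanned_bracket_mult[OF _ _ br]) (use ks in auto)
  have 3: "spanned (J2 - {d}) ({k1, k2, k3, k4} \<union> K2)
     (\<lambda>u x. (wd u [] (x k2) \<bullet> wd u [] (x k3)) * (\<Sum>a\<in>I7. (wd u [] (x k4) \<bullet> (oct_e a \<odot> wd u [] (x k1))) * p (u(d := oct_e a)) x))"
    by (rule spanned_bracket_mult[OF _ _ br]) (use ks in auto)
  have "spanned (J2 - {d}) ({k1, k2, k3, k4} \<union> K2) (cross_contr c d (\<lambda>u x. Cayley_form (u j \<odot> x k1) (x k2) (x k3) (x k4)) p)"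
  proof (rule spanned.cong[OF spanned_neg[OF spanned_add[OF spanned_diff[OF 1 2] 3]]])
    fix u x :: "nat \<Rightarrow> octonion"
    have pb: "p (u(b := v, d := w)) x = p (u(d := w)) x" for v w
    proof -
      have "u(b := v, d := w) = (u(d := w))(b := v)" by (rule fun_upd_twist) (use b d in auto)
      then show ?thesis by (simp only: gen_product_dep[OF p b])
    qed
    let ?p = "\<lambda>a. p (u(d := oct_e a)) x"
    have "(\<Sum>e\<in>I7. (x k2 \<bullet> (oct_e e \<odot> x k4)) * R (u(b := oct_e e)) x)
       = (\<Sum>e\<in>I7. \<Sum>a\<in>I7. (((oct_e a \<odot> x k1) \<bullet> (oct_e e \<odot> x k3)) * (x k2 \<bullet> (oct_e e \<odot> x k4))) * ?p a)"
      unfolding R_def sum_distrib_left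
      by (intro sum.cong refl) (simp add: pb inner_commute[of "oct_e _ \<odot> x k3"] mult_ac)
    also have "\<dots> = (\<Sum>a\<in>I7. (\<Sum>e\<in>I7. ((oct_e a \<odot> x k1) \<bullet> (oct_e e \<odot> x k3)) * (x k2 \<bullet> (oct_e e \<odot> x k4))) * ?p a)"
      unfolding sum_distrib_right by (rule sum.swap)
    finally have R: "(\<Sum>e\<in>I7. (x k2 \<bullet> (oct_e e \<odot> x k4)) * R (u(b := oct_e e)) x) = \<dots>" .
    have "cross_contr c d (\<lambda>u x. Cayley_form (u j \<odot> x k1) (x k2) (x k3) (x k4)) p u x
       = (\<Sum>a\<in>I7. - ((\<Sum>e\<in>I7. ((oct_e a \<odot> x k1) \<bullet> (oct_e e \<odot> x k3)) * (x k2 \<bullet> (oct_e e \<odot> x k4))) * ?p a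
           - (x k3 \<bullet> x k4) * ((x k2 \<bullet> (oct_e a \<odot> x k1)) * ?p a) + (x k2 \<bullet> x k3) * ((x k4 \<bullet> (oct_e a \<odot> x k1)) * ?p a)))"
      unfolding cross_contr_def cj Cayley_form_phi phi_def
      by (intro sum.cong refl) (simp only: fun_upd_same inner_commute[of "oct_e _ \<odot> x k1" "x k2"]
          inner_commute[of "oct_e _ \<odot> x k1" "x k4"], simp add: algebra_simps)
    also have "\<dots> = - ((\<Sum>e\<in>I7. (x k2 \<bullet> (oct_e e \<odot> x k4)) * R (u(b := oct_e e)) x)
        - (x k3 \<bullet> x k4) * (\<Sum>a\<in>I7. (x k2 \<bullet> (oct_e a \<odot> x k1)) * ?p a)
        + (x k2 \<bullet> x k3) * (\<Sum>a\<in>I7. (x k4 \<bullet> (oct_e a \<odot> x k1)) * ?p a))"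
      unfolding R sum_negf sum.distrib sum_subtractf sum_distrib_left[symmetric] ..
    finally show "- ((\<Sum>e\<in>I7. (wd u [] (x k2) \<bullet> (oct_e e \<odot> wd u [] (x k4))) * R (u(b := oct_e e)) x)
        - (wd u [] (x k3) \<bullet> wd u [] (x k4)) * (\<Sum>a\<in>I7. (wd u [] (x k2) \<bullet> (oct_e a \<odot> wd u [] (x k1))) * ?p a)
        + (wd u [] (x k2) \<bullet> wd u [] (x k3)) * (\<Sum>a\<in>I7. (wd u [] (x k4) \<bullet> (oct_e a \<odot> wd u [] (x k1))) * ?p a))
      = cross_contr c d (\<lambda>u x. Cayley_form (u j \<odot> x k1) (x k2) (x k3) (x k4)) p u x"
      by simp
  qed
  then show ?case using cj by simp
qed

lemma cross_contr_commute: "cross_contr c d f p = cross_contr d c p f"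
  by (intro ext) (simp add: cross_contr_def mult.commute)

lemma cross_contr_mult_right:
  assumes "generator J1 K1 g" "gen_product J2 K2 p" "J1 \<inter> J2 = {}"
  shows "d \<in> J1 \<Longrightarrow> cross_contr c d f (\<lambda>u x. g u x * p u x) u x = cross_contr c d f g u x * p u x"
    and "d \<in> J2 \<Longrightarrow> cross_contr c d f (\<lambda>u x. g u x * p u x) u x = g u x * cross_contr c d f p u x"
proof -
  assume "d \<in> J1" then have "d \<notin> J2" using assms by auto
  then show "cross_contr c d f (\<lambda>u x. g u x * p u x) u x = cross_contr c d f g u x * p u x"
    unfolding cross_contr_def sum_distrib_right gen_product_dep[OF assms(2) \<open>d \<notin> J2\<close>] by (simp add: mult.assoc)
next
  assume "d \<in> J2" then have "d \<notin> J1" using assms by auto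
  then show "cross_contr c d f (\<lambda>u x. g u x * p u x) u x = g u x * cross_contr c d f p u x"
    unfolding cross_contr_def sum_distrib_left generator_dep[OF assms(1) \<open>d \<notin> J1\<close>] by (simp add: mult.left_commute)
qed

text \<open>
  Two contracted determinants form an invariant of vectors alone, so the vector case of the
  theorem applies.
\<close>

lemma cross_contr_det_det:
  assumes "generator (set js) {} (\<lambda>u x. det_Im (map u js))" "generator (set ks) {} (\<lambda>u x. det_Im (map u ks))"
    and "c \<in> set js" "d \<in> set ks" "set js \<inter> set ks = {}"
  shows "spanned ((set js - {c}) \<union> (set ks - {d})) {} (cross_contr c d (\<lambda>u x. det_Im (map u js)) (\<lambda>u x. det_Im (map u ks)))"
proof -
  have "gen_product (set js \<union> (set ks \<union> {})) ({} \<union> ({} \<union> {})) (\<lambda>u x. det_Im (map u js) * (det_Im (map u ks) * 1))"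
    by (intro gen_product.times gen_product.empty assms) (use assms in auto)
  then have I: "invar (set js \<union> set ks) {} (\<lambda>u x. det_Im (map u js) * det_Im (map u ks))"
    using invar_gen_product by simp
  have cd: "c \<noteq> d" "c \<notin> set ks" "d \<notin> set js" using assms by auto
  have "invar ((set js \<union> set ks) - {c, d}) {} (contr c d (\<lambda>u x. det_Im (map u js) * det_Im (map u ks)))"
    by (rule contr_invar[OF I]) (use assms cd in auto)
  from FFT_vectors[OF this]
  have "spanned ((set js - {c}) \<union> (set ks - {d})) {} (contr c d (\<lambda>u x. det_Im (map u js) * det_Im (map u ks)))"
    by (rule spanned_sets) (use cd in auto)
  moreover have "contr c d (\<lambda>u x. det_Im (map u js) * det_Im (map u ks))
      = cross_contr c d (\<lambda>u x. det_Im (map u js)) (\<lambda>u x. det_Im (map u ks))"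
  proof (intro ext)
    fix u x :: "nat \<Rightarrow> octonion"
    have "map (u(c := v, d := w)) js = map (u(c := v)) js" "map (u(c := v, d := w)) ks = map (u(d := w)) ks" for v w
      using cd by auto
    then show "contr c d (\<lambda>u x. det_Im (map u js) * det_Im (map u ks)) u x
      = cross_contr c d (\<lambda>u x. det_Im (map u js)) (\<lambda>u x. det_Im (map u ks)) u x"
      unfolding contr_def cross_contr_def by (simp only:)
  qed
  ultimately show ?thesis by simp
qed

text \<open>
  If the basic function is a determinant, the roles are exchanged: the factor of the product that
  contains the contracted variable is contracted with the determinant.
\<close>

lemma cross_contr_generator:
  assumes "generator J1 K1 f" "gen_product J2 K2 p" "c \<in> J1" "d \<in> J2" "J1 \<inter> J2 = {}" "K1 \<inter> K2 = {}"
  shows "spanned ((J1 - {c}) \<union> (J2 - {d})) (K1 \<union> K2) (cross_contr c d f p)"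
  using cross_contr_nondet[OF assms]
proof
  assume "\<exists>js. distinct js \<and> length js = 7 \<and> J1 = set js \<and> K1 = {} \<and> f = (\<lambda>u x. det_Im (map u js))"
  then obtain js where js: "distinct js" "length js = 7" "J1 = set js" "K1 = {}" "f = (\<lambda>u x. det_Im (map u js))" by blast
  note f = assms(1)[unfolded js]
  have fp: "gen_product (set js) {} (\<lambda>u x. det_Im (map u js))"
    using gen_product.times[OF f gen_product.empty] by simp
  have "spanned ((set js - {c}) \<union> (J2 - {d})) K2 (cross_contr c d (\<lambda>u x. det_Im (map u js)) p)"
    using assms(2,4,5)
  proof (induction rule: gen_product.induct)
    case empty
    then show ?case by simp
  next
    case (times J3 K3 g J4 K4 p)
    have cjs: "c \<in> set js" using assms(3) js(3) by simp
    show ?case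
    proof (cases "d \<in> J3")
      case True
      then have d4: "d \<notin> J4" using times.hyps by auto
      have "spanned ((J3 - {d}) \<union> (set js - {c})) (K3 \<union> {}) (cross_contr d c g (\<lambda>u x. det_Im (map u js)))
        \<or> (\<exists>js. distinct js \<and> length js = 7 \<and> J3 = set js \<and> K3 = {} \<and> g = (\<lambda>u x. det_Im (map u js)))"
        by (rule cross_contr_nondet[OF times.hyps(1) fp True cjs]) (use times.prems js in auto)
      then have "spanned ((set js - {c}) \<union> (J3 - {d})) K3 (cross_contr c d (\<lambda>u x. det_Im (map u js)) g)"
      proof
        assume "spanned ((J3 - {d}) \<union> (set js - {c})) (K3 \<union> {}) (cross_contr d c g (\<lambda>u x. det_Im (map u js)))"
        then show ?thesis by (simp add: cross_contr_commute[of c d] Un_commute)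
      next
        assume "\<exists>js. distinct js \<and> length js = 7 \<and> J3 = set js \<and> K3 = {} \<and> g = (\<lambda>u x. det_Im (map u js))"
        then obtain ks where ks: "J3 = set ks" "K3 = {}" "g = (\<lambda>u x. det_Im (map u ks))" by blast
        show ?thesis unfolding ks
          by (rule cross_contr_det_det[OF f times.hyps(1)[unfolded ks] cjs]) (use True ks times.prems js in auto)
      qed
      from spanned_mult[OF this spanned_gen[OF times.hyps(2)]]
      have "spanned ((set js - {c}) \<union> (J3 - {d}) \<union> J4) (K3 \<union> K4) (\<lambda>u x. cross_contr c d (\<lambda>u x. det_Im (map u js)) g u x * p u x)"
        using times.prems times.hyps js by blast
      then have "spanned ((set js - {c}) \<union> (J3 \<union> J4 - {d})) (K3 \<union> K4) (\<lambda>u x. cross_contr c d (\<lambda>u x. det_Im (map u js)) g u x * p u x)"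
        by (rule spanned_sets) (use d4 in auto)
      then show ?thesis
        by (rule spanned.cong) (simp only: cross_contr_mult_right(1)[OF times.hyps(1,2) times.hyps(3) True])
    next
      case False
      then have d4: "d \<in> J4" using times.prems by auto
      have "spanned ((set js - {c}) \<union> (J4 - {d})) K4 (cross_contr c d (\<lambda>u x. det_Im (map u js)) p)"
        by (rule times.IH[OF d4]) (use times.prems in auto)
      from spanned_mult[OF spanned_generator[OF times.hyps(1)] this]
      have "spanned (J3 \<union> ((set js - {c}) \<union> (J4 - {d}))) (K3 \<union> K4) (\<lambda>u x. g u x * cross_contr c d (\<lambda>u x. det_Im (map u js)) p u x)"
        using times.prems times.hyps js by blast
      then have "spanned ((set js - {c}) \<union> (J3 \<union> J4 - {d})) (K3 \<union> K4) (\<lambda>u x. g u x * cross_contr c d (\<lambda>u x. det_Im (map u js)) p u x)"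
        by (rule spanned_sets) (use False in auto)
      then show ?thesis
        by (rule spanned.cong) (simp only: cross_contr_mult_right(2)[OF times.hyps(1,2) times.hyps(3) d4])
    qed
  qed
  then show ?thesis unfolding js by simp
qed

lemma contr_commute: "c \<noteq> d \<Longrightarrow> contr c d f = contr d c f"
  by (intro ext) (simp add: contr_def fun_upd_twist)

lemma contr_generator:
  assumes "generator J K f" "c \<in> J" "d \<in> J" "c \<noteq> d"
  shows "spanned (J - {c, d}) K (contr c d f)"
  using assms
proof (induction rule: generator.induct)
  case (inner_u j1 j2)
  have "spanned {} {} (\<lambda>u x. 7)" by (rule spanned_const)
  then have "spanned ({j1, j2} - {c, d}) {} (\<lambda>u x. 7)" by (rule spanned_sets) (use inner_u in auto)
  then show ?case
  proof (rule spanned.cong)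
    fix u x :: "nat \<Rightarrow> octonion"
    have "(u(c := v, d := v)) j1 \<bullet> (u(c := v, d := v)) j2 = v \<bullet> v" for v :: octonion using inner_u by auto
    then show "7 = contr c d (\<lambda>u x. u j1 \<bullet> u j2) u x"
      unfolding contr_def by (simp only:) (simp add: oct_e_coords card_I7)
  qed
next
  case (det_u js)
  then have js: "distinct js" "length js = 7" by (simp_all add: strict_sorted_iff)
  show ?case
  proof (rule spanned.cong[OF spanned.zero])
    fix u x :: "nat \<Rightarrow> octonion" assume u: "imag u"
    have "det_Im (map (u(c := oct_e a, d := oct_e a)) js) = 0" if "a \<in> I7" for a
      by (rule alternating_eq_zero[OF det_Im_alternating[OF js], of _ c d]) (use det_u u that in \<open>auto simp: imag_def\<close>)
    then show "0 = contr c d (\<lambda>u x. det_Im (map u js)) u x" by (simp add: contr_def)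
  qed
next
  case (inner_x js k1 k2)
  have js: "distinct js" using inner_x by (simp add: strict_sorted_iff)
  have main: "spanned (set js - {c, d}) {k1, k2} (contr c d (\<lambda>u x. x k1 \<bullet> foldr (\<lambda>j y. u j \<odot> y) js (x k2)))"
    if s: "js = P @ c # Q @ d # R" for c d P Q R
  proof -
    have "spanned (set P \<union> set Q \<union> set R) {k1, k2}
      (\<lambda>u x. \<Sum>a\<in>I7. x k1 \<bullet> wd u P (oct_e a \<odot> wd u Q (oct_e a \<odot> wd u R (x k2))))"
      by (rule spanned_sandwich) (use js s inner_x in auto)
    then have "spanned (set js - {c, d}) {k1, k2}
      (\<lambda>u x. \<Sum>a\<in>I7. x k1 \<bullet> wd u P (oct_e a \<odot> wd u Q (oct_e a \<odot> wd u R (x k2))))"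
      by (rule spanned_sets) (use js s in auto)
    then show ?thesis
      by (rule spanned.cong) (use js s in \<open>simp add: contr_def wd_def[symmetric]\<close>)
  qed
  obtain P S where PS: "js = P @ c # S" using inner_x(4) by (meson split_list)
  show ?case
  proof (cases "d \<in> set S")
    case True
    then obtain Q R where "S = Q @ d # R" by (meson split_list)
    then show ?thesis using main PS by simp
  next
    case False
    then have "d \<in> set P" using inner_x PS by auto
    then obtain Q R where "P = Q @ d # R" by (meson split_list)
    then have "js = Q @ d # R @ c # S" using PS by simp
    from main[OF this] show ?thesis by (simp add: contr_commute[OF inner_x(6)] insert_commute)
  qed
next
  case (Cayley k1 k2 k3 k4)
  then show ?case by simp
next
  case (Cayley_u k1 k2 k3 k4 j)
  then show ?case by simp
qed

lemma contr_gen_product: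
  assumes "gen_product J K p" "c \<in> J" "d \<in> J" "c \<noteq> d"
  shows "spanned (J - {c, d}) K (contr c d p)"
  using assms
proof (induction rule: gen_product.induct)
  case empty
  then show ?case by simp
next
  case (times J1 K1 f J2 K2 p)
  have f: "f (u(j := v)) x = f u x" if "j \<notin> J1" for u j v x by (rule generator_dep[OF times.hyps(1) that])
  have p: "p (u(j := v)) x = p u x" if "j \<notin> J2" for u j v x by (rule gen_product_dep[OF times.hyps(2) that])
  have mix: "spanned (J1 \<union> J2 - {c, d}) (K1 \<union> K2) (contr c d (\<lambda>u x. f u x * p u x))"
    if cd: "c \<in> J1" "d \<in> J2" for c d
  proof -
    have n: "c \<notin> J2" "d \<notin> J1" "c \<noteq> d" using cd times.hyps by auto
    have "spanned ((J1 - {c}) \<union> (J2 - {d})) (K1 \<union> K2) (cross_contr c d f p)"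
      by (rule cross_contr_generator[OF times.hyps(1,2) cd times.hyps(3,4)])
    then have "spanned (J1 \<union> J2 - {c, d}) (K1 \<union> K2) (cross_contr c d f p)"
      by (rule spanned_sets) (use n in auto)
    moreover have "cross_contr c d f p = contr c d (\<lambda>u x. f u x * p u x)"
    proof (intro ext)
      fix u x :: "nat \<Rightarrow> octonion"
      have "f (u(c := v, d := w)) x = f (u(c := v)) x" for v w by (rule f[OF n(2)])
      moreover have "p (u(c := v, d := w)) x = p (u(d := w)) x" for v w
        unfolding fun_upd_twist[OF n(3), of u] by (rule p[OF n(1)])
      ultimately show "cross_contr c d f p u x = contr c d (\<lambda>u x. f u x * p u x) u x"
        by (simp only: cross_contr_def contr_def)
    qed
    ultimately show ?thesis by simp
  qed
  consider "c \<in> J1" "d \<in> J1" | "c \<in> J2" "d \<in> J2" | "c \<in> J1" "d \<in> J2" | "d \<in> J1" "c \<in> J2"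
    using times.prems by blast
  then show ?case
  proof cases
    case 1
    then have n: "c \<notin> J2" "d \<notin> J2" using times.hyps by auto
    have "spanned ((J1 - {c, d}) \<union> J2) (K1 \<union> K2) (\<lambda>u x. contr c d f u x * p u x)"
      by (rule spanned_mult[OF contr_generator[OF times.hyps(1) 1] spanned_gen[OF times.hyps(2)]]) (use times in auto)
    then have "spanned (J1 \<union> J2 - {c, d}) (K1 \<union> K2) (\<lambda>u x. contr c d f u x * p u x)"
      by (rule spanned_sets) (use n in auto)
    then show ?thesis
      by (rule spanned.cong) (simp add: contr_def p n sum_distrib_right)
  next
    case 2
    then have n: "c \<notin> J1" "d \<notin> J1" using times.hyps by auto
    have "spanned (J1 \<union> (J2 - {c, d})) (K1 \<union> K2) (\<lambda>u x. f u x * contr c d p u x)"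
      by (rule spanned_mult[OF spanned_generator[OF times.hyps(1)] times.IH[OF 2]]) (use times in auto)
    then have "spanned (J1 \<union> J2 - {c, d}) (K1 \<union> K2) (\<lambda>u x. f u x * contr c d p u x)"
      by (rule spanned_sets) (use n in auto)
    then show ?thesis
      by (rule spanned.cong) (simp add: contr_def f n sum_distrib_left)
  next
    case 3
    then show ?thesis by (rule mix)
  next
    case 4
    from mix[OF 4] show ?thesis by (simp add: contr_commute[OF times.prems(3)] insert_commute)
  qed
qed

lemma contr_spanned:
  assumes "spanned J K f" "c \<in> J" "d \<in> J" "c \<noteq> d"
  shows "spanned (J - {c, d}) K (contr c d f)"
proof (rule spanned_lift[where T = "contr c d", OF assms(1)])
  fix f g :: tuple_fun and u x assume "\<And>u x. imag u \<Longrightarrow> f u x = g u x" "imag u"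
  then show "contr c d f u x = contr c d g u x"
    unfolding contr_def by (intro sum.cong) (auto simp: imag_def)
qed (use contr_gen_product[OF _ assms(2-4)] in \<open>auto simp: contr_def sum.distrib sum_distrib_left\<close>)

section \<open>Eliminating spinor variables\<close>

text \<open>
  The tensor \<open>\<Sum>\<^sub>p e\<^sub>p \<otimes> e\<^sub>p\<close> of spinors is invariant because \<open>L\<^sub>w\<close> is orthogonal.
\<close>

lemma spinor_contraction_unit:
  fixes B :: "octonion \<Rightarrow> octonion \<Rightarrow> real"
  assumes l1: "\<And>y. linear (\<lambda>x. B x y)" and l2: "\<And>x. linear (\<lambda>y. B x y)" and w: "unit_im w"
  shows "(\<Sum>p\<in>UNIV. B (w \<odot> oct_e p) (w \<odot> oct_e p)) = (\<Sum>p\<in>UNIV. B (oct_e p) (oct_e p))"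
proof -
  have wi: "w \<in> Im_oct" using w by (simp add: unit_im_def)
  have B: "B x y = (\<Sum>i\<in>UNIV. \<Sum>j\<in>UNIV. (x $ i * y $ j) * B (oct_e i) (oct_e j))" for x y
  proof -
    have "B x y = (\<Sum>i\<in>UNIV. x $ i * B (oct_e i) y)"
      by (subst oct_expand[of x]) (simp only: linear_sum[OF l1] linear_scale[OF l1] real_scaleR_def)
    also have "\<dots> = (\<Sum>i\<in>UNIV. x $ i * (\<Sum>j\<in>UNIV. y $ j * B (oct_e i) (oct_e j)))"
    proof (intro sum.cong refl)
      fix i
      have "B (oct_e i) y = (\<Sum>j\<in>UNIV. y $ j * B (oct_e i) (oct_e j))"
        by (subst oct_expand[of y]) (simp only: linear_sum[OF l2] linear_scale[OF l2] real_scaleR_def)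
      then show "x $ i * B (oct_e i) y = x $ i * (\<Sum>j\<in>UNIV. y $ j * B (oct_e i) (oct_e j))" by simp
    qed
    finally show ?thesis by (simp only: sum_distrib_left mult.assoc)
  qed
  have o: "(\<Sum>p\<in>UNIV. (w \<odot> oct_e p) $ i * (w \<odot> oct_e p) $ j) = (if i = j then 1 else 0)" for i j
  proof -
    have s: "(w \<odot> oct_e p) $ i = - (w \<odot> oct_e i) $ p" for i p
      using inner_oct_mult_skew[OF wi, of "oct_e i" "oct_e p"] by simp
    have "(\<Sum>p\<in>UNIV. (w \<odot> oct_e p) $ i * (w \<odot> oct_e p) $ j) = (\<Sum>p\<in>UNIV. (w \<odot> oct_e i) $ p * (w \<odot> oct_e j) $ p)"
      unfolding s[of _ i] s[of _ j] by (simp only: minus_mult_minus)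
    then have "(\<Sum>p\<in>UNIV. (w \<odot> oct_e p) $ i * (w \<odot> oct_e p) $ j) = (w \<odot> oct_e i) \<bullet> (w \<odot> oct_e j)"
      by (simp add: inner_vec_def)
    then show ?thesis unfolding unit_mult_inner[OF w] by (simp add: oct_e_coords)
  qed
  have "(\<Sum>p\<in>UNIV. B (w \<odot> oct_e p) (w \<odot> oct_e p))
     = (\<Sum>i\<in>UNIV. \<Sum>j\<in>UNIV. \<Sum>p\<in>UNIV. ((w \<odot> oct_e p) $ i * (w \<odot> oct_e p) $ j) * B (oct_e i) (oct_e j))"
    unfolding B[of "w \<odot> oct_e _"] by (subst sum.swap) (intro sum.cong refl sum.swap)
  also have "\<dots> = (\<Sum>i\<in>UNIV. \<Sum>j\<in>UNIV. (if i = j then 1 else 0) * B (oct_e i) (oct_e j))"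
    by (simp only: sum_distrib_right[symmetric] o)
  also have "\<dots> = (\<Sum>p\<in>UNIV. B (oct_e p) (oct_e p))"
    by (intro sum.cong refl) (simp add: if_distrib[of "\<lambda>r. r * _"] cong: if_cong)
  finally show ?thesis .
qed

text \<open>
  The coefficient of \<open>\<langle>x\<^sub>2, L\<^sub>a\<^sub>1 \<dots> L\<^sub>a\<^sub>s x\<^sub>1\<rangle>\<close> in the Fierz expansion of \<open>f\<close> in two of its spinors.  The letters
  become new vector variables.
\<close>

definition spinor_trace :: "nat \<Rightarrow> nat \<Rightarrow> nat list \<Rightarrow> tuple_fun \<Rightarrow> tuple_fun" where
  "spinor_trace k1 k2 as f u x = (\<Sum>p\<in>UNIV. f u (x(k1 := oct_e p, k2 := wd u as (oct_e p))))"

lemma spinor_trace_invar: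
  assumes f: "invar J K f" and k: "k1 \<in> K" "k2 \<in> K" "k1 \<noteq> k2" and as: "distinct as" "set as \<inter> J = {}"
  shows "invar (J \<union> set as) (K - {k1, k2}) (spinor_trace k1 k2 as f)"
  unfolding invar_def
proof (intro conjI ballI allI impI)
  show "finite (J \<union> set as)" "finite (K - {k1, k2})" using invarD(1,2)[OF f] by auto
  show "depends_on (J \<union> set as) (K - {k1, k2}) (spinor_trace k1 k2 as f)"
    unfolding depends_on_def spinor_trace_def
  proof (intro allI impI sum.cong refl)
    fix u u' x x' :: "nat \<Rightarrow> octonion" and p
    assume u: "\<forall>j\<in>J \<union> set as. u j = u' j" and x: "\<forall>k\<in>K - {k1, k2}. x k = x' k"
    have "wd u as (oct_e p) = wd u' as (oct_e p)" by (rule wd_cong) (use u in auto)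
    then show "f u (x(k1 := oct_e p, k2 := wd u as (oct_e p))) = f u' (x'(k1 := oct_e p, k2 := wd u' as (oct_e p)))"
      by (intro depends_onD[OF invarD(3)[OF f]]) (use u x in auto)
  qed
  show "lin_at j (\<lambda>u. spinor_trace k1 k2 as f u x)" if j: "j \<in> J \<union> set as" for j x
    unfolding spinor_trace_def
  proof (rule lin_at_sum)
    fix p
    show "lin_at j (\<lambda>u. f u (x(k1 := oct_e p, k2 := wd u as (oct_e p))))"
    proof (cases "j \<in> J")
      case True
      then have n: "j \<notin> set as" using as by auto
      show ?thesis
        unfolding lin_at_def wd_upd_other[OF n] by (intro allI impI ballI lin_atD[OF invarD(4)[OF f True]])
    next
      case False
      then have ja: "j \<in> set as" using j by simp
      have fu: "f (u(j := v)) y = f u y" for u v y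
        by (rule depends_onD[OF invarD(3)[OF f]]) (use False in auto)
      show ?thesis
      proof (rule lin_atI)
        fix u assume "imag u"
        from linear_compose[OF wd_linear_at[OF ja as(1), of u "oct_e p"] invarD(5)[OF f k(2) this, of "x(k1 := oct_e p)"]]
        show "linear (\<lambda>v. f (u(j := v)) (x(k1 := oct_e p, k2 := wd (u(j := v)) as (oct_e p))))"
          unfolding fu by (simp only: o_def)
      qed
    qed
  qed
  show "linear (\<lambda>y. spinor_trace k1 k2 as f u (x(k := y)))" if "k \<in> K - {k1, k2}" "imag u" for k u x
    unfolding spinor_trace_def
  proof (intro linear_compose_sum ballI)
    fix p
    have "(x(k := y))(k1 := oct_e p, k2 := wd u as (oct_e p)) = (x(k1 := oct_e p, k2 := wd u as (oct_e p)))(k := y)" for y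
      using that by (auto simp: fun_eq_iff)
    then show "linear (\<lambda>y. f u ((x(k := y))(k1 := oct_e p, k2 := wd u as (oct_e p))))"
      using invarD(5)[OF f, of k u] that by simp
  qed
  show "half_turn_invariant (spinor_trace k1 k2 as f)"
    unfolding half_turn_invariant_def
  proof (intro allI impI)
    fix w u and x :: "nat \<Rightarrow> octonion" assume w: "unit_im w" and u: "imag u"
    let ?u = "\<lambda>j. half_turn w (u j)" and ?x = "\<lambda>k::nat. w \<odot> x k"
    have iu: "imag ?u" using half_turn_Im[OF w] u by (simp add: imag_def)
    have "spinor_trace k1 k2 as f ?u ?x = (\<Sum>p\<in>UNIV. f ?u (?x(k1 := w \<odot> oct_e p, k2 := wd ?u as (w \<odot> oct_e p))))"
      unfolding spinor_trace_def
    proof (rule spinor_contraction_unit[where B = "\<lambda>y z. f ?u (?x(k1 := y, k2 := wd ?u as z))", symmetric, OF _ _ w])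
      show "linear (\<lambda>y. f ?u (?x(k1 := y, k2 := wd ?u as z)))" for z
        unfolding fun_upd_twist[OF k(3), of ?x] by (rule invarD(5)[OF f k(1) iu])
      show "linear (\<lambda>z. f ?u (?x(k1 := y, k2 := wd ?u as z)))" for y
        using linear_compose[OF wd_linear invarD(5)[OF f k(2) iu, of "?x(k1 := y)"]] by (simp only: o_def)
    qed
    also have "\<dots> = spinor_trace k1 k2 as f u x"
      unfolding spinor_trace_def
    proof (intro sum.cong refl)
      fix p
      have "?x(k1 := w \<odot> oct_e p, k2 := wd ?u as (w \<odot> oct_e p)) = (\<lambda>k. w \<odot> (x(k1 := oct_e p, k2 := wd u as (oct_e p))) k)"
        unfolding wd_half_turn[OF w u] by (auto simp: fun_eq_iff)
      then show "f ?u (?x(k1 := w \<odot> oct_e p, k2 := wd ?u as (w \<odot> oct_e p))) = f u (x(k1 := oct_e p, k2 := wd u as (oct_e p)))"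
        using invarD(6)[OF f] w u unfolding half_turn_invariant_def by metis
    qed
    finally show "spinor_trace k1 k2 as f ?u ?x = spinor_trace k1 k2 as f u x" .
  qed
qed

text \<open>
  Applying \<open>L\<^sub>w\<close> twice acts as \<open>-1\<close> on spinors and trivially on vectors.
\<close>

lemma invar_one_spinor:
  assumes f: "invar J {k} f" and u: "imag u"
  shows "f u x = 0"
proof -
  \<comment> \<open>any unit vector would do\<close>
  have w: "unit_im (oct_e 1)" by (simp add: unit_im_def Im_oct_iff oct_e_coords)
  have i: "f (\<lambda>j. half_turn (oct_e 1) (u j)) (\<lambda>k. oct_e 1 \<odot> x k) = f u x" if "imag u" for u x
    using invarD(6)[OF f] w that unfolding half_turn_invariant_def by blast
  have r: "imag (\<lambda>j. half_turn (oct_e 1) (u j))" using half_turn_Im[OF w] u by (simp add: imag_def)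
  have sq: "oct_e 1 \<odot> (oct_e 1 \<odot> y) = - y" for y
    using Clifford_square[of "oct_e 1" y] w by (simp add: unit_im_def)
  have "f u x = f u (\<lambda>k. - x k)"
    using i[OF u, of x] i[OF r, of "\<lambda>k. oct_e 1 \<odot> x k"] by (simp add: half_turn_involution[OF w] sq)
  also have "\<dots> = f u (x(k := - x k))"
    by (rule depends_onD[OF invarD(3)[OF f]]) auto
  also have "\<dots> = - f u (x(k := x k))"
    by (rule linear_neg[OF invarD(5)[OF f _ u]]) simp
  finally show ?thesis by simp
qed

text \<open>
  The Fierz identity paired with a bilinear function, with the two spinors as first arguments.
\<close>

lemma Fierz_trace:
  fixes g :: "8 \<Rightarrow> octonion \<Rightarrow> real"
  assumes "\<And>p. linear (g p)"
  shows "48 * (\<Sum>p\<in>UNIV. x $ p * g p z) =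
     (\<Sum>c\<in>I7. \<Sum>b\<in>I7. \<Sum>a\<in>I7. (z \<bullet> (oct_e a \<odot> (oct_e b \<odot> (oct_e c \<odot> x)))) *
        (\<Sum>p\<in>UNIV. g p (oct_e a \<odot> (oct_e b \<odot> (oct_e c \<odot> oct_e p)))))
     + 3 * (\<Sum>b\<in>I7. \<Sum>a\<in>I7. (z \<bullet> (oct_e a \<odot> (oct_e b \<odot> x))) * (\<Sum>p\<in>UNIV. g p (oct_e a \<odot> (oct_e b \<odot> oct_e p))))
     - 13 * (\<Sum>a\<in>I7. (z \<bullet> (oct_e a \<odot> x)) * (\<Sum>p\<in>UNIV. g p (oct_e a \<odot> oct_e p)))
     - 15 * ((z \<bullet> x) * (\<Sum>p\<in>UNIV. g p (oct_e p)))"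
proof -
  have g: "g p y = (\<Sum>q\<in>UNIV. y $ q * g p (oct_e q))" for p y
    by (subst oct_expand[of y]) (simp only: linear_sum[OF assms] linear_scale[OF assms] real_scaleR_def)
  define L where "L X = (\<Sum>p\<in>UNIV. \<Sum>q\<in>UNIV. X p q * g p (oct_e q))" for X :: "8 \<Rightarrow> 8 \<Rightarrow> real"
  have Lsum: "L (\<lambda>p q. \<Sum>a\<in>I7. X a p q) = (\<Sum>a\<in>I7. L (X a))" for X
  proof -
    have "L (\<lambda>p q. \<Sum>a\<in>I7. X a p q) = (\<Sum>p\<in>UNIV. \<Sum>a\<in>I7. \<Sum>q\<in>UNIV. X a p q * g p (oct_e q))"
      unfolding L_def sum_distrib_right by (intro sum.cong refl sum.swap)
    also have "\<dots> = (\<Sum>a\<in>I7. L (X a))" unfolding L_def by (rule sum.swap)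
    finally show ?thesis .
  qed
  have L1: "L (\<lambda>p q. c * (oct_e q \<bullet> y p)) = c * (\<Sum>p\<in>UNIV. g p (y p))" for c y
    unfolding L_def g[of _ "y _"] by (simp add: sum_distrib_left mult.assoc)
  have lin: "L (\<lambda>p q. X3 p q + 3 * X2 p q - 13 * X1 p q - 15 * X0 p q) = L X3 + 3 * L X2 - 13 * L X1 - 15 * L X0" for X3 X2 X1 X0
    by (simp add: L_def left_diff_distrib distrib_right sum.distrib sum_subtractf sum_distrib_left mult.assoc)
  have "48 * (\<Sum>p\<in>UNIV. x $ p * g p z) = L (\<lambda>p q. 48 * ((x \<bullet> oct_e p) * (z \<bullet> oct_e q)))"
    unfolding L_def g[of _ z] by (simp add: sum_distrib_left mult.assoc)
  also have "\<dots> = L (\<lambda>p q. brackets3 x (oct_e p) z (oct_e q) + 3 * brackets2 x (oct_e p) z (oct_e q)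
      - 13 * brackets1 x (oct_e p) z (oct_e q) - 15 * ((z \<bullet> x) * (oct_e q \<bullet> oct_e p)))"
    unfolding Fierz ..
  finally show ?thesis unfolding lin brackets3_def brackets2_def brackets1_def Lsum L1 .
qed

text \<open>
  Two spinors are replaced by up to three contracted pairs of fresh vector variables: one partner of
  each pair occurs in a bracket of the two spinors, the other in an invariant of the remaining
  spinors, which lies in the span by induction.
\<close>

theorem invar_spanned: "invar J K f \<Longrightarrow> spanned J K f"
proof (induction "card K" arbitrary: J K f rule: less_induct)
  case less
  note f = less.prems
  have fin: "finite J" "finite K" using invarD(1,2)[OF f] .
  consider "K = {}" | k where "K = {k}" | k1 k2 where "k1 \<in> K" "k2 \<in> K" "k1 \<noteq> k2" by blast
  then show ?case
  proof cases
    case 1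
    then show ?thesis using FFT_vectors f by simp
  next
    case (2 k)
    show ?thesis by (rule spanned.cong[OF spanned.zero]) (use invar_one_spinor f 2 in auto)
  next
    case (3 k1 k2)
    \<comment> \<open>six letters outside \<open>J\<close>, one pair for each contraction\<close>
    define N where "N = Suc (Max (insert 0 J))"
    have N: "n \<notin> J" if "n \<ge> N" for n
    proof
      assume "n \<in> J"
      then have "n \<le> Max (insert 0 J)" using fin by simp
      then show False using that by (simp add: N_def)
    qed
    define a1 a2 a3 b1 b2 b3 where ab: "a1 = N" "a2 = N + 1" "a3 = N + 2" "b1 = N + 3" "b2 = N + 4" "b3 = N + 5"
    have dist: "distinct [a1, a2, a3, b1, b2, b3]" by (simp add: ab)
    have dist': "distinct [b3, b2, b1, a3, a2, a1]" using dist by auto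
    have nJ: "a1 \<notin> J" "a2 \<notin> J" "a3 \<notin> J" "b1 \<notin> J" "b2 \<notin> J" "b3 \<notin> J" by (simp_all add: ab N)
    have "card (K - {k1, k2}) < card K" using fin 3 by (intro psubset_card_mono) auto
    then have tr: "spanned (J \<union> set as) (K - {k1, k2}) (spinor_trace k1 k2 as f)"
      if "distinct as" "set as \<inter> J = {}" for as
      using less.hyps spinor_trace_invar[OF f 3 that] by blast
    define H where "H bs as u x = (x k2 \<bullet> wd u bs (x k1)) * spinor_trace k1 k2 as f u x" for bs as u x
    have H: "spanned (set bs \<union> set as \<union> J) K (H bs as)" if "distinct (as @ bs)" "(set as \<union> set bs) \<inter> J = {}" for as bs
    proof -
      have "spanned (set bs \<union> (J \<union> set as)) ({k2, k1} \<union> (K - {k1, k2})) (H bs as)"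
        unfolding H_def[abs_def] by (rule spanned_mult[OF spanned_bracket tr]) (use 3 that in auto)
      then show ?thesis by (rule spanned_sets) (use 3 in auto)
    qed
    have f_other: "f (u(j := v)) y = f u y" if "j \<notin> J" for u j v y
      by (rule depends_onD[OF invarD(3)[OF f]]) (use that in auto)
    let ?e = oct_e
    let ?g = "\<lambda>u x p y. f u (x(k1 := ?e p, k2 := y))"
    have 0: "spanned J K (H [] [])" using H[of "[]" "[]"] by simp
    have 1: "spanned J K (contr a1 b1 (H [b1] [a1]))"
      by (rule spanned_sets[OF contr_spanned[OF H]]) (use dist nJ in auto)
    have 2: "spanned J K (contr a2 b2 (contr a1 b1 (H [b1, b2] [a1, a2])))"
      by (rule spanned_sets[OF contr_spanned[OF contr_spanned[OF H]]]) (use dist nJ in auto)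
    have 3: "spanned J K (contr a3 b3 (contr a2 b2 (contr a1 b1 (H [b1, b2, b3] [a1, a2, a3]))))"
      by (rule spanned_sets[OF contr_spanned[OF contr_spanned[OF contr_spanned[OF H]]]]) (use dist nJ in auto)
    have e0: "H [] [] u x = (x k2 \<bullet> x k1) * (\<Sum>p\<in>UNIV. ?g u x p (?e p))" for u x
      by (simp add: H_def spinor_trace_def)
    have e1: "contr a1 b1 (H [b1] [a1]) u x = (\<Sum>a\<in>I7. (x k2 \<bullet> (?e a \<odot> x k1)) * (\<Sum>p\<in>UNIV. ?g u x p (?e a \<odot> ?e p)))" for u x
      unfolding contr_def H_def spinor_trace_def using dist dist' by (simp add: f_other nJ)
    have e2: "contr a2 b2 (contr a1 b1 (H [b1, b2] [a1, a2])) u x = (\<Sum>b\<in>I7. \<Sum>a\<in>I7. (x k2 \<bullet> (?e a \<odot> (?e b \<odot> x k1)))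
        * (\<Sum>p\<in>UNIV. ?g u x p (?e a \<odot> (?e b \<odot> ?e p))))" for u x
      unfolding contr_def H_def spinor_trace_def using dist dist' by (simp add: f_other nJ)
    have e3: "contr a3 b3 (contr a2 b2 (contr a1 b1 (H [b1, b2, b3] [a1, a2, a3]))) u x
      = (\<Sum>c\<in>I7. \<Sum>b\<in>I7. \<Sum>a\<in>I7. (x k2 \<bullet> (?e a \<odot> (?e b \<odot> (?e c \<odot> x k1))))
        * (\<Sum>p\<in>UNIV. ?g u x p (?e a \<odot> (?e b \<odot> (?e c \<odot> ?e p)))))" for u x
      unfolding contr_def H_def spinor_trace_def using dist dist' by (simp add: f_other nJ)
    from spanned_scale[OF spanned_diff[OF spanned_diff[OF spanned_add[OF 3 spanned_scale[OF 2, of 3]] spanned_scale[OF 1, of 13]] spanned_scale[OF 0, of 15]], of "1 / 48"]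
    show ?thesis
    proof (rule spanned.cong)
      fix u x :: "nat \<Rightarrow> octonion" assume u: "imag u"
      have lin: "linear (?g u x p)" for p
        by (rule invarD(5)[OF f \<open>k2 \<in> K\<close> u])
      have "(\<Sum>p\<in>UNIV. x k1 $ p * ?g u x p (x k2)) = f u x"
      proof -
        have tw: "x(k1 := y, k2 := x k2) = x(k1 := y)" for y using \<open>k1 \<noteq> k2\<close> by (auto simp: fun_eq_iff)
        have "f u (x(k1 := x k1)) = f u (x(k1 := \<Sum>p\<in>UNIV. x k1 $ p *\<^sub>R ?e p))" using oct_expand[of "x k1"] by simp
        also have "\<dots> = (\<Sum>p\<in>UNIV. x k1 $ p * f u (x(k1 := ?e p)))"
          by (simp only: linear_sum[OF invarD(5)[OF f \<open>k1 \<in> K\<close> u, of x]]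
              linear_scale[OF invarD(5)[OF f \<open>k1 \<in> K\<close> u, of x]] real_scaleR_def)
        finally show ?thesis unfolding tw by simp
      qed
      then show "1 / 48 * (contr a3 b3 (contr a2 b2 (contr a1 b1 (H [b1, b2, b3] [a1, a2, a3]))) u x
          + 3 * contr a2 b2 (contr a1 b1 (H [b1, b2] [a1, a2])) u x - 13 * contr a1 b1 (H [b1] [a1]) u x - 15 * H [] [] u x) = f u x"
        unfolding e0 e1 e2 e3 using Fierz_trace[of "?g u x" "x k1" "x k2", OF lin] by simp
    qed
  qed
qed

section \<open>The action of the whole group\<close>

lemma vector_rep_eq:
  assumes "bij g" "g (u \<odot> inv_into UNIV g (oct_e 0)) = v \<odot> g (inv_into UNIV g (oct_e 0))"
  shows "vector_rep g u = v"
  using assms by (simp add: vector_rep_def bij_is_surj surj_f_inv_f)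

text \<open>
  The properties of the generators \<open>L\<^sub>w\<close> that are stable under composition.  The intertwining relation
  makes the vector representation multiplicative.
\<close>

definition acts_on_invariants :: "(octonion \<Rightarrow> octonion) \<Rightarrow> bool" where
  "acts_on_invariants g \<longleftrightarrow> bij g \<and> (\<forall>u\<in>Im_oct. vector_rep g u \<in> Im_oct \<and> (\<forall>y. g (u \<odot> y) = vector_rep g u \<odot> g y))
     \<and> (\<forall>f u x. half_turn_invariant f \<longrightarrow> imag u \<longrightarrow> f (\<lambda>j. vector_rep g (u j)) (\<lambda>k. g (x k)) = f u x)"

lemma acts_on_invariantsD: "acts_on_invariants g \<Longrightarrow> half_turn_invariant f \<Longrightarrow> imag u \<Longrightarrow> f (\<lambda>j. vector_rep g (u j)) (\<lambda>k. g (x k)) = f u x"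
  by (simp add: acts_on_invariants_def)

lemma linear_oct_mult: "linear ((\<odot>) w)"
  by (intro linearI) (simp_all add: oct_mult_add_right oct_mult_scale_right)

lemma unit_mult_bij:
  assumes "unit_im w" shows "(\<odot>) w \<circ> (\<odot>) (- w) = id" "(\<odot>) (- w) \<circ> (\<odot>) w = id" "bij ((\<odot>) w)"
proof -
  have "w \<odot> (w \<odot> y) = - y" for y
    using Clifford_square[of w y] assms by (simp add: unit_im_def)
  then show 1: "(\<odot>) w \<circ> (\<odot>) (- w) = id" "(\<odot>) (- w) \<circ> (\<odot>) w = id"
    by (auto simp: fun_eq_iff oct_mult_neg_left oct_mult_neg_right)
  show "bij ((\<odot>) w)" by (rule o_bij[OF 1(2) 1(1)])
qed

lemma vector_rep_unit:
  assumes w: "unit_im w" and "u \<in> Im_oct"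
  shows "vector_rep ((\<odot>) w) u = half_turn w u"
  by (rule vector_rep_eq[OF unit_mult_bij(3)[OF w]]) (simp add: half_turn_mult[OF assms])

lemma acts_on_invariants_unit:
  assumes w: "unit_im w" shows "acts_on_invariants ((\<odot>) w)"
  unfolding acts_on_invariants_def
proof (intro conjI ballI allI impI)
  show "bij ((\<odot>) w)" by (rule unit_mult_bij[OF w])
  show "vector_rep ((\<odot>) w) u \<in> Im_oct" "w \<odot> (u \<odot> y) = vector_rep ((\<odot>) w) u \<odot> (w \<odot> y)" if "u \<in> Im_oct" for u y
    unfolding vector_rep_unit[OF w that] by (simp_all add: half_turn_Im half_turn_mult w that)
  fix f :: tuple_fun and u x assume "half_turn_invariant f" "imag u"
  moreover have "(\<lambda>j. vector_rep ((\<odot>) w) (u j)) = (\<lambda>j. half_turn w (u j))"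
    using vector_rep_unit[OF w] \<open>imag u\<close> by simp
  ultimately show "f (\<lambda>j. vector_rep ((\<odot>) w) (u j)) (\<lambda>k. w \<odot> x k) = f u x"
    using w unfolding half_turn_invariant_def by simp
qed

lemma acts_on_invariants_id: "acts_on_invariants id"
proof -
  have "vector_rep id u = u" for u by (simp add: vector_rep_def inv_id)
  then show ?thesis by (simp add: acts_on_invariants_def)
qed

lemma acts_on_invariants_comp:
  assumes g: "acts_on_invariants g" and h: "acts_on_invariants h" shows "acts_on_invariants (g \<circ> h)"
proof -
  have b: "bij (g \<circ> h)" using g h by (simp add: acts_on_invariants_def bij_comp)
  have v: "vector_rep (g \<circ> h) u = vector_rep g (vector_rep h u)" if "u \<in> Im_oct" for u
    by (rule vector_rep_eq[OF b]) (use g h that in \<open>simp add: acts_on_invariants_def\<close>)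
  show ?thesis
    unfolding acts_on_invariants_def
  proof (intro conjI ballI allI impI)
    show "vector_rep (g \<circ> h) u \<in> Im_oct" "(g \<circ> h) (u \<odot> y) = vector_rep (g \<circ> h) u \<odot> (g \<circ> h) y"
      if "u \<in> Im_oct" for u y
      unfolding v[OF that] using g h that by (simp_all add: acts_on_invariants_def)
    fix f :: tuple_fun and u x assume f: "half_turn_invariant f" and u: "imag u"
    have iu: "imag (\<lambda>j. vector_rep h (u j))" using h u by (simp add: acts_on_invariants_def imag_def)
    have "f (\<lambda>j. vector_rep (g \<circ> h) (u j)) (\<lambda>k. (g \<circ> h) (x k)) = f (\<lambda>j. vector_rep g (vector_rep h (u j))) (\<lambda>k. g (h (x k)))"
      using v u by simp
    also have "\<dots> = f (\<lambda>j. vector_rep h (u j)) (\<lambda>k. h (x k))"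
      by (rule acts_on_invariantsD[OF g f iu])
    also have "\<dots> = f u x" by (rule acts_on_invariantsD[OF h f u])
    finally show "f (\<lambda>j. vector_rep (g \<circ> h) (u j)) (\<lambda>k. (g \<circ> h) (x k)) = f u x" .
  qed (rule b)
qed

lemma unit_im_norm: "w \<in> Im_oct \<and> norm w = 1 \<longleftrightarrow> unit_im w"
  by (simp add: unit_im_def norm_eq_1)

lemma GL_inv_unit:
  assumes w: "unit_im w" shows "inv\<^bsub>GL_oct\<^esub> ((\<odot>) w) = (\<odot>) (- w)"
proof -
  have nw: "unit_im (- w)" using w by (simp add: unit_im_def Im_oct_iff)
  show ?thesis
    unfolding m_inv_def
  proof (rule the_equality)
    show "(\<odot>) (- w) \<in> carrier GL_oct \<and> (\<odot>) w \<otimes>\<^bsub>GL_oct\<^esub> (\<odot>) (- w) = \<one>\<^bsub>GL_oct\<^esub> \<and> (\<odot>) (- w) \<otimes>\<^bsub>GL_oct\<^esub> (\<odot>) w = \<one>\<^bsub>GL_oct\<^esub>"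
      using unit_mult_bij[OF w] unit_mult_bij(3)[OF nw] by (simp add: GL_oct_def linear_oct_mult)
    fix h assume "h \<in> carrier GL_oct \<and> (\<odot>) w \<otimes>\<^bsub>GL_oct\<^esub> h = \<one>\<^bsub>GL_oct\<^esub> \<and> h \<otimes>\<^bsub>GL_oct\<^esub> (\<odot>) w = \<one>\<^bsub>GL_oct\<^esub>"
    then have "h \<circ> (\<odot>) w = id" by (simp add: GL_oct_def)
    then have "h \<circ> ((\<odot>) w \<circ> (\<odot>) (- w)) = (\<odot>) (- w)" by (simp add: o_assoc)
    then show "h = (\<odot>) (- w)" unfolding unit_mult_bij(1)[OF w] by simp
  qed
qed

lemma Spin7_acts_on_invariants: "g \<in> Spin7 \<Longrightarrow> acts_on_invariants g"
  unfolding Spin7_def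
proof (induction rule: generate.induct)
  case one
  have "\<one>\<^bsub>GL_oct\<^esub> = id" by (simp add: GL_oct_def)
  then show ?case using acts_on_invariants_id by (simp only:)
next
  case (incl h)
  then show ?case using acts_on_invariants_unit unit_im_norm by auto
next
  case (inv h)
  then obtain w where w: "h = (\<odot>) w" "unit_im w" using unit_im_norm by auto
  then have "unit_im (- w)" by (simp add: unit_im_def Im_oct_iff)
  then show ?case unfolding w(1) GL_inv_unit[OF w(2)] by (rule acts_on_invariants_unit)
next
  case (eng h1 h2)
  have "h1 \<otimes>\<^bsub>GL_oct\<^esub> h2 = h1 \<circ> h2" by (simp add: GL_oct_def)
  then show ?case using acts_on_invariants_comp[OF eng.IH] by (simp only:)
qed

lemma unit_in_Spin7: "unit_im w \<Longrightarrow> (\<odot>) w \<in> Spin7"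
  unfolding Spin7_def by (rule generate.incl) (use unit_im_norm in auto)

lemma u_tuplesD: "u \<in> u_tuples l \<Longrightarrow> j \<in> {1..l} \<Longrightarrow> u j \<in> Im_oct"
  by (auto simp: u_tuples_def)

lemma u_tuples_upd: "u \<in> u_tuples l \<Longrightarrow> j \<in> {1..l} \<Longrightarrow> v \<in> Im_oct \<Longrightarrow> u(j := v) \<in> u_tuples l"
  unfolding u_tuples_def by (auto simp: PiE_def extensional_def)

lemma x_tuples_upd: "x \<in> x_tuples m \<Longrightarrow> k \<in> {1..m} \<Longrightarrow> x(k := y) \<in> x_tuples m"
  unfolding x_tuples_def by (auto simp: PiE_def extensional_def)

text \<open>
  Tuples are undefined outside their index range; the extension by \<open>0\<close> is imaginary everywhere.
\<close>

definition zero_ext :: "nat \<Rightarrow> (nat \<Rightarrow> octonion) \<Rightarrow> nat \<Rightarrow> octonion" where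
  "zero_ext l u j = (if j \<in> {1..l} then u j else 0)"

lemma imag_zero_ext: "u \<in> u_tuples l \<Longrightarrow> imag (zero_ext l u)"
  using u_tuplesD by (auto simp: imag_def zero_ext_def Im_oct_iff)

lemma gen_product_invariant:
  assumes p: "gen_product {1..l} {1..m} p"
  shows "restrict_tuples l m p \<in> invariant_space l m"
proof -
  have d: "depends_on {1..l} {1..m} p" and ml: "mlinear {1..l} {1..m} p" using gen_product_mlinear[OF p] by auto
  have r: "restrict_tuples l m p u x = p u x" if "u \<in> u_tuples l" "x \<in> x_tuples m" for u x
    using that by (simp add: restrict_tuples_def)
  have lu: "linear (\<lambda>v. p (u(j := v)) x)" if "j \<in> {1..l}" for j u x using ml that unfolding mlinear_def by blast
  have lx: "linear (\<lambda>y. p u (x(k := y)))" if "k \<in> {1..m}" for k u x using ml that unfolding mlinear_def by blast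
  have "multilinear_fun l m (restrict_tuples l m p)"
    unfolding multilinear_fun_def
  proof (intro ballI conjI allI)
    fix u x j v w c assume u: "u \<in> u_tuples l" and x: "x \<in> x_tuples m" and j: "j \<in> {1..l}" and v: "v \<in> Im_oct"
    have cv: "c *\<^sub>R v \<in> Im_oct" using v by (simp add: Im_oct_iff)
    show "restrict_tuples l m p (u(j := c *\<^sub>R v)) x = c * restrict_tuples l m p (u(j := v)) x"
      unfolding r[OF u_tuples_upd[OF u j v] x] r[OF u_tuples_upd[OF u j cv] x]
      using linear_scale[OF lu[OF j]] by simp
    assume w: "w \<in> Im_oct"
    have vw: "v + w \<in> Im_oct" using v w by (simp add: Im_oct_iff)
    show "restrict_tuples l m p (u(j := v + w)) x = restrict_tuples l m p (u(j := v)) x + restrict_tuples l m p (u(j := w)) x"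
      unfolding r[OF u_tuples_upd[OF u j v] x] r[OF u_tuples_upd[OF u j w] x] r[OF u_tuples_upd[OF u j vw] x]
      by (rule linear_add[OF lu[OF j]])
  next
    fix u x k assume "u \<in> u_tuples l" "x \<in> x_tuples m" "k \<in> {1..m}"
    then show "linear (\<lambda>y. restrict_tuples l m p u (x(k := y)))"
      using lx r x_tuples_upd by simp
  qed
  moreover have "Spin7_invariant l m (restrict_tuples l m p)"
    unfolding Spin7_invariant_def
  proof (intro ballI)
    fix g u x assume g: "g \<in> Spin7" and u: "u \<in> u_tuples l" and x: "x \<in> x_tuples m"
    note gg = Spin7_acts_on_invariants[OF g]
    have "(\<lambda>j\<in>{1..l}. vector_rep g (u j)) \<in> u_tuples l"
      using gg u_tuplesD[OF u] by (auto simp: u_tuples_def acts_on_invariants_def)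
    moreover have "(\<lambda>k\<in>{1..m}. g (x k)) \<in> x_tuples m" by (auto simp: x_tuples_def)
    ultimately have "restrict_tuples l m p (\<lambda>j\<in>{1..l}. vector_rep g (u j)) (\<lambda>k\<in>{1..m}. g (x k))
       = p (\<lambda>j\<in>{1..l}. vector_rep g (u j)) (\<lambda>k\<in>{1..m}. g (x k))" by (rule r)
    also have "\<dots> = p (\<lambda>j. vector_rep g (zero_ext l u j)) (\<lambda>k. g (x k))"
      by (rule depends_onD[OF d]) (auto simp: zero_ext_def)
    also have "\<dots> = p (zero_ext l u) x"
      by (rule acts_on_invariantsD[OF gg gen_product_half_turn_invariant[OF p] imag_zero_ext[OF u]])
    also have "\<dots> = p u x" by (rule depends_onD[OF d]) (auto simp: zero_ext_def)
    finally show "restrict_tuples l m p (\<lambda>j\<in>{1..l}. vector_rep g (u j)) (\<lambda>k\<in>{1..m}. g (x k)) = restrict_tuples l m p u x"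
      using r[OF u x] by simp
  qed
  moreover have "restrict_tuples l m (restrict_tuples l m p) = restrict_tuples l m p"
    by (auto simp: restrict_tuples_def fun_eq_iff)
  ultimately show ?thesis by (simp add: invariant_space_def)
qed

lemma sum_Im: "(\<And>i. i \<in> A \<Longrightarrow> h i \<in> Im_oct) \<Longrightarrow> sum h A \<in> Im_oct"
  by (simp add: Im_oct_iff)

lemma invariant_space_invar:
  assumes f: "f \<in> invariant_space l m"
  shows "invar {1..l} {1..m} (\<lambda>u x. f (restrict u {1..l}) (restrict x {1..m}))"
proof -
  have ml: "multilinear_fun l m f" and sp: "Spin7_invariant l m f" using f by (auto simp: invariant_space_def)
  have ru: "restrict u {1..l} \<in> u_tuples l" if "imag u" for u using that by (auto simp: u_tuples_def)
  have rx: "restrict x {1..m} \<in> x_tuples m" for x by (auto simp: x_tuples_def)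
  have ud: "restrict (u(j := v)) {1..l} = (restrict u {1..l})(j := v)" if "j \<in> {1..l}" for u :: "nat \<Rightarrow> octonion" and j v
    using that by (auto simp: fun_eq_iff)
  have xd: "restrict (x(j := v)) {1..m} = (restrict x {1..m})(j := v)" if "j \<in> {1..m}" for x :: "nat \<Rightarrow> octonion" and j v
    using that by (auto simp: fun_eq_iff)
  show ?thesis
    unfolding invar_def
  proof (intro conjI ballI allI impI)
    show "depends_on {1..l} {1..m} (\<lambda>u x. f (restrict u {1..l}) (restrict x {1..m}))"
      unfolding depends_on_def
    proof (intro allI impI)
      fix u u' x x' :: "nat \<Rightarrow> octonion" assume "\<forall>j\<in>{1..l}. u j = u' j" "\<forall>k\<in>{1..m}. x k = x' k"
      then have "restrict u {1..l} = restrict u' {1..l}" "restrict x {1..m} = restrict x' {1..m}" by (auto simp: fun_eq_iff)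
      then show "f (restrict u {1..l}) (restrict x {1..m}) = f (restrict u' {1..l}) (restrict x' {1..m})" by simp
    qed
    show "lin_at j (\<lambda>u. f (restrict u {1..l}) (restrict x {1..m}))" if j: "j \<in> {1..l}" for j x
      unfolding lin_at_def ud[OF j]
    proof (intro allI impI ballI)
      fix u v assume u: "imag u" and v: "v \<in> Im_oct"
      define h where "h v = f ((restrict u {1..l})(j := v)) (restrict x {1..m})" for v
      have ha: "h (p + q) = h p + h q" if "p \<in> Im_oct" "q \<in> Im_oct" for p q
        using ml ru[OF u] rx[of x] j that unfolding multilinear_fun_def h_def by blast
      have hs: "h (c *\<^sub>R p) = c * h p" if "p \<in> Im_oct" for c p
        using ml ru[OF u] rx[of x] j that unfolding multilinear_fun_def h_def by blast
      have z: "(0::octonion) \<in> Im_oct" by (simp add: Im_oct_iff)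
      have h0: "h 0 = 0" using hs[OF z, of 0] by simp
      have sI: "c *\<^sub>R oct_e a \<in> Im_oct" if "a \<in> I7" for a c using Im_comb[OF oct_e_Im[OF that] z, of c 0] by simp
      have "h (\<Sum>a\<in>A. v $ a *\<^sub>R oct_e a) = (\<Sum>a\<in>A. v $ a * h (oct_e a))" if "finite A" "A \<subseteq> I7" for A
        using that
      proof (induction A rule: finite_induct)
        case empty
        then show ?case by (simp add: h0)
      next
        case (insert a A)
        then have a: "a \<in> I7" and A: "(\<Sum>a\<in>A. v $ a *\<^sub>R oct_e a) \<in> Im_oct" by (auto intro!: sum_Im sI)
        show ?case using insert by (simp add: ha[OF sI[OF a] A] hs[OF oct_e_Im[OF a]])
      qed
      from this[OF finite_I7 order.refl]
      have "h v = (\<Sum>a\<in>I7. v $ a * h (oct_e a))" using Im_oct_expand[OF v] by metis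
      then show "f ((restrict u {1..l})(j := v)) (restrict x {1..m})
        = (\<Sum>a\<in>I7. v $ a * f ((restrict u {1..l})(j := oct_e a)) (restrict x {1..m}))" unfolding h_def .
    qed
    show "linear (\<lambda>y. f (restrict u {1..l}) (restrict (x(k := y)) {1..m}))" if "k \<in> {1..m}" "imag u" for k u x
      unfolding xd[OF that(1)] using ml ru[OF that(2)] rx[of x] that(1) unfolding multilinear_fun_def by blast
    show "half_turn_invariant (\<lambda>u x. f (restrict u {1..l}) (restrict x {1..m}))"
      unfolding half_turn_invariant_def
    proof (intro allI impI)
      fix w u and x :: "nat \<Rightarrow> octonion" assume w: "unit_im w" and u: "imag u"
      have "f (\<lambda>j\<in>{1..l}. vector_rep ((\<odot>) w) (restrict u {1..l} j)) (\<lambda>k\<in>{1..m}. w \<odot> restrict x {1..m} k)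
        = f (restrict u {1..l}) (restrict x {1..m})"
        using sp unit_in_Spin7[OF w] ru[OF u] rx[of x] unfolding Spin7_invariant_def by blast
      moreover have "(\<lambda>j\<in>{1..l}. vector_rep ((\<odot>) w) (restrict u {1..l} j)) = restrict (\<lambda>j. half_turn w (u j)) {1..l}"
        using vector_rep_unit[OF w] u by (auto simp: fun_eq_iff)
      moreover have "(\<lambda>k\<in>{1..m}. w \<odot> restrict x {1..m} k) = restrict (\<lambda>k. w \<odot> x k) {1..m}"
        by (auto simp: fun_eq_iff)
      ultimately show "f (restrict (\<lambda>j. half_turn w (u j)) {1..l}) (restrict (\<lambda>k. w \<odot> x k) {1..m})
        = f (restrict u {1..l}) (restrict x {1..m})" by simp
    qed
  qed simp_all
qed

section \<open>The theorem\<close>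

interpretation tuple_fun: module "\<lambda>(c::real) (f::tuple_fun) u x. c * f u x"
  by unfold_locales (auto simp: fun_eq_iff algebra_simps)

lemma subspace_invariant_space: "tuple_fun.subspace (invariant_space l m)"
  unfolding tuple_fun.subspace_def
proof (intro conjI ballI allI)
  have "restrict_tuples l m 0 = 0" by (auto simp: restrict_tuples_def fun_eq_iff)
  then show "0 \<in> invariant_space l m"
    by (auto simp: invariant_space_def multilinear_fun_def Spin7_invariant_def linear_zero intro!: linearI)
next
  fix f g :: tuple_fun assume fg: "f \<in> invariant_space l m" "g \<in> invariant_space l m"
  have "restrict_tuples l m (f + g) u x = restrict_tuples l m f u x + restrict_tuples l m g u x" for u x
    by (simp add: restrict_tuples_def)
  then have "restrict_tuples l m (f + g) = f + g" using fg by (auto simp: invariant_space_def fun_eq_iff)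
  then show "f + g \<in> invariant_space l m"
    using fg by (auto simp: invariant_space_def multilinear_fun_def Spin7_invariant_def distrib_left intro: linear_compose_add)
next
  fix c :: real and f :: tuple_fun assume f: "f \<in> invariant_space l m"
  have "restrict_tuples l m (\<lambda>u x. c * f u x) u x = c * restrict_tuples l m f u x" for u x
    by (simp add: restrict_tuples_def)
  then have "restrict_tuples l m (\<lambda>u x. c * f u x) = (\<lambda>u x. c * f u x)" using f by (auto simp: invariant_space_def fun_eq_iff)
  moreover have "linear g \<Longrightarrow> linear (\<lambda>y. c * g y)" for g :: "octonion \<Rightarrow> real"
    using linear_compose_scale_right[of g c] by simp
  ultimately show "(\<lambda>u x. c * f u x) \<in> invariant_space l m"
    using f by (auto simp: invariant_space_def multilinear_fun_def Spin7_invariant_def distrib_left)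
qed

lemma spanned_span:
  assumes "spanned {1..l} {1..m} f"
  shows "(\<lambda>u x. if u \<in> u_tuples l \<and> x \<in> x_tuples m then f (zero_ext l u) x else 0)
    \<in> span_fun {restrict_tuples l m p | p. gen_product {1..l} {1..m} p}"
  using assms unfolding span_fun_def
proof induction
  case zero
  show ?case using tuple_fun.span_zero by (simp add: zero_fun_def)
next
  case (step f p c)
  have "p (zero_ext l u) x = p u x" for u x
    using gen_product_mlinear[OF step.hyps(2)] by (intro depends_onD[of "{1..l}" "{1..m}"]) (auto simp: zero_ext_def)
  then have eq: "(\<lambda>u x. if u \<in> u_tuples l \<and> x \<in> x_tuples m then c * p (zero_ext l u) x + f (zero_ext l u) x else 0)
     = (\<lambda>u x. c * restrict_tuples l m p u x) + (\<lambda>u x. if u \<in> u_tuples l \<and> x \<in> x_tuples m then f (zero_ext l u) x else 0)"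
    by (auto simp: fun_eq_iff restrict_tuples_def)
  have "restrict_tuples l m p \<in> {restrict_tuples l m p | p. gen_product {1..l} {1..m} p}"
    using step.hyps(2) by blast
  from tuple_fun.span_add[OF tuple_fun.span_scale[OF tuple_fun.span_base[OF this], of c] step.IH]
  show ?case unfolding eq .
next
  case (cong f g)
  have "(\<lambda>u x. if u \<in> u_tuples l \<and> x \<in> x_tuples m then f (zero_ext l u) x else 0)
    = (\<lambda>u x. if u \<in> u_tuples l \<and> x \<in> x_tuples m then g (zero_ext l u) x else 0)"
    by (intro ext if_cong refl cong.hyps(2) imag_zero_ext) simp
  then show ?case using cong.IH by simp
qed

theorem theorem4p8:
  fixes l m :: nat
  shows "invariant_space l m =
    span_fun {restrict_tuples l m p | p. gen_product {1..l} {1..m} p}"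
proof
  show "span_fun {restrict_tuples l m p | p. gen_product {1..l} {1..m} p} \<subseteq> invariant_space l m"
    unfolding span_fun_def
    by (rule tuple_fun.span_minimal[OF _ subspace_invariant_space]) (auto intro: gen_product_invariant)
  show "invariant_space l m \<subseteq> span_fun {restrict_tuples l m p | p. gen_product {1..l} {1..m} p}"
  proof
    fix f assume f: "f \<in> invariant_space l m"
    have "f = (\<lambda>u x. if u \<in> u_tuples l \<and> x \<in> x_tuples m
        then f (restrict (zero_ext l u) {1..l}) (restrict x {1..m}) else 0)"
    proof (intro ext)
      fix u x
      have "restrict (zero_ext l u) {1..l} = u" if "u \<in> u_tuples l"
        using that by (auto simp: fun_eq_iff zero_ext_def u_tuples_def PiE_def extensional_def)
      moreover have "restrict x {1..m} = x" if "x \<in> x_tuples m"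
        using that by (auto simp: fun_eq_iff x_tuples_def PiE_def extensional_def)
      moreover have "f u x = (if u \<in> u_tuples l \<and> x \<in> x_tuples m then f u x else 0)"
      proof -
        have "f = restrict_tuples l m f" using f by (simp add: invariant_space_def)
        from fun_cong[OF fun_cong[OF this, of u], of x] show ?thesis by (simp only: restrict_tuples_def)
      qed
      ultimately show "f u x = (if u \<in> u_tuples l \<and> x \<in> x_tuples m
        then f (restrict (zero_ext l u) {1..l}) (restrict x {1..m}) else 0)"
        by (cases "u \<in> u_tuples l \<and> x \<in> x_tuples m") (simp_all only: if_True if_False simp_thms)
    qed
    also have "\<dots> \<in> span_fun {restrict_tuples l m p | p. gen_product {1..l} {1..m} p}"
      by (rule spanned_span[OF invar_spanned[OF invariant_space_invar[OF f]]])
    finally show "f \<in> span_fun {restrict_tuples l m p | p. gen_product {1..l} {1..m} p}" .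
  qed
qed

end
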